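(* For every $\varepsilon>0$, the energy functional $\mathcal E_\varepsilon$ possesses a global minimizer $\bar\rho^\varepsilon$ over $\mathcal P_2(\mathbb R)$ which is radially decreasing about $0$, has bounded support and lies in $C^1(\mathbb R)$.
   Context: Standing assumptions: $\lambda>0$ is fixed, and $h:[0,\infty)\to\mathbb R$ is a fixed function with $h\in C^2([0,\infty))\cap C^4((0,\infty))$, $h(0)=h'(0)=0$, such that for some constant $A<+\infty$, $|h''(r)|\le\frac A2\min\{\frac1{\sqrt r},\sqrt r\}$ for all $r>0$, and such that for every $H<+\infty$ there is a constant $L_H$ with $|h^{(4)}(r)|\le\frac{L_H}{8r^{3/2}}$ for $0<r\le H$. $\mathcal P_2(\mathbb R)$ is the set of probability measures on $\mathbb R$ with finite second moment; absolutely continuous measures are identified with their densities. The energy is $$\mathcal E_\varepsilon(\rho)=\int_{\mathbb R}\left[\tfrac12\rho_x^2+\tfrac\lambda2x^2\rho+\varepsilon h(\rho)\right]dx\ \text{ if }\rho\in H^1(\mathbb R),\qquad \mathcal E_\varepsilon(\rho)=+\infty\ \text{ otherwise},$$ for $\rho\in\mathcal P_2(\mathbb R)$. A density is radially decreasing about $0$ if it is even and non-increasing on $[0,\infty)$. *)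

theory Defs
  imports "HOL-Probability.Probability"
begin

text \<open>Derivatives are taken within \<open>S\<close>, so on \<open>{0..}\<close> they are one-sided at \<open>0\<close>; \<open>D j\<close> is the
  \<open>j\<close>-th derivative.\<close>

definition Ck_on :: "nat \<Rightarrow> real set \<Rightarrow> (real \<Rightarrow> real) \<Rightarrow> bool" where
  "Ck_on k S f \<longleftrightarrow>
     (\<exists>D :: nat \<Rightarrow> real \<Rightarrow> real. D 0 = f \<and>
        (\<forall>j<k. \<forall>x\<in>S. (D j has_real_derivative D (Suc j) x) (at x within S)) \<and>
        (\<forall>j\<le>k. continuous_on S (D j)))"

definition test_functions :: "(real \<Rightarrow> real) set" where
  "test_functions = {\<phi>. (\<forall>k. Ck_on k UNIV \<phi>) \<and> compact (closure {x. \<phi> x \<noteq> 0})}"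

definition locally_integrable :: "(real \<Rightarrow> real) \<Rightarrow> bool" where
  "locally_integrable f \<longleftrightarrow> (\<forall>K. compact K \<longrightarrow> set_integrable lborel K f)"

definition has_weak_derivative :: "(real \<Rightarrow> real) \<Rightarrow> (real \<Rightarrow> real) \<Rightarrow> bool" where
  "has_weak_derivative f g \<longleftrightarrow> locally_integrable f \<and> locally_integrable g \<and>
     (\<forall>\<phi>\<in>test_functions. (LINT x|lborel. f x * deriv \<phi> x) = - (LINT x|lborel. g x * \<phi> x))"

text \<open>Weak derivatives are unique only up to null sets; \<open>weak_deriv\<close> picks a representative and is
  used only under integrals.\<close>

definition weak_deriv :: "(real \<Rightarrow> real) \<Rightarrow> real \<Rightarrow> real" where
  "weak_deriv f = (SOME g. has_weak_derivative f g)"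

definition L2 :: "(real \<Rightarrow> real) set" where
  "L2 = {f. f \<in> borel_measurable lborel \<and> integrable lborel (\<lambda>x. (f x)\<^sup>2)}"

definition H1 :: "(real \<Rightarrow> real) set" where
  "H1 = {f. f \<in> L2 \<and> (\<exists>g\<in>L2. has_weak_derivative f g)}"

definition P2 :: "real measure set" where
  "P2 = {M. prob_space M \<and> sets M = sets borel \<and> integrable M (\<lambda>x. x\<^sup>2)}"

definition density_of :: "real measure \<Rightarrow> real \<Rightarrow> real" where
  "density_of M x = enn2real (RN_deriv lborel M x)"

text \<open>For \<open>M \<in> P2\<close> with density in \<open>H1\<close> and \<open>h\<close> as in the standing assumptions, each of the three
  terms is integrable: \<open>\<bar>h r\<bar>\<close> is bounded by a constant times \<open>r\<close> on bounded intervals, and the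
  density is bounded and integrable. Hence the Bochner integral is the intended one.\<close>

definition energy :: "real \<Rightarrow> (real \<Rightarrow> real) \<Rightarrow> real \<Rightarrow> real measure \<Rightarrow> ereal" where
  "energy lam h eps M =
     (if absolutely_continuous lborel M \<and> density_of M \<in> H1
      then ereal (LINT x|lborel. 1/2 * (weak_deriv (density_of M) x)\<^sup>2
                    + lam/2 * x\<^sup>2 * density_of M x + eps * h (density_of M x))
      else \<infinity>)"

definition radially_decreasing :: "(real \<Rightarrow> real) \<Rightarrow> bool" where
  "radially_decreasing f \<longleftrightarrow> (\<forall>x. f (- x) = f x) \<and> antimono_on {0..} f"

end

theory Submission
  imports Defs "HOL-Computational_Algebra.Polynomial" "HOL-Complex_Analysis.Great_Picard"
begin

text \<open>The minimizer is obtained by the direct method, and its symmetry and regularity are then read off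
from its minimality.

On the line, a density in \<open>H1\<close> is almost everywhere a primitive of a square-integrable function
(\<open>du_bois_reymond\<close>). So the energy of a measure becomes a functional \<open>J u g\<close> of a continuous density
\<open>u\<close> together with its derivative \<open>g\<close>, and weak derivatives disappear from the argument
(\<open>profile_energy\<close>, \<open>energy_finite_imp_profile\<close>). The function \<open>h\<close> enters through the quadratic
Taylor bound \<open>\<bar>h b - h a - h' a * (b - a)\<bar> \<le> K * (b - a)\<^sup>2\<close>.

Existence. A profile of mass one satisfies \<open>u\<^sup>3 \<le> 8 (\<integral>g\<^sup>2 + 1)\<close>, so that \<open>\<integral>\<bar>h u\<bar> \<le> K \<integral>u\<^sup>2\<close> is of lower
order than \<open>\<integral>g\<^sup>2\<close> and \<open>J\<close> is coercive. A minimizing sequence is bounded and equi-Hoelder, hence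
converges pointwise along a subsequence; the confining potential prevents mass from escaping, so the
limit is again of mass one and the convergence holds in \<open>L\<^sup>1\<close>. The confinement energy is linear in
\<open>u\<close> and the Dirichlet energy is quadratic in \<open>g\<close>: comparing \<open>J\<close> at the midpoint of two members of
the sequence with the infimum therefore bounds \<open>\<integral>(g\<^sub>i - g\<^sub>j)\<^sup>2\<close> by quantities that tend to zero
(\<open>J_midpoint\<close>). The derivatives are Cauchy in \<open>L\<^sup>2\<close>, and Fatou's lemma finishes the proof of
\<open>minimizer_exists\<close>.

Symmetry. Let \<open>a > 0\<close> and suppose that \<open>u (2 a - x) > u x\<close> for some \<open>x < a\<close>. On the connected
component of the set of such \<open>x\<close>, interchange \<open>u\<close> with its reflection about \<open>a\<close>. The result
is continuous because the two agree at the end points, and it has the same mass, Dirichlet energy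
and \<open>h\<close>-energy; but larger values have moved to the side of \<open>a\<close> that contains the origin, so that
the confinement energy has dropped. Hence \<open>u (2 a - x) \<le> u x\<close> for all \<open>x < a\<close>, and this for all
\<open>a > 0\<close>, together with the mirror image for \<open>a < 0\<close>, says that \<open>u\<close> is even and non-increasing on
\<open>{0..}\<close>.

Regularity. Perturb the minimizer by multiples of tent functions and renormalize the mass. With \<open>Z\<close>
a second antiderivative of \<open>lam/2 x\<^sup>2 + eps h' (u x) - \<mu>\<close>, the resulting inequalities say precisely
that \<open>u - Z\<close> has non-increasing chord slopes, and that they are constant where \<open>u > 0\<close>
(\<open>slopes_concave\<close>). If \<open>u\<close> were positive everywhere, then \<open>u''\<close> would be at least \<open>1\<close> far out, which
is impossible for a non-increasing function. So \<open>u\<close> is positive exactly on some interval from \<open>- R\<close>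
to \<open>R\<close>, and there it equals the \<open>C\<^sup>2\<close> function \<open>y = Z +\<close> affine. Concavity of \<open>u - Z\<close> across \<open>\<plusminus> R\<close>
gives \<open>y \<ge> 0\<close> on both sides of \<open>\<plusminus> R\<close>, where \<open>y = 0\<close>; hence \<open>y' = 0\<close> there and \<open>u\<close> is \<open>C\<^sup>1\<close>.\<close>

section \<open>Smooth bump functions\<close>

text \<open>The powers of \<open>t\<close> in the denominator make the family closed under differentiation, up to linear
combinations. The parameter \<open>c\<close> later tends to zero, which turns a bump into an indicator function.\<close>

definition flat_exp :: "real \<Rightarrow> nat \<Rightarrow> real \<Rightarrow> real" where
  "flat_exp c k t = (if t > 0 then exp (- c / t) / t ^ k else 0)"

lemma flat_exp_tendsto_0:
  assumes "c > 0"
  shows "(flat_exp c k \<longlongrightarrow> 0) (at 0)"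
proof -
  have lim: "filterlim (\<lambda>t::real. c / t) at_top (at_right 0)"
    using filterlim_tendsto_pos_mult_at_top[OF tendsto_const assms filterlim_inverse_at_top_right]
    by (simp add: divide_inverse)
  have "((\<lambda>t. (c / t) ^ k / exp (c / t)) \<longlongrightarrow> 0) (at_right 0)"
    by (rule filterlim_compose[OF tendsto_power_div_exp_0 lim])
  then have "((\<lambda>t. (c / t) ^ k / exp (c / t) / c ^ k) \<longlongrightarrow> 0) (at_right 0)"
    by (rule tendsto_divide_zero)
  moreover have "\<forall>\<^sub>F t in at_right 0. (c / t) ^ k / exp (c / t) / c ^ k = flat_exp c k t"
    using assms by (intro eventually_at_right_less[THEN eventually_mono])
      (simp add: flat_exp_def power_divide exp_minus field_simps)
  ultimately have r: "(flat_exp c k \<longlongrightarrow> 0) (at_right 0)"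
    by (rule Lim_transform_eventually)
  have l: "(flat_exp c k \<longlongrightarrow> 0) (at_left 0)"
    by (rule Lim_transform_eventually[OF tendsto_const])
      (simp add: flat_exp_def eventually_at_filter)
  show ?thesis using l r by (simp add: filterlim_split_at)
qed

lemma flat_exp_has_derivative:
  assumes "c > 0"
  shows "(flat_exp c k has_real_derivative
           c * flat_exp c (k + 2) t - real k * flat_exp c (k + 1) t) (at t)"
proof -
  consider "t > 0" | "t < 0" | "t = 0" by linarith
  then show ?thesis
  proof cases
    case 1
    have "((\<lambda>t. exp (- c / t) / t ^ k) has_real_derivative
           c * flat_exp c (k + 2) t - real k * flat_exp c (k + 1) t) (at t)"
    proof (cases k)
      case 0
      then show ?thesis using 1 by (auto intro!: derivative_eq_intros
        simp: flat_exp_def field_simps power2_eq_square)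
    next
      case (Suc n)
      have "((\<lambda>t. exp (- c / t) / t ^ k) has_real_derivative
          (exp (- c / t) * (c / t\<^sup>2) * t ^ k - exp (- c / t) * (real k * t ^ n)) / (t ^ k * t ^ k)) (at t)"
      proof -
        have "((\<lambda>t. t ^ k) has_real_derivative real k * t ^ n) (at t)"
          using DERIV_pow[of k t] Suc by (simp del: power_Suc)
        moreover have "((\<lambda>t. exp (- c / t)) has_real_derivative exp (- c / t) * (c / t\<^sup>2)) (at t)"
          using 1 by (auto intro!: derivative_eq_intros simp: power2_eq_square)
        ultimately show ?thesis
          using 1 by (intro DERIV_divide) auto
      qed
      moreover have "(exp (- c / t) * (c / t\<^sup>2) * t ^ k - exp (- c / t) * (real k * t ^ n)) / (t ^ k * t ^ k)
         = c * flat_exp c (k + 2) t - real k * flat_exp c (k + 1) t"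
        using 1 by (simp add: Suc flat_exp_def field_simps power2_eq_square)
      ultimately show ?thesis by simp
    qed
    then show ?thesis
      by (rule DERIV_cong_ev[THEN iffD1, rotated -1, OF _ refl _ refl])
        (use 1 in \<open>auto simp: flat_exp_def intro: eventually_mono[OF eventually_nhds_in_open[of "{0<..}"]]\<close>)
  next
    case 2
    have "((\<lambda>_. 0) has_real_derivative
           c * flat_exp c (k + 2) t - real k * flat_exp c (k + 1) t) (at t)"
      using 2 by (simp add: flat_exp_def)
    then show ?thesis
      by (rule DERIV_cong_ev[THEN iffD1, rotated -1, OF _ refl _ refl])
        (use 2 in \<open>auto simp: flat_exp_def intro: eventually_mono[OF eventually_nhds_in_open[of "{..<0}"]]\<close>)
  next
    case 3
    have "((\<lambda>y. (flat_exp c k y - flat_exp c k 0) / (y - 0)) \<longlongrightarrow> 0) (at 0)"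
      by (rule Lim_transform_eventually[OF flat_exp_tendsto_0[OF assms, of "Suc k"]])
        (simp add: flat_exp_def eventually_at_filter)
    then show ?thesis
      using 3 by (simp add: has_field_derivative_iff flat_exp_def)
  qed
qed

text \<open>Raising all members to the same index lets a combination of several of them be written as one
polynomial times one member.\<close>

lemma flat_exp_shift: "flat_exp c k t = t ^ 2 * flat_exp c (k + 2) t"
  "flat_exp c (k + 1) t = t * flat_exp c (k + 2) t"
  by (auto simp: flat_exp_def power_add power2_eq_square)

definition bump :: "real \<Rightarrow> real \<Rightarrow> real \<Rightarrow> real \<Rightarrow> real" where
  "bump c a b x = flat_exp c 0 ((x - a) * (b - x))"

text \<open>A pair \<open>(p, k)\<close> stands for the function \<open>p(x) flat_exp c k (q(x))\<close>; the step yields the pair of its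
derivative, so that iterating it from \<open>(1, 0)\<close> gives all derivatives of a bump.\<close>

definition bump_step :: "real \<Rightarrow> real poly \<Rightarrow> real poly \<times> nat \<Rightarrow> real poly \<times> nat" where
  "bump_step c q = (\<lambda>(p, k). (pderiv p * q\<^sup>2 - smult (real k) (p * q * pderiv q) + smult c (p * pderiv q), k + 2))"

lemma bump_step_derivative:
  assumes "c > 0"
  shows "((\<lambda>x. poly (fst s) x * flat_exp c (snd s) (poly q x)) has_real_derivative
     poly (fst (bump_step c q s)) x * flat_exp c (snd (bump_step c q s)) (poly q x)) (at x)"
proof -
  obtain p k where s: "s = (p, k)" by force
  have "((\<lambda>x. poly p x * flat_exp c k (poly q x)) has_real_derivative
      poly (pderiv p) x * flat_exp c k (poly q x) +
      (c * flat_exp c (k + 2) (poly q x) - real k * flat_exp c (k + 1) (poly q x)) * poly (pderiv q) x * poly p x) (at x)"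
    by (rule DERIV_mult[OF poly_DERIV DERIV_chain2[OF flat_exp_has_derivative[OF assms] poly_DERIV]])
  then show ?thesis
    unfolding flat_exp_shift(1)[of c k "poly q x"] flat_exp_shift(2)[of c k "poly q x"]
    by (simp add: s bump_step_def algebra_simps)
qed

lemma bump_nonneg: "0 \<le> bump c a b x"
  by (simp add: bump_def flat_exp_def)

lemma bump_le_1: "c > 0 \<Longrightarrow> bump c a b x \<le> 1"
  by (simp add: bump_def flat_exp_def)

lemma bump_pos_iff: "bump c a b x > 0 \<longleftrightarrow> (a < x \<and> x < b) \<or> (b < x \<and> x < a)"
  by (auto simp: bump_def flat_exp_def zero_less_mult_iff)

lemma bump_eq_0: "a \<le> b \<Longrightarrow> x \<notin> {a<..<b} \<Longrightarrow> bump c a b x = 0"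
  using bump_pos_iff[of c a b x] bump_nonneg[of c a b x] by force

lemma bump_derivatives:
  assumes "c > 0"
  obtains D :: "nat \<Rightarrow> real \<Rightarrow> real" where "D 0 = bump c a b"
    "\<And>j x. (D j has_real_derivative D (Suc j) x) (at x)"
proof -
  define q where "q = [:-a, 1:] * [:b, -1:]"
  define D where "D j x = poly (fst ((bump_step c q ^^ j) (1, 0))) x *
     flat_exp c (snd ((bump_step c q ^^ j) (1, 0))) (poly q x)" for j x
  have "D 0 = bump c a b" by (auto simp: D_def bump_def q_def algebra_simps)
  moreover have "(D j has_real_derivative D (Suc j) x) (at x)" for j x
    using bump_step_derivative[OF assms, of "(bump_step c q ^^ j) (1, 0)" q x] by (simp add: D_def[abs_def])
  ultimately show ?thesis using that by blast
qed

lemma test_functionsI: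
  assumes "D 0 = f" "\<And>j x. (D j has_real_derivative D (Suc j) x) (at x)"
    and "\<And>x. x \<notin> {a..b} \<Longrightarrow> f x = 0"
  shows "f \<in> test_functions"
proof -
  have "continuous_on UNIV (D j)" for j
    using assms(2) DERIV_isCont by (blast intro: continuous_at_imp_continuous_on)
  then have "Ck_on k UNIV f" for k
    using assms(1,2) unfolding Ck_on_def by (intro exI[of _ D]) auto
  moreover have "closure {x. f x \<noteq> 0} \<subseteq> {a..b}"
    by (rule closure_minimal) (use assms(3) in force)+
  then have "compact (closure {x. f x \<noteq> 0})"
    by (metis bounded_closed_interval bounded_subset closed_closure compact_eq_bounded_closed)
  ultimately show ?thesis by (simp add: test_functions_def)
qed

text \<open>The value at the end points of the interval is zero as well, so that boundary terms vanish in
integrations by parts.\<close>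

lemma test_functionsE:
  assumes "\<phi> \<in> test_functions"
  obtains a b where "a < b" "\<And>x. x \<notin> {a<..<b} \<Longrightarrow> \<phi> x = 0" "\<And>x. x \<notin> {a..b} \<Longrightarrow> deriv \<phi> x = 0"
    "\<And>x. (\<phi> has_real_derivative deriv \<phi> x) (at x)" "continuous_on UNIV (deriv \<phi>)"
    "continuous_on UNIV \<phi>"
proof -
  have C: "compact (closure {x. \<phi> x \<noteq> 0})" and "Ck_on 1 UNIV \<phi>"
    using assms by (auto simp: test_functions_def)
  then obtain D where D: "D 0 = \<phi>" "\<And>x. (\<phi> has_real_derivative D (Suc 0) x) (at x)"
      "continuous_on UNIV (D (Suc 0))"
    unfolding Ck_on_def by auto
  have d: "deriv \<phi> = D (Suc 0)" using D(2) DERIV_imp_deriv by blast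
  obtain M where M: "\<And>x. x \<in> closure {x. \<phi> x \<noteq> 0} \<Longrightarrow> norm x \<le> M"
    using compact_imp_bounded[OF C] by (auto simp: bounded_iff)
  define a where "a = - (\<bar>M\<bar> + 1)"
  define b where "b = \<bar>M\<bar> + 1"
  have z: "\<phi> x = 0" if "x \<notin> {a<..<b}" for x
    using M[of x] closure_subset[of "{x. \<phi> x \<noteq> 0}"] that by (force simp: a_def b_def)
  have dz: "deriv \<phi> x = 0" if "x \<notin> {a..b}" for x
  proof -
    have "\<forall>\<^sub>F y in nhds x. \<phi> y = 0"
      by (rule eventually_mono[OF eventually_nhds_in_open[of "- {a..b}" x]]) (use that z in auto)
    then have "(\<phi> has_real_derivative 0) (at x)"
      using DERIV_cong_ev[of x x \<phi> "\<lambda>_. 0" 0 0] by simp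
    then show ?thesis by (rule DERIV_imp_deriv)
  qed
  show ?thesis
  proof (rule that[of a b])
    show "continuous_on UNIV \<phi>"
      using D(2) DERIV_isCont by (blast intro: continuous_at_imp_continuous_on)
  qed (use D d z dz in \<open>auto simp: a_def b_def\<close>)
qed

lemma continuous_bump: "c > 0 \<Longrightarrow> continuous_on S (bump c a b)"
  by (rule bump_derivatives[of c a b], assumption)
    (metis DERIV_isCont continuous_at_imp_continuous_on)

lemma bump_measurable[measurable]: "c > 0 \<Longrightarrow> bump c a b \<in> borel_measurable borel"
  by (intro borel_measurable_continuous_onI continuous_bump)

section \<open>Weak derivatives and primitives\<close>

text \<open>This is local absolute continuity of \<open>u\<close>, in a form that keeps the derivative at hand.\<close>

definition is_primitive :: "(real \<Rightarrow> real) \<Rightarrow> (real \<Rightarrow> real) \<Rightarrow> bool" where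
  "is_primitive u g \<longleftrightarrow> locally_integrable g \<and>
     (\<forall>x y. x \<le> y \<longrightarrow> u y - u x = set_lebesgue_integral lborel {x..y} g)"

lemma locally_integrable_Icc: "locally_integrable f \<Longrightarrow> set_integrable lborel {a..b} f"
  by (simp add: locally_integrable_def)

lemma locally_integrableI:
  assumes "\<And>a b. set_integrable lborel {a..b} f"
  shows "locally_integrable f"
  unfolding locally_integrable_def
proof safe
  fix K :: "real set" assume "compact K"
  then obtain M where "\<And>x. x \<in> K \<Longrightarrow> norm x \<le> M"
    using compact_imp_bounded[of K] bounded_iff[of K] by blast
  then have "K \<subseteq> {-M..M}" by force
  then show "set_integrable lborel K f"
    using set_integrable_subset[OF assms] \<open>compact K\<close> by (metis borel_compact sets_lborel)
qed

lemma locally_integrable_measurable: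
  assumes "locally_integrable f"
  shows "f \<in> borel_measurable borel"
proof (rule borel_measurable_LIMSEQ_real)
  show "(\<lambda>x. indicator {-real n..real n} x *\<^sub>R f x) \<in> borel_measurable borel" for n
    using locally_integrable_Icc[OF assms, of "-real n" "real n"]
    by (auto simp: set_integrable_def dest: borel_measurable_integrable)
  fix x :: real
  obtain N where N: "\<bar>x\<bar> \<le> real N" using real_arch_simple by blast
  have "\<forall>\<^sub>F n in sequentially. f x = indicator {-real n..real n} x *\<^sub>R f x"
    using eventually_ge_at_top[of N] by eventually_elim (use N in \<open>auto simp: indicator_def\<close>)
  then show "(\<lambda>n. indicator {-real n..real n} x *\<^sub>R f x) \<longlonglongrightarrow> f x"
    by (rule Lim_transform_eventually[OF tendsto_const])
qed

lemma locally_integrable_continuous: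
  fixes f :: "real \<Rightarrow> real"
  assumes "continuous_on UNIV f" shows "locally_integrable f"
  using assms continuous_on_subset
  by (intro locally_integrableI borel_integrable_atLeastAtMost') blast

lemma locally_integrable_diff:
  "locally_integrable f \<Longrightarrow> locally_integrable g \<Longrightarrow> locally_integrable (\<lambda>x. f x - g x)"
  by (simp add: locally_integrable_def)

lemma integrable_mult_compact_support:
  fixes f \<psi> :: "real \<Rightarrow> real"
  assumes "locally_integrable f" "continuous_on UNIV \<psi>" "\<And>x. x \<notin> {a..b} \<Longrightarrow> \<psi> x = 0"
  shows "integrable lborel (\<lambda>x. f x * \<psi> x)"
proof -
  obtain B where B: "\<And>x. x \<in> {a..b} \<Longrightarrow> \<bar>\<psi> x\<bar> \<le> B"
    using compact_imp_bounded[OF compact_continuous_image[OF continuous_on_subset[OF assms(2)], of "{a..b}"]]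
      bounded_iff[of "\<psi> ` {a..b}"] by force
  have i: "integrable lborel (\<lambda>x. B * (indicator {a..b} x *\<^sub>R \<bar>f x\<bar>))"
    using set_integrable_abs[OF locally_integrable_Icc[OF assms(1)]]
    unfolding set_integrable_def by (intro integrable_mult_right)
  show ?thesis
  proof (rule Bochner_Integration.integrable_bound[OF i])
    show "(\<lambda>x. f x * \<psi> x) \<in> borel_measurable lborel"
      using locally_integrable_measurable[OF assms(1)] borel_measurable_continuous_onI[OF assms(2)] by measurable
    show "AE x in lborel. norm (f x * \<psi> x) \<le> norm (B * (indicator {a..b} x *\<^sub>R \<bar>f x\<bar>))"
    proof (rule AE_I2)
      fix x
      show "norm (f x * \<psi> x) \<le> norm (B * (indicator {a..b} x *\<^sub>R \<bar>f x\<bar>))"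
      proof (cases "x \<in> {a..b}")
        case True
        then have "\<bar>f x\<bar> * \<bar>\<psi> x\<bar> \<le> \<bar>f x\<bar> * \<bar>B\<bar>" using B[of x] by (intro mult_left_mono) auto
        then show ?thesis using True by (simp add: abs_mult mult.commute)
      qed (use assms(3) in auto)
    qed
  qed
qed

lemma set_integral_combine:
  assumes "locally_integrable g" "a \<le> b" "b \<le> c"
  shows "set_lebesgue_integral lborel {a..b} g + set_lebesgue_integral lborel {b..c} g
       = set_lebesgue_integral lborel {a..c} g"
  using assms locally_integrable_Icc[OF assms(1)]
  by (simp add: set_borel_integral_eq_integral Henstock_Kurzweil_Integration.integral_combine)

lemma is_primitiveD: "is_primitive u g \<Longrightarrow> x \<le> y \<Longrightarrow> u y - u x = set_lebesgue_integral lborel {x..y} g"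
  by (simp add: is_primitive_def)

lemma primitive_continuous:
  assumes "is_primitive u g"
  shows "continuous_on S u"
proof -
  have li: "locally_integrable g" using assms by (simp add: is_primitive_def)
  have "isCont u x" for x
  proof -
    have "continuous_on {x-1..x+1} (\<lambda>y. u (x-1) + integral {x-1..y} g)"
      using locally_integrable_Icc[OF li]
      by (intro continuous_intros indefinite_integral_continuous_1 set_borel_integral_eq_integral(1))
    moreover have "u (x-1) + integral {x-1..y} g = u y" if "y \<in> {x-1..x+1}" for y
      using that is_primitiveD[OF assms, of "x-1" y] locally_integrable_Icc[OF li]
      by (simp add: set_borel_integral_eq_integral(2)[symmetric])
    ultimately have "continuous_on {x-1..x+1} u" by (metis (no_types, lifting) continuous_on_cong)
    then show ?thesis by (simp add: continuous_on_interior)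
  qed
  then show ?thesis by (simp add: continuous_at_imp_continuous_on)
qed

lemma primitive_measurable: "is_primitive u g \<Longrightarrow> u \<in> borel_measurable borel"
  by (intro borel_measurable_continuous_onI primitive_continuous)

lemma primitive_exists:
  assumes "locally_integrable g"
  obtains u where "is_primitive u g" "u a = 0"
proof -
  let ?I = "\<lambda>x y. set_lebesgue_integral lborel {x..y} g"
  define u where "u x = (if a \<le> x then ?I a x else - ?I x a)" for x
  have "u y - u x = ?I x y" if "x \<le> y" for x y
    using that set_integral_combine[OF assms, of a x y] set_integral_combine[OF assms, of x a y]
      set_integral_combine[OF assms, of x y a] unfolding u_def by (auto simp: not_le)
  moreover have "u a = 0"
  proof -
    have "?I a a + ?I a a = ?I a a" by (rule set_integral_combine[OF assms]) auto
    then show ?thesis by (simp add: u_def)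
  qed
  ultimately show ?thesis using that[of u] assms by (auto simp: is_primitive_def)
qed

lemma primitive_deriv:
  assumes "is_primitive u g" "continuous_on UNIV g"
  shows "(u has_real_derivative g x) (at x)"
proof -
  have li: "locally_integrable g" using assms by (simp add: is_primitive_def)
  have "((\<lambda>y. integral {x-1..y} g) has_vector_derivative g x) (at x within {x-1..x+1})"
    by (rule integral_has_vector_derivative) (use assms(2) continuous_on_subset in auto)
  then have "((\<lambda>y. integral {x-1..y} g) has_real_derivative g x) (at x)"
    using at_within_interior[of x "{x-1..x+1}"] by (simp add: has_real_derivative_iff_has_vector_derivative)
  then have *: "((\<lambda>y. u (x-1) + integral {x-1..y} g) has_real_derivative g x) (at x)"
    by (auto intro!: derivative_eq_intros)
  have ev: "\<forall>\<^sub>F y in nhds x. u (x-1) + integral {x-1..y} g = u y"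
    using eventually_nhds_in_open[of "{x-1<..}" x] 
  proof (rule eventually_mono)
    fix y assume "y \<in> {x-1<..}"
    then show "u (x-1) + integral {x-1..y} g = u y"
      using is_primitiveD[OF assms(1), of "x-1" y] locally_integrable_Icc[OF li]
      by (simp add: set_borel_integral_eq_integral(2)[symmetric])
  qed auto
  show ?thesis
    using DERIV_cong_ev[OF refl ev refl] * by blast
qed

lemma is_primitive_add:
  assumes "is_primitive u g" "is_primitive v k"
  shows "is_primitive (\<lambda>x. u x + v x) (\<lambda>x. g x + k x)"
proof -
  have li: "locally_integrable g" "locally_integrable k" using assms by (auto simp: is_primitive_def)
  have "u y + v y - (u x + v x) = set_lebesgue_integral lborel {x..y} (\<lambda>x. g x + k x)" if "x \<le> y" for x y
    using is_primitiveD[OF assms(1) that] is_primitiveD[OF assms(2) that]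
      locally_integrable_Icc[OF li(1)] locally_integrable_Icc[OF li(2)] by simp
  then show ?thesis using li by (simp add: is_primitive_def locally_integrable_def)
qed

lemma is_primitive_scale:
  assumes "is_primitive u g"
  shows "is_primitive (\<lambda>x. c * u x) (\<lambda>x. c * g x)"
  using assms by (auto simp: is_primitive_def locally_integrable_def right_diff_distrib[symmetric])

text \<open>At almost every point the value is the limit of averages over shrinking intervals.\<close>

lemma AE_zero_if_interval_integrals_zero:
  assumes li: "locally_integrable w"
    and z: "\<And>a b. a < b \<Longrightarrow> set_lebesgue_integral lborel {a..b} w = 0"
  shows "AE x in lborel. w x = 0"
proof -
  have "w integrable_on cbox a b" for a b
    using set_borel_integral_eq_integral(1)[OF locally_integrable_Icc[OF li]] by simp
  then obtain N where N: "negligible N"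
    "\<And>x e. x \<notin> N \<Longrightarrow> 0 < e \<Longrightarrow>
       \<exists>d>0. \<forall>h. 0 < h \<and> h < d \<longrightarrow>
          norm (integral (cbox x (x + h *\<^sub>R One)) w /\<^sub>R h ^ DIM(real) - w x) < e"
    using integrable_ccontinuous_explicit[of w] by blast
  have "w x = 0" if "x \<notin> N" for x
  proof (rule ccontr)
    assume "w x \<noteq> 0"
    then obtain d where d: "d > 0" "\<forall>h. 0 < h \<and> h < d \<longrightarrow>
        norm (integral (cbox x (x + h *\<^sub>R One)) w /\<^sub>R h ^ DIM(real) - w x) < \<bar>w x\<bar>"
      using N(2)[of x "\<bar>w x\<bar>"] \<open>x \<notin> N\<close> by (metis zero_less_abs_iff)
    have "integral {x..x + d/2} w = 0"
      using z[of x "x + d/2"] d(1) set_borel_integral_eq_integral(2)[OF locally_integrable_Icc[OF li]]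
      by simp
    then show False using d(2)[rule_format, of "d/2"] d(1) by simp
  qed
  then have "AE x in lebesgue. w x = 0"
    using N(1) by (intro AE_I'[of N]) (auto simp: negligible_iff_null_sets)
  then show ?thesis by (simp add: AE_completion_iff)
qed

text \<open>Write \<open>u x - u a\<close> as an integral of \<open>g\<close> and exchange the order of integration; the inner integral of
\<open>deriv \<phi>\<close> over \<open>{y..b}\<close> is then \<open>- \<phi> y\<close>.\<close>

lemma primitive_by_parts:
  assumes u: "is_primitive u g" and \<phi>: "\<phi> \<in> test_functions"
  shows "(LINT x|lborel. u x * deriv \<phi> x) = - (LINT x|lborel. g x * \<phi> x)"
proof -
  have li: "locally_integrable g" using u by (simp add: is_primitive_def)
  obtain a b where ab: "a < b" and z: "\<And>x. x \<notin> {a<..<b} \<Longrightarrow> \<phi> x = 0"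
    and dz: "\<And>x. x \<notin> {a..b} \<Longrightarrow> deriv \<phi> x = 0"
    and d: "\<And>x. (\<phi> has_real_derivative deriv \<phi> x) (at x)"
    and dc: "continuous_on UNIV (deriv \<phi>)" and c: "continuous_on UNIV \<phi>"
    using test_functionsE[OF \<phi>] by metis
  define \<psi> where "\<psi> = deriv \<phi>"
  have [measurable]: "g \<in> borel_measurable borel" "\<psi> \<in> borel_measurable borel"
    using locally_integrable_measurable[OF li] borel_measurable_continuous_onI[OF dc] by (auto simp: \<psi>_def)
  have FTC: "(LINT x|lborel. indicator {y..b} x * \<psi> x) = - \<phi> y" if "y \<le> b" for y
    using integral_FTC_atLeastAtMost[of y b \<phi> \<psi>] that z[of b] d continuous_on_subset[OF dc]
    by (simp add: \<psi>_def has_real_derivative_iff_has_vector_derivative[symmetric] has_field_derivative_at_within)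
  define k where "k x y = indicator {a..b} x * \<psi> x * (indicator {a..b} y * g y) * indicator {p. snd p \<le> fst p} (x, y)" for x y :: real
  have [measurable]: "{p::real\<times>real. snd p \<le> fst p} \<in> sets (borel \<Otimes>\<^sub>M borel)"
    unfolding borel_prod by (intro borel_closed closed_Collect_le continuous_intros)
  have [measurable]: "case_prod k \<in> borel_measurable (lborel \<Otimes>\<^sub>M lborel)"
    unfolding k_def by measurable
  have ig: "integrable lborel (\<lambda>y. indicator {a..b} y * \<bar>g y\<bar>)"
    using set_integrable_abs[OF locally_integrable_Icc[OF li]] by (simp add: set_integrable_def)
  have i\<psi>: "integrable lborel (\<lambda>x. indicator {a..b} x * \<bar>\<psi> x\<bar>)"
    using set_integrable_abs[OF borel_integrable_atLeastAtMost'[OF continuous_on_subset[OF dc]]]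
    by (simp add: set_integrable_def \<psi>_def)
  have kle: "\<bar>k x y\<bar> \<le> (indicator {a..b} x * \<bar>\<psi> x\<bar>) * (indicator {a..b} y * \<bar>g y\<bar>)" for x y
    by (simp add: k_def abs_mult indicator_def)
  have pi: "integrable (lborel \<Otimes>\<^sub>M lborel)
     (\<lambda>p. (indicator {a..b} (fst p) * \<bar>\<psi> (fst p)\<bar>) * (indicator {a..b} (snd p) * \<bar>g (snd p)\<bar>))"
  proof (rule lborel_pair.Fubini_integrable)
    show "integrable lborel (\<lambda>x. LINT y|lborel. norm (indicator {a..b} (fst (x, y)) * \<bar>\<psi> (fst (x, y))\<bar> * (indicator {a..b} (snd (x, y)) * \<bar>g (snd (x, y))\<bar>)))"
      using i\<psi> by (simp add: abs_mult)
    show "AE x in lborel. integrable lborel (\<lambda>y. indicator {a..b} (fst (x, y)) * \<bar>\<psi> (fst (x, y))\<bar> * (indicator {a..b} (snd (x, y)) * \<bar>g (snd (x, y))\<bar>))"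
      using ig by simp
  qed measurable
  have ki: "integrable (lborel \<Otimes>\<^sub>M lborel) (case_prod k)"
    by (rule Bochner_Integration.integrable_bound[OF pi]) (use kle in \<open>auto simp: abs_mult\<close>)
  have inner1: "(LINT y|lborel. k x y) = indicator {a..b} x * \<psi> x * (u x - u a)" for x
  proof (cases "x \<in> {a..b}")
    case True
    have "k x y = \<psi> x * (indicator {a..x} y * g y)" for y
      using True by (auto simp: k_def indicator_def)
    then show ?thesis using True is_primitiveD[OF u, of a x] by (simp add: set_lebesgue_integral_def)
  qed (simp add: k_def)
  have inner2: "(LINT x|lborel. k x y) = - (g y * \<phi> y)" for y
  proof (cases "y \<in> {a..b}")
    case True
    have "k x y = g y * (indicator {y..b} x * \<psi> x)" for x
      using True by (auto simp: k_def indicator_def)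
    then show ?thesis using True FTC[of y] by simp
  qed (use z in \<open>auto simp: k_def\<close>)
  have loc: "locally_integrable u" "locally_integrable (\<lambda>x. u a)"
    by (auto intro!: locally_integrable_continuous primitive_continuous[OF u])
  have eq: "indicator {a..b} x * \<psi> x * (u x - u a) = u x * \<psi> x - u a * (indicator {a..b} x * \<psi> x)" for x
    using dz by (cases "x \<in> {a..b}") (auto simp: \<psi>_def algebra_simps)
  have i1: "integrable lborel (\<lambda>x. u x * \<psi> x)"
    using integrable_mult_compact_support[OF loc(1) dc dz] by (simp add: \<psi>_def)
  have i2: "integrable lborel (\<lambda>x. indicator {a..b} x * \<psi> x)"
    using borel_integrable_atLeastAtMost'[OF continuous_on_subset[OF dc]] by (simp add: set_integrable_def \<psi>_def)
  have "(LINT x|lborel. u x * \<psi> x) = (LINT x|lborel. indicator {a..b} x * \<psi> x * (u x - u a))"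
    unfolding eq using i1 i2 FTC[of a] ab z[of a] by simp
  also have "\<dots> = (LINT y|lborel. - (g y * \<phi> y))"
    using lborel_pair.Fubini_integral[OF ki] by (simp add: inner1 inner2)
  finally show ?thesis by (simp add: \<psi>_def)
qed

text \<open>A test function with integral zero is the derivative of a test function, so \<open>w\<close> is orthogonal to
it. Subtracting from a bump \<open>\<psi>\<close> the multiple of a fixed bump \<open>\<eta>\<close> with the same integral shows
\<open>\<integral>w \<psi> = c \<integral>\<psi>\<close> with \<open>c = \<integral>w \<eta> / \<integral>\<eta>\<close>. Letting the bumps tend to the indicator of an interval, the
integral of \<open>w - c\<close> over every interval vanishes.\<close>

lemma du_bois_reymond:
  assumes li: "locally_integrable w"
    and w: "\<And>\<phi>. \<phi> \<in> test_functions \<Longrightarrow> (LINT x|lborel. w x * deriv \<phi> x) = 0"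
  obtains c where "AE x in lborel. w x = c"
proof -
  define \<eta> where "\<eta> = bump 1 0 1"
  define I where "I = (LINT x|lborel. \<eta> x)"
  have one: "locally_integrable (\<lambda>x. 1)" by (intro locally_integrable_continuous continuous_intros)
  have ib: "integrable lborel (bump \<delta> a b)" and iwb: "integrable lborel (\<lambda>x. w x * bump \<delta> a b x)"
    if "\<delta> > 0" "a < b" for \<delta> a b
    using integrable_mult_compact_support[OF one continuous_bump, of \<delta> a b a b]
      integrable_mult_compact_support[OF li continuous_bump, of \<delta> a b a b] that bump_eq_0[of a b _ \<delta>] by force+
  have I: "I > 0"
  proof -
    have "I \<noteq> 0"
    proof
      assume "I = 0"
      then have "AE x in lborel. \<eta> x = 0"
        using integral_nonneg_eq_0_iff_AE[OF ib[of 1 0 1]] bump_nonneg by (auto simp: I_def \<eta>_def)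
      then have "AE x in lborel. x \<notin> {0<..<1::real}"
      proof eventually_elim
        fix x assume "\<eta> x = 0"
        then have "\<not> 0 < bump 1 0 1 x" by (simp add: \<eta>_def)
        then show "x \<notin> {0<..<1}" by (auto simp: bump_pos_iff)
      qed
      then have "AE x in lebesgue. x \<in> - {0<..<1::real}" by (auto intro: AE_completion)
      then have "1/2 \<in> - {0<..<1::real}" by (rule mem_closed_if_AE_lebesgue[rotated]) auto
      then show False by simp
    qed
    moreover have "I \<ge> 0" unfolding I_def \<eta>_def by (intro integral_nonneg_AE AE_I2 bump_nonneg)
    ultimately show ?thesis by simp
  qed
  define c where "c = (LINT x|lborel. w x * \<eta> x) / I"
  have orth: "(LINT x|lborel. (w x - c) * bump \<delta> a b x) = 0" if \<delta>: "\<delta> > 0" and ab: "a < b" for \<delta> a b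
  proof -
    \<comment> \<open>The multiple of \<open>\<eta>\<close> with the same integral as the bump; \<open>lo\<close> and \<open>hi\<close> enclose both supports.\<close>
    define \<kappa> where "\<kappa> = (LINT x|lborel. bump \<delta> a b x) / I"
    define \<theta> where "\<theta> x = bump \<delta> a b x - \<kappa> * \<eta> x" for x
    define lo where "lo = min a 0"
    define hi where "hi = max b 1"
    have \<theta>0: "\<theta> x = 0" if "x \<notin> {lo<..<hi}" for x
    proof -
      have "x \<notin> {a<..<b}" "x \<notin> {0<..<1}" using that by (auto simp: lo_def hi_def)
      then show ?thesis
        using bump_eq_0[of a b x \<delta>] bump_eq_0[of 0 1 x 1] ab by (simp add: \<theta>_def \<eta>_def)
    qed
    have \<theta>c: "continuous_on UNIV \<theta>"
      unfolding \<theta>_def[abs_def] \<eta>_def using \<delta> by (intro continuous_intros continuous_bump) auto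
    obtain \<Phi> where \<Phi>: "is_primitive \<Phi> \<theta>" "\<Phi> lo = 0"
      using primitive_exists[OF locally_integrable_continuous[OF \<theta>c]] by metis
    have i\<theta>: "(LINT x|lborel. \<theta> x) = 0"
      using ib[OF \<delta> ab] ib[of 1 0 1] I by (simp add: \<theta>_def \<kappa>_def I_def \<eta>_def)
    have \<Phi>0: "\<Phi> x = 0" if "x \<notin> {lo..hi}" for x
    proof (cases "x < lo")
      case True
      have "set_lebesgue_integral lborel {x..lo} \<theta> = set_lebesgue_integral lborel {x..lo} (\<lambda>_. 0)"
        by (rule set_lebesgue_integral_cong) (use \<theta>0 in auto)
      then show ?thesis using is_primitiveD[OF \<Phi>(1), of x lo] \<Phi>(2) True by simp
    next
      case False
      then have "x > hi" using that by auto
      have nz: "lo < y \<and> y < hi" if "\<theta> y \<noteq> 0" for y using \<theta>0[of y] that by force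
      then have nz: "lo \<le> y" "y \<le> x" if "\<theta> y \<noteq> 0" for y using \<open>x > hi\<close> that by force+
      have "(\<lambda>y. indicator {lo..x} y *\<^sub>R \<theta> y) = \<theta>"
        by (intro ext) (auto simp: indicator_def dest: nz)
      then show ?thesis
        using is_primitiveD[OF \<Phi>(1), of lo x] \<Phi>(2) i\<theta> False by (simp add: set_lebesgue_integral_def)
    qed
    obtain D1 where D1: "D1 0 = bump \<delta> a b" "\<And>j x. (D1 j has_real_derivative D1 (Suc j) x) (at x)"
      using bump_derivatives[OF \<delta>] by blast
    obtain D2 where D2: "D2 0 = \<eta>" "\<And>j x. (D2 j has_real_derivative D2 (Suc j) x) (at x)"
      using bump_derivatives[of 1 0 1] unfolding \<eta>_def by auto
    define D where "D j = (case j of 0 \<Rightarrow> \<Phi> | Suc i \<Rightarrow> (\<lambda>x. D1 i x - \<kappa> * D2 i x))" for j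
    have d\<Phi>: "(\<Phi> has_real_derivative \<theta> x) (at x)" for x by (rule primitive_deriv[OF \<Phi>(1) \<theta>c])
    have "(D j has_real_derivative D (Suc j) x) (at x)" for j x
    proof (cases j)
      case 0
      then show ?thesis using d\<Phi>[of x] D1(1) D2(1) by (simp add: D_def \<theta>_def)
    next
      case (Suc i)
      then show ?thesis by (auto simp: D_def intro!: DERIV_diff DERIV_cmult D1 D2)
    qed
    then have "\<Phi> \<in> test_functions"
      by (intro test_functionsI[of D \<Phi> lo hi]) (use \<Phi>0 in \<open>auto simp: D_def\<close>)
    moreover have "deriv \<Phi> = \<theta>" using d\<Phi> DERIV_imp_deriv by blast
    ultimately have "(LINT x|lborel. w x * \<theta> x) = 0" using w by metis
    then have "(LINT x|lborel. w x * bump \<delta> a b x) = \<kappa> * (LINT x|lborel. w x * \<eta> x)"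
      using iwb[OF \<delta> ab] iwb[of 1 0 1] by (simp add: \<theta>_def \<eta>_def algebra_simps)
    then show ?thesis
      using iwb[OF \<delta> ab] ib[OF \<delta> ab] I by (simp add: left_diff_distrib \<kappa>_def c_def)
  qed
  have lc: "locally_integrable (\<lambda>x. w x - c)"
    by (intro locally_integrable_diff li locally_integrable_continuous continuous_intros)
  have "set_lebesgue_integral lborel {a..b} (\<lambda>x. w x - c) = 0" if ab: "a < b" for a b
  proof -
    have [measurable]: "(\<lambda>x. w x - c) \<in> borel_measurable borel" by (rule locally_integrable_measurable[OF lc])
    have "(\<lambda>n. LINT x|lborel. (w x - c) * bump (1 / Suc n) a b x) \<longlonglongrightarrow>
        (LINT x|lborel. indicator {a<..<b} x * (w x - c))"
    proof (rule integral_dominated_convergence[where w = "\<lambda>x. indicator {a..b} x * \<bar>w x - c\<bar>"])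
      show "integrable lborel (\<lambda>x. indicator {a..b} x * \<bar>w x - c\<bar>)"
        using set_integrable_abs[OF locally_integrable_Icc[OF lc]] by (simp add: set_integrable_def)
      show "AE x in lborel. (\<lambda>n. (w x - c) * bump (1 / Suc n) a b x) \<longlonglongrightarrow> indicator {a<..<b} x * (w x - c)"
      proof (rule AE_I2)
        fix x
        show "(\<lambda>n. (w x - c) * bump (1 / Suc n) a b x) \<longlonglongrightarrow> indicator {a<..<b} x * (w x - c)"
        proof (cases "x \<in> {a<..<b}")
          case True
          then have p: "(x - a) * (b - x) > 0" by simp
          have "(\<lambda>n. exp (- (1 / real (Suc n)) / ((x - a) * (b - x)))) \<longlonglongrightarrow> exp (- 0 / ((x - a) * (b - x)))"
            using p by (intro tendsto_intros LIMSEQ_Suc[OF lim_1_over_n]) auto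
          then have "(\<lambda>n. (w x - c) * bump (1 / Suc n) a b x) \<longlonglongrightarrow> (w x - c) * 1"
            using p by (intro tendsto_mult tendsto_const) (simp add: bump_def flat_exp_def)
          then show ?thesis using True by simp
        qed (use bump_eq_0[of a b x] ab in simp)
      qed
      show "AE x in lborel. norm ((w x - c) * bump (1 / Suc n) a b x) \<le> indicator {a..b} x * \<bar>w x - c\<bar>" for n
      proof (rule AE_I2)
        fix x
        show "norm ((w x - c) * bump (1 / Suc n) a b x) \<le> indicator {a..b} x * \<bar>w x - c\<bar>"
        proof (cases "x \<in> {a..b}")
          case True
          have "\<bar>w x - c\<bar> * bump (1 / Suc n) a b x \<le> \<bar>w x - c\<bar> * 1"
            by (intro mult_left_mono bump_le_1) auto
          then show ?thesis using True bump_nonneg[of "1 / Suc n" a b x] by (simp add: abs_mult)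
        next
          case False
          then have "bump (1 / Suc n) a b x = 0" using ab by (intro bump_eq_0) auto
          then show ?thesis by simp
        qed
      qed
    qed (measurable; simp)+
    then have "(LINT x|lborel. indicator {a<..<b} x * (w x - c)) = 0"
      using orth[OF _ ab] by (simp add: LIMSEQ_const_iff)
    moreover have "(LINT x|lborel. indicator {a<..<b} x * (w x - c)) = set_lebesgue_integral lborel {a..b} (\<lambda>x. w x - c)"
      unfolding set_lebesgue_integral_def
    proof (rule integral_cong_AE)
      show "AE x in lborel. indicator {a<..<b} x * (w x - c) = indicator {a..b} x *\<^sub>R (w x - c)"
        using AE_lborel_singleton[of a] AE_lborel_singleton[of b]
        by eventually_elim (auto simp: indicator_def)
    qed measurable
    ultimately show ?thesis by simp
  qed
  then have "AE x in lborel. w x - c = 0"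
    by (rule AE_zero_if_interval_integrals_zero[OF lc])
  then show ?thesis using that[of c] by simp
qed

text \<open>The difference of \<open>f\<close> and any primitive of \<open>g\<close> has weak derivative zero.\<close>

lemma weak_derivative_imp_primitive:
  assumes "has_weak_derivative f g"
  obtains u where "is_primitive u g" "AE x in lborel. f x = u x"
proof -
  have li: "locally_integrable f" "locally_integrable g"
    and w: "\<And>\<phi>. \<phi> \<in> test_functions \<Longrightarrow> (LINT x|lborel. f x * deriv \<phi> x) = - (LINT x|lborel. g x * \<phi> x)"
    using assms by (auto simp: has_weak_derivative_def)
  obtain G where G: "is_primitive G g" using primitive_exists[OF li(2)] by metis
  have lG: "locally_integrable G" by (intro locally_integrable_continuous primitive_continuous[OF G])
  obtain c where c: "AE x in lborel. f x - G x = c"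
  proof (rule du_bois_reymond[OF locally_integrable_diff[OF li(1) lG]])
    fix \<phi> assume \<phi>: "\<phi> \<in> test_functions"
    obtain a b where "\<And>x. x \<notin> {a..b} \<Longrightarrow> deriv \<phi> x = 0" "continuous_on UNIV (deriv \<phi>)"
      using test_functionsE[OF \<phi>] by metis
    then have "integrable lborel (\<lambda>x. f x * deriv \<phi> x)" "integrable lborel (\<lambda>x. G x * deriv \<phi> x)"
      using integrable_mult_compact_support li lG by blast+
    then show "(LINT x|lborel. (f x - G x) * deriv \<phi> x) = 0"
      using w[OF \<phi>] primitive_by_parts[OF G \<phi>] by (simp add: left_diff_distrib)
  qed
  have "is_primitive (\<lambda>x. c + G x) g" using G by (simp add: is_primitive_def)
  moreover have "AE x in lborel. f x = c + G x" using c by eventually_elim simp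
  ultimately show ?thesis using that by blast
qed

lemma primitive_imp_weak_derivative:
  assumes u: "is_primitive u g" and f: "f \<in> borel_measurable borel" and ae: "AE x in lborel. f x = u x"
  shows "has_weak_derivative f g"
proof -
  note [measurable] = f primitive_measurable[OF u]
  have li: "locally_integrable f"
  proof (rule locally_integrableI)
    fix a b
    have "set_integrable lborel {a..b} u"
      by (intro borel_integrable_atLeastAtMost' primitive_continuous[OF u])
    moreover have "set_integrable lborel {a..b} f = set_integrable lborel {a..b} u"
      by (rule set_integrable_cong_AE) (use ae in auto)
    ultimately show "set_integrable lborel {a..b} f" by simp
  qed
  have "(LINT x|lborel. f x * deriv \<phi> x) = - (LINT x|lborel. g x * \<phi> x)" if \<phi>: "\<phi> \<in> test_functions" for \<phi>
  proof -
    have [measurable]: "deriv \<phi> \<in> borel_measurable borel"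
      using test_functionsE[OF \<phi>] borel_measurable_continuous_onI by metis
    have "(LINT x|lborel. f x * deriv \<phi> x) = (LINT x|lborel. u x * deriv \<phi> x)"
      by (rule integral_cong_AE) (measurable, use ae in auto)
    then show ?thesis using primitive_by_parts[OF u \<phi>] by simp
  qed
  then show ?thesis using li u by (simp add: has_weak_derivative_def is_primitive_def)
qed

text \<open>A closed set of full measure is the whole line.\<close>

lemma AE_nonneg_continuous:
  fixes u :: "real \<Rightarrow> real"
  assumes "continuous_on UNIV u" "AE x in lborel. 0 \<le> u x"
  shows "0 \<le> u x"
proof -
  have "closed {x. 0 \<le> u x}"
    using assms(1) by (intro closed_Collect_le continuous_intros)
  moreover have "AE x in lebesgue. x \<in> {x. 0 \<le> u x}" using assms(2) by (auto intro: AE_completion)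
  ultimately show ?thesis using mem_closed_if_AE_lebesgue by blast
qed

lemma AE_eq_continuous:
  fixes u v :: "real \<Rightarrow> real"
  assumes "continuous_on UNIV u" "continuous_on UNIV v" "AE x in lborel. u x = v x"
  shows "u = v"
proof
  fix x
  have "0 \<le> u x - v x"
    using assms by (intro AE_nonneg_continuous[where u = "\<lambda>x. u x - v x"] continuous_intros) auto
  moreover have "0 \<le> v x - u x"
    using assms by (intro AE_nonneg_continuous[where u = "\<lambda>x. v x - u x"] continuous_intros) auto
  ultimately show "u x = v x" by simp
qed

lemma primitive_unique:
  assumes "is_primitive u g1" "is_primitive v g2" "AE x in lborel. u x = v x"
  shows "AE x in lborel. g1 x = g2 x"
proof -
  have uv: "u = v" using AE_eq_continuous primitive_continuous assms by blast
  have li: "locally_integrable g1" "locally_integrable g2" using assms by (auto simp: is_primitive_def)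
  have "AE x in lborel. g1 x - g2 x = 0"
  proof (rule AE_zero_if_interval_integrals_zero[OF locally_integrable_diff[OF li]])
    fix a b :: real assume "a < b"
    then show "set_lebesgue_integral lborel {a..b} (\<lambda>x. g1 x - g2 x) = 0"
      using is_primitiveD[OF assms(1), of a b] is_primitiveD[OF assms(2), of a b] uv
        locally_integrable_Icc[OF li(1)] locally_integrable_Icc[OF li(2)] by simp
  qed
  then show ?thesis by simp
qed

section \<open>Integrals of squares and of sequences\<close>

text \<open>The quadratic \<open>t \<mapsto> \<integral>(f - t g)\<^sup>2\<close> is nowhere negative.\<close>

lemma integral_Cauchy_Schwarz:
  fixes f g :: "'a \<Rightarrow> real"
  assumes [measurable]: "f \<in> borel_measurable M" "g \<in> borel_measurable M"
    and f: "integrable M (\<lambda>x. (f x)\<^sup>2)" and g: "integrable M (\<lambda>x. (g x)\<^sup>2)"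
  shows "integrable M (\<lambda>x. f x * g x)"
    and "(LINT x|M. f x * g x)\<^sup>2 \<le> (LINT x|M. (f x)\<^sup>2) * (LINT x|M. (g x)\<^sup>2)"
proof -
  show fg: "integrable M (\<lambda>x. f x * g x)"
  proof (rule Bochner_Integration.integrable_bound)
    show "integrable M (\<lambda>x. (f x)\<^sup>2 + (g x)\<^sup>2)" using f g by simp
    have "2 * \<bar>f x * g x\<bar> \<le> (f x)\<^sup>2 + (g x)\<^sup>2" for x
      using sum_squares_bound[of "\<bar>f x\<bar>" "\<bar>g x\<bar>"] by (simp add: abs_mult)
    then have "\<bar>f x * g x\<bar> \<le> (f x)\<^sup>2 + (g x)\<^sup>2" for x
      by (smt (verit) abs_ge_zero)
    then show "AE x in M. norm (f x * g x) \<le> norm ((f x)\<^sup>2 + (g x)\<^sup>2)" by simp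
  qed measurable
  define F P G where "F = (LINT x|M. (f x)\<^sup>2)" and "P = (LINT x|M. f x * g x)" and "G = (LINT x|M. (g x)\<^sup>2)"
  have q: "0 \<le> F - 2 * t * P + t\<^sup>2 * G" for t
  proof -
    have "0 \<le> (LINT x|M. (f x - t * g x)\<^sup>2)" by simp
    also have "(\<lambda>x. (f x - t * g x)\<^sup>2) = (\<lambda>x. (f x)\<^sup>2 - 2 * t * (f x * g x) + t\<^sup>2 * (g x)\<^sup>2)"
      by (auto simp: power2_eq_square algebra_simps)
    also have "(LINT x|M. \<dots> x) = F - 2 * t * P + t\<^sup>2 * G"
      using f g fg by (simp add: F_def P_def G_def)
    finally show ?thesis .
  qed
  have "P\<^sup>2 \<le> F * G"
  proof (cases "G = 0")
    case True
    have "P = 0"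
    proof (rule ccontr)
      assume "P \<noteq> 0"
      then show False using q[of "(F + 1) / (2 * P)"] True by (simp add: field_simps)
    qed
    then show ?thesis using True by simp
  next
    case False
    have "G \<ge> 0" by (simp add: G_def)
    then have "G > 0" using False by simp
    then show ?thesis using q[of "P / G"] by (simp add: field_simps power2_eq_square)
  qed
  then show "(LINT x|M. f x * g x)\<^sup>2 \<le> (LINT x|M. (f x)\<^sup>2) * (LINT x|M. (g x)\<^sup>2)"
    by (simp add: F_def P_def G_def)
qed

lemma square_integrable_diff:
  fixes f g :: "'a \<Rightarrow> real"
  assumes "f \<in> borel_measurable M" "g \<in> borel_measurable M"
    and "integrable M (\<lambda>x. (f x)\<^sup>2)" "integrable M (\<lambda>x. (g x)\<^sup>2)"
  shows "integrable M (\<lambda>x. (f x - g x)\<^sup>2)"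
proof -
  have "integrable M (\<lambda>x. (f x)\<^sup>2 - 2 * (f x * g x) + (g x)\<^sup>2)"
    using assms integral_Cauchy_Schwarz(1)[OF assms] by simp
  then show ?thesis by (simp add: power2_diff algebra_simps)
qed

lemma integral_Fatou:
  fixes f :: "'a \<Rightarrow> real"
  assumes [measurable]: "\<And>n. integrable M (F n)" "f \<in> borel_measurable M"
    and nn: "\<And>n x. 0 \<le> F n x" "\<And>x. 0 \<le> f x" and lim: "AE x in M. (\<lambda>n. F n x) \<longlonglongrightarrow> f x"
    and le: "\<And>n. (LINT x|M. F n x) \<le> c"
  shows "integrable M f" "(LINT x|M. f x) \<le> c"
proof -
  have "0 \<le> (LINT x|M. F 0 x)" using nn(1) by (intro integral_nonneg_AE) auto
  then have c: "0 \<le> c" using le[of 0] by simp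
  have "(\<integral>\<^sup>+x. ennreal (f x) \<partial>M) = (\<integral>\<^sup>+x. liminf (\<lambda>n. ennreal (F n x)) \<partial>M)"
  proof (rule nn_integral_cong_AE)
    show "AE x in M. ennreal (f x) = liminf (\<lambda>n. ennreal (F n x))"
      using lim
    proof eventually_elim
      fix x assume "(\<lambda>n. F n x) \<longlonglongrightarrow> f x"
      then have "(\<lambda>n. ennreal (F n x)) \<longlonglongrightarrow> ennreal (f x)" by simp
      then show "ennreal (f x) = liminf (\<lambda>n. ennreal (F n x))"
        by (simp add: lim_imp_Liminf)
    qed
  qed
  also have "\<dots> \<le> liminf (\<lambda>n. \<integral>\<^sup>+x. ennreal (F n x) \<partial>M)"
    by (rule nn_integral_liminf) simp
  also have "\<dots> \<le> ennreal c"
  proof -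
    have "(\<integral>\<^sup>+x. ennreal (F n x) \<partial>M) \<le> ennreal c" for n
      using nn le by (subst nn_integral_eq_integral) (auto intro: ennreal_leI assms(1))
    then show ?thesis by (intro Liminf_le always_eventually) auto
  qed
  finally have b: "(\<integral>\<^sup>+x. ennreal (f x) \<partial>M) \<le> ennreal c" .
  show i: "integrable M f"
    using nn b by (intro integrableI_bounded) (auto simp: top.not_eq_extremum[symmetric] top_unique le_less_trans)
  show "(LINT x|M. f x) \<le> c"
    using b nn c by (subst (asm) nn_integral_eq_integral[OF i]) auto
qed

lemma integrable_indicator_Icc: "integrable lborel (indicator {a..b::real} :: real \<Rightarrow> real)"
  by (rule integrable_real_indicator) (auto simp: emeasure_lborel_Icc_eq)

lemma L2_locally_integrable:
  assumes [measurable]: "g \<in> borel_measurable borel" and "integrable lborel (\<lambda>x::real. (g x)\<^sup>2)"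
  shows "locally_integrable g"
proof (rule locally_integrableI)
  fix a b :: real
  have "(\<lambda>x. (indicator {a..b} x)\<^sup>2 :: real) = indicator {a..b}" by (auto simp: indicator_def)
  then have "integrable lborel (\<lambda>x. indicator {a..b} x * g x)"
    by (intro integral_Cauchy_Schwarz(1) assms(2)) (auto intro: integrable_indicator_Icc)
  then show "set_integrable lborel {a..b} g" by (simp add: set_integrable_def)
qed

lemma interval_integral_L2_bound:
  assumes [measurable]: "g \<in> borel_measurable borel" and "integrable lborel (\<lambda>x::real. (g x)\<^sup>2)" and "a \<le> b"
  shows "(set_lebesgue_integral lborel {a..b} g)\<^sup>2 \<le> (b - a) * (LINT x|lborel. (g x)\<^sup>2)"
proof -
  have e: "(\<lambda>x. (indicator {a..b} x)\<^sup>2 :: real) = indicator {a..b}" by (auto simp: indicator_def)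
  have "integrable lborel (\<lambda>x. (indicator {a..b} x)\<^sup>2 :: real)" unfolding e using assms(3) by simp
  then have "(LINT x|lborel. indicator {a..b} x * g x)\<^sup>2 \<le> (LINT x|lborel. (indicator {a..b} x)\<^sup>2) * (LINT x|lborel. (g x)\<^sup>2)"
    by (intro integral_Cauchy_Schwarz(2) assms(2)) auto
  then show ?thesis using assms(3) by (simp add: e set_lebesgue_integral_def)
qed

section \<open>Probability densities with square-integrable derivative\<close>

text \<open>Densities of finite energy, paired with their derivatives. Carrying \<open>g\<close> along makes convex
combinations, reflections and limits of derivatives explicit.\<close>

definition profile :: "(real \<Rightarrow> real) \<Rightarrow> (real \<Rightarrow> real) \<Rightarrow> bool" where
  "profile u g \<longleftrightarrow> is_primitive u g \<and> integrable lborel (\<lambda>x. (g x)\<^sup>2) \<and> (\<forall>x. 0 \<le> u x) \<and>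
     integrable lborel u \<and> (LINT x|lborel. u x) = 1 \<and> integrable lborel (\<lambda>x. x\<^sup>2 * u x)"

lemma profileD:
  assumes "profile u g"
  shows "is_primitive u g" "integrable lborel (\<lambda>x. (g x)\<^sup>2)" "0 \<le> u x" "integrable lborel u"
    "(LINT x|lborel. u x) = 1" "integrable lborel (\<lambda>x. x\<^sup>2 * u x)"
    "u \<in> borel_measurable borel" "g \<in> borel_measurable borel" "continuous_on S u"
  using assms primitive_measurable[of u g] primitive_continuous[of u g] locally_integrable_measurable[of g]
  by (auto simp: profile_def is_primitive_def)

lemma primitive_Hoelder:
  assumes u: "is_primitive u g" and g: "integrable lborel (\<lambda>x. (g x)\<^sup>2)"
  shows "(u y - u x)\<^sup>2 \<le> \<bar>y - x\<bar> * (LINT x|lborel. (g x)\<^sup>2)"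
proof -
  have m: "g \<in> borel_measurable borel" using u locally_integrable_measurable by (auto simp: is_primitive_def)
  show ?thesis
  proof (cases "x \<le> y")
    case True
    then show ?thesis using interval_integral_L2_bound[OF m g True] is_primitiveD[OF u True] by simp
  next
    case False
    then have "y \<le> x" by simp
    from interval_integral_L2_bound[OF m g this] show ?thesis
      using is_primitiveD[OF u \<open>y \<le> x\<close>] \<open>y \<le> x\<close> by (simp add: power2_commute)
  qed
qed

text \<open>If \<open>u x = M\<close> then, by the Hoelder bound, \<open>u \<ge> M / 2\<close> on an interval of length about
\<open>M\<^sup>2 / (4 \<integral>g\<^sup>2)\<close>, and this interval carries mass at most one. Adding \<open>1\<close> to \<open>\<integral>g\<^sup>2\<close> keeps the length
finite.\<close>

lemma profile_sup_bound:
  assumes p: "profile u g"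
  shows "u x ^ 3 \<le> 8 * ((LINT x|lborel. (g x)\<^sup>2) + 1)"
proof (cases "u x = 0")
  case True
  then show ?thesis by simp
next
  case False
  define D where "D = (LINT x|lborel. (g x)\<^sup>2) + 1"
  define M where "M = u x"
  have M: "M > 0" using False profileD(3)[OF p, of x] by (simp add: M_def)
  have D0: "0 \<le> (LINT x|lborel. (g x)\<^sup>2)" by simp
  then have D: "D > 0" unfolding D_def by linarith
  \<comment> \<open>Chosen such that \<open>sqrt (L * D) = M / 2\<close>.\<close>
  define L where "L = M\<^sup>2 / (4 * D)"
  have L: "L > 0" using M D by (simp add: L_def)
  have half: "u y \<ge> M / 2" if "y \<in> {x..x+L}" for y
  proof (rule ccontr)
    assume "\<not> u y \<ge> M / 2"
    then have "M / 2 < M - u y" by simp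
    then have "(M / 2)\<^sup>2 < (M - u y)\<^sup>2" using M by (intro power_strict_mono) auto
    also have "\<dots> \<le> \<bar>y - x\<bar> * (D - 1)"
      using primitive_Hoelder[OF profileD(1,2)[OF p], of y x] by (simp add: M_def D_def power2_commute)
    also have "\<dots> \<le> L * D" using that D D0 by (intro mult_mono) (auto simp: D_def)
    also have "\<dots> = (M / 2)\<^sup>2" using D by (simp add: L_def power2_eq_square)
    finally show False by simp
  qed
  have "L * (M / 2) = (LINT y|lborel. (M / 2) * indicator {x..x+L} y)" using L by simp
  also have "\<dots> \<le> (LINT y|lborel. u y)"
  proof (intro integral_mono integrable_mult_right integrable_indicator_Icc)
    show "M / 2 * indicator {x..x+L} y \<le> u y" for y
      using half[of y] profileD(3)[OF p, of y] by (cases "y \<in> {x..x+L}") auto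
  qed (rule profileD(4)[OF p])
  finally have "L * (M / 2) \<le> 1" using profileD(5)[OF p] by simp
  then have "M ^ 3 \<le> 8 * D" using D by (simp add: L_def field_simps power2_eq_square power3_eq_cube)
  then show ?thesis by (simp add: M_def D_def)
qed

lemma profile_le:
  assumes p: "profile u g"
  shows "u x \<le> 8 * ((LINT x|lborel. (g x)\<^sup>2) + 1)"
proof (rule ccontr)
  define D where "D = 8 * ((LINT x|lborel. (g x)\<^sup>2) + 1)"
  have "0 \<le> (LINT x|lborel. (g x)\<^sup>2)" by simp
  then have D: "D \<ge> 1" by (simp add: D_def)
  assume "\<not> u x \<le> 8 * ((LINT x|lborel. (g x)\<^sup>2) + 1)"
  then have "D ^ 3 < u x ^ 3" using D by (intro power_strict_mono) (auto simp: D_def)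
  moreover have "D ^ 1 \<le> D ^ 3" using D by (intro power_increasing) auto
  ultimately show False using profile_sup_bound[OF p, of x] by (simp add: D_def)
qed

lemma profile_bounded:
  assumes p: "profile u g"
  obtains B where "B > 0" "\<And>x. u x \<le> B"
proof -
  have "0 < 8 * ((LINT x|lborel. (g x)\<^sup>2) + 1)"
    by (intro mult_pos_pos add_nonneg_pos integral_nonneg_AE) auto
  then show ?thesis using that profile_le[OF p] by blast
qed

lemma profile_square_integrable:
  assumes p: "profile u g"
  shows "integrable lborel (\<lambda>x. (u x)\<^sup>2)"
proof -
  obtain B where B: "B > 0" "\<And>x. u x \<le> B" using profile_bounded[OF p] by blast
  note [measurable] = profileD(7)[OF p]
  have "(u x)\<^sup>2 \<le> B * u x" for x
    using B(2)[of x] profileD(3)[OF p, of x] by (simp add: power2_eq_square mult_right_mono)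
  then have le: "AE x in lborel. norm ((u x)\<^sup>2) \<le> norm (B * u x)"
    using profileD(3)[OF p] B(1) by (auto simp: abs_mult)
  have "integrable lborel (\<lambda>x. B * u x)" using profileD(4)[OF p] by simp
  from this _ le show ?thesis by (rule Bochner_Integration.integrable_bound) measurable
qed

lemma profile_convex:
  assumes u: "profile u g" and v: "profile v k" and t: "0 \<le> t" "t \<le> 1"
  shows "profile (\<lambda>x. (1 - t) * u x + t * v x) (\<lambda>x. (1 - t) * g x + t * k x)"
proof -
  note [measurable] = profileD(7,8)[OF u] profileD(7,8)[OF v]
  have sq: "integrable lborel (\<lambda>x. ((1 - t) * g x + t * k x)\<^sup>2)"
  proof -
    have "integrable lborel (\<lambda>x. g x * k x)"
      using profileD(2)[OF u] profileD(2)[OF v] by (intro integral_Cauchy_Schwarz) auto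
    then have "integrable lborel (\<lambda>x. (1 - t)\<^sup>2 * (g x)\<^sup>2 + 2 * (1 - t) * t * (g x * k x) + t\<^sup>2 * (k x)\<^sup>2)"
      using profileD(2)[OF u] profileD(2)[OF v] by simp
    then show ?thesis by (rule back_subst[of "integrable lborel"]) (auto simp: power2_eq_square algebra_simps)
  qed
  have prim: "is_primitive (\<lambda>x. (1 - t) * u x + t * v x) (\<lambda>x. (1 - t) * g x + t * k x)"
    by (intro is_primitive_add is_primitive_scale profileD(1)[OF u] profileD(1)[OF v])
  have x2: "integrable lborel (\<lambda>x. x\<^sup>2 * ((1 - t) * u x + t * v x))"
  proof -
    have "integrable lborel (\<lambda>x. (1 - t) * (x\<^sup>2 * u x) + t * (x\<^sup>2 * v x))"
      using profileD(6)[OF u] profileD(6)[OF v] by simp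
    then show ?thesis by (simp add: algebra_simps)
  qed
  show ?thesis
    unfolding profile_def using prim sq x2 t profileD(3,4,5)[OF u] profileD(3,4,5)[OF v] by simp
qed

section \<open>The energy of a profile\<close>

text \<open>The function \<open>h'\<close> is the derivative of \<open>h\<close>, and \<open>2 K\<close> is a bound for the second derivative.\<close>

locale droplet_energy =
  fixes lam eps K :: real and h h' :: "real \<Rightarrow> real"
  assumes lam: "lam > 0" and eps: "eps > 0" and K: "K \<ge> 0"
    and h_cont: "continuous_on {0..} h" and h'_cont: "continuous_on {0..} h'"
    and h0: "h 0 = 0" and h'0: "h' 0 = 0"
    and h_taylor: "\<And>a b. a \<ge> 0 \<Longrightarrow> b \<ge> 0 \<Longrightarrow> \<bar>h b - h a - h' a * (b - a)\<bar> \<le> K * (b - a)\<^sup>2"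
begin

definition J :: "(real \<Rightarrow> real) \<Rightarrow> (real \<Rightarrow> real) \<Rightarrow> real" where
  "J u g = (LINT x|lborel. 1/2 * (g x)\<^sup>2 + lam/2 * x\<^sup>2 * u x + eps * h (u x))"

lemma h_bound: "a \<ge> 0 \<Longrightarrow> \<bar>h a\<bar> \<le> K * a\<^sup>2"
  using h_taylor[of 0 a] by (simp add: h0 h'0)

lemma h'_bound:
  assumes "a \<ge> 0" shows "\<bar>h' a\<bar> \<le> 2 * K * a"
proof (cases "a = 0")
  case False
  then have a: "a > 0" using assms by simp
  have "\<bar>h' a * a\<bar> \<le> K * a\<^sup>2 + K * a\<^sup>2"
    using h_taylor[of a 0] h_bound[OF assms] a by (simp add: h0)
  then have "a * \<bar>h' a\<bar> \<le> a * (2 * K * a)"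
    using a by (simp add: abs_mult power2_eq_square algebra_simps)
  then show ?thesis using a by simp
qed (simp add: h'0)

lemma h_comp_continuous:
  assumes "continuous_on UNIV u" "\<And>x. 0 \<le> u x"
  shows "continuous_on UNIV (\<lambda>x. h (u x))" "continuous_on UNIV (\<lambda>x. h' (u x))"
  by (auto intro!: continuous_on_compose2[OF h_cont assms(1)] continuous_on_compose2[OF h'_cont assms(1)] assms(2))

text \<open>\<open>h\<close> is continuous on the half-line only, so it is first extended by its value at zero.\<close>

lemma h_comp_measurable:
  fixes u :: "'a \<Rightarrow> real"
  assumes [measurable]: "u \<in> borel_measurable M" and "\<And>x. 0 \<le> u x"
  shows "(\<lambda>x. h (u x)) \<in> borel_measurable M"
proof -
  have "continuous_on UNIV (\<lambda>x. h (max 0 x))" by (intro h_comp_continuous continuous_intros) auto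
  then have [measurable]: "(\<lambda>x. h (max 0 x)) \<in> borel_measurable borel" by (rule borel_measurable_continuous_onI)
  have "(\<lambda>x. h (max 0 (u x))) \<in> borel_measurable M" by measurable
  then show ?thesis using assms(2) by (simp add: max_def)
qed

lemma h_comp_integrable:
  assumes p: "profile u g"
  shows "integrable lborel (\<lambda>x. h (u x))"
proof (rule Bochner_Integration.integrable_bound)
  show "integrable lborel (\<lambda>x. K * (u x)\<^sup>2)" using profile_square_integrable[OF p] by simp
  show "(\<lambda>x. h (u x)) \<in> borel_measurable lborel"
    using profileD(3,7)[OF p] by (intro h_comp_measurable) auto
  show "AE x in lborel. norm (h (u x)) \<le> norm (K * (u x)\<^sup>2)"
    using h_bound profileD(3)[OF p] K by (auto simp: abs_mult)
qed

lemma J_split: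
  assumes p: "profile u g"
  shows "J u g = 1/2 * (LINT x|lborel. (g x)\<^sup>2) + lam/2 * (LINT x|lborel. x\<^sup>2 * u x) + eps * (LINT x|lborel. h (u x))"
    and "integrable lborel (\<lambda>x. 1/2 * (g x)\<^sup>2 + lam/2 * x\<^sup>2 * u x + eps * h (u x))"
proof -
  have i: "integrable lborel (\<lambda>x. 1/2 * (g x)\<^sup>2)" "integrable lborel (\<lambda>x. lam/2 * (x\<^sup>2 * u x))"
    "integrable lborel (\<lambda>x. eps * h (u x))"
    using profileD(2,6)[OF p] h_comp_integrable[OF p] by auto
  show "integrable lborel (\<lambda>x. 1/2 * (g x)\<^sup>2 + lam/2 * x\<^sup>2 * u x + eps * h (u x))"
    unfolding mult.assoc[of "lam/2"] by (intro Bochner_Integration.integrable_add i)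
  show "J u g = 1/2 * (LINT x|lborel. (g x)\<^sup>2) + lam/2 * (LINT x|lborel. x\<^sup>2 * u x) + eps * (LINT x|lborel. h (u x))"
    unfolding J_def mult.assoc[of "lam/2"]
    by (simp only: Bochner_Integration.integral_add[OF Bochner_Integration.integrable_add[OF i(1,2)] i(3)]
        Bochner_Integration.integral_add[OF i(1,2)] integral_mult_right_zero)
qed

definition is_minimizer :: "(real \<Rightarrow> real) \<Rightarrow> (real \<Rightarrow> real) \<Rightarrow> bool" where
  "is_minimizer u g \<longleftrightarrow> profile u g \<and> (\<forall>v k. profile v k \<longrightarrow> J u g \<le> J v k)"

definition J_offset :: real where
  "J_offset = 1/8 + 8 * (eps * K) * sqrt (eps * K)"

text \<open>Only the term with \<open>h\<close> can be negative, and it is at least \<open>- eps K \<integral>u\<^sup>2 \<ge> - eps K sup u\<close> since the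
mass is one. The supremum is at most of the order of the cube root of \<open>\<integral>g\<^sup>2 + 1\<close>, so a small part of
the Dirichlet energy absorbs this.\<close>

lemma J_coercive:
  assumes p: "profile u g"
  shows "3/8 * (LINT x|lborel. (g x)\<^sup>2) + lam/2 * (LINT x|lborel. x\<^sup>2 * u x) \<le> J u g + J_offset"
proof -
  define C where "C = eps * K"
  define D where "D = (LINT x|lborel. (g x)\<^sup>2)"
  have C: "C \<ge> 0" using eps K by (simp add: C_def)
  have D: "D \<ge> 0" by (simp add: D_def)
  have pt: "C * u x \<le> D / 8 + J_offset" for x
  proof (cases "u x \<le> 8 * sqrt C")
    case True
    then have "C * u x \<le> C * (8 * sqrt C)" using C by (intro mult_left_mono)
    then show ?thesis using D by (simp add: J_offset_def C_def)
  next
    case False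
    then have "(8 * sqrt C)\<^sup>2 \<le> (u x)\<^sup>2" using C by (intro power_mono) auto
    then have "64 * C \<le> (u x)\<^sup>2" using C by (simp add: power_mult_distrib)
    then have "64 * C * u x \<le> (u x)\<^sup>2 * u x" using profileD(3)[OF p] by (intro mult_right_mono)
    also have "\<dots> \<le> 8 * (D + 1)" using profile_sup_bound[OF p, of x] by (simp add: D_def power3_eq_cube power2_eq_square)
    finally have "C * u x \<le> D / 8 + 1 / 8" by simp
    moreover have "1/8 \<le> J_offset" using C by (simp add: J_offset_def C_def)
    ultimately show ?thesis by simp
  qed
  have "(LINT x|lborel. - (eps * h (u x))) \<le> (LINT x|lborel. (D / 8 + J_offset) * u x)"
  proof (rule integral_mono)
    show "integrable lborel (\<lambda>x. - (eps * h (u x)))" using h_comp_integrable[OF p] by simp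
    show "integrable lborel (\<lambda>x. (D / 8 + J_offset) * u x)" using profileD(4)[OF p] by simp
    fix x
    have "- h (u x) \<le> K * (u x)\<^sup>2" using h_bound[OF profileD(3)[OF p], of x] by simp
    then have "eps * - h (u x) \<le> eps * (K * (u x)\<^sup>2)" using eps by (intro mult_left_mono) auto
    also have "\<dots> = C * u x * u x" by (simp add: C_def power2_eq_square)
    also have "\<dots> \<le> (D / 8 + J_offset) * u x" using pt profileD(3)[OF p] by (intro mult_right_mono)
    finally show "- (eps * h (u x)) \<le> (D / 8 + J_offset) * u x" by simp
  qed
  then have "- (eps * (LINT x|lborel. h (u x))) \<le> D / 8 + J_offset"
    using profileD(5)[OF p] by simp
  then show ?thesis unfolding J_split(1)[OF p] D_def by simp
qed

text \<open>\<open>density_of\<close> and \<open>weak_deriv\<close> return representatives, which agree almost everywhere with \<open>u\<close> and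
\<open>g\<close> by uniqueness of densities and of primitives.\<close>

lemma profile_energy:
  assumes p: "profile u g"
  shows "density lborel u \<in> P2" "energy lam h eps (density lborel u) = ereal (J u g)"
proof -
  note [measurable] = profileD(7,8)[OF p]
  let ?M = "density lborel (\<lambda>x. ennreal (u x))"
  show "?M \<in> P2"
  proof -
    have "emeasure ?M (space ?M) = 1"
      using profileD(3,4,5)[OF p] by (simp add: emeasure_density nn_integral_eq_integral)
    moreover have "integrable ?M (\<lambda>x. x\<^sup>2)"
      using profileD(3,6)[OF p] by (subst integrable_density) (auto simp: mult.commute)
    ultimately show ?thesis by (auto simp: P2_def intro: prob_spaceI)
  qed
  have ac: "absolutely_continuous lborel ?M"
    by (simp add: absolutely_continuousI_density)
  have "AE x in lborel. ennreal (u x) = RN_deriv lborel ?M x"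
    by (rule sigma_finite_measure.RN_deriv_unique[OF sigma_finite_lborel]) auto
  then have ae: "AE x in lborel. density_of ?M x = u x"
    by eventually_elim (metis density_of_def enn2real_ennreal profileD(3)[OF p])
  have [measurable]: "density_of ?M \<in> borel_measurable borel"
    unfolding density_of_def[abs_def] by measurable
  have d0: "0 \<le> density_of ?M x" for x by (simp add: density_of_def)
  have wd: "has_weak_derivative (density_of ?M) g"
    by (rule primitive_imp_weak_derivative[OF profileD(1)[OF p] _ ae]) measurable
  have "integrable lborel (\<lambda>x. (density_of ?M x)\<^sup>2)"
    by (rule integrable_cong_AE_imp[OF profile_square_integrable[OF p]]) (use ae in auto)
  then have "density_of ?M \<in> L2" by (simp add: L2_def)
  moreover have gL2: "g \<in> L2" using profileD(2)[OF p] by (simp add: L2_def)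
  ultimately have "density_of ?M \<in> H1"
    using wd unfolding H1_def by blast
  moreover
  have wd': "has_weak_derivative (density_of ?M) (weak_deriv (density_of ?M))"
    unfolding weak_deriv_def by (rule someI[of _ g]) fact
  then obtain v where v: "is_primitive v (weak_deriv (density_of ?M))" "AE x in lborel. density_of ?M x = v x"
    using weak_derivative_imp_primitive by blast
  have "AE x in lborel. u x = v x" using ae v(2) by eventually_elim simp
  then have wg: "AE x in lborel. g x = weak_deriv (density_of ?M) x"
    by (rule primitive_unique[OF profileD(1)[OF p] v(1)])
  have [measurable]: "weak_deriv (density_of ?M) \<in> borel_measurable borel"
    using v(1) locally_integrable_measurable by (auto simp: is_primitive_def)
  have [measurable]: "(\<lambda>x. h (density_of ?M x)) \<in> borel_measurable borel" "(\<lambda>x. h (u x)) \<in> borel_measurable borel"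
    using d0 profileD(3)[OF p] by (auto intro!: h_comp_measurable)
  have "(LINT x|lborel. 1/2 * (weak_deriv (density_of ?M) x)\<^sup>2 + lam/2 * x\<^sup>2 * density_of ?M x + eps * h (density_of ?M x)) = J u g"
    unfolding J_def by (rule integral_cong_AE) (measurable, use ae wg in eventually_elim, simp)
  ultimately show "energy lam h eps ?M = ereal (J u g)"
    using ac by (simp add: energy_def)
qed

text \<open>The continuous representative of the density inherits non-negativity and integrability from it.\<close>

lemma energy_finite_imp_profile:
  assumes M: "M \<in> P2" and fin: "energy lam h eps M \<noteq> \<infinity>"
  obtains u g where "profile u g" "energy lam h eps M = ereal (J u g)"
proof -
  interpret prob_space M using M by (simp add: P2_def)
  have sets[measurable_cong]: "sets M = sets borel" and i2: "integrable M (\<lambda>x. x\<^sup>2)" using M by (auto simp: P2_def)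
  have ac: "absolutely_continuous lborel M" and H1: "density_of M \<in> H1"
    using fin by (auto simp: energy_def split: if_splits)
  define f where "f = density_of M"
  have f0: "0 \<le> f x" for x by (simp add: f_def density_of_def)
  have [measurable]: "f \<in> borel_measurable borel" using H1 by (simp add: f_def H1_def L2_def)
  have dRN: "density lborel (RN_deriv lborel M) = M"
    by (rule sigma_finite_measure.density_RN_deriv[OF sigma_finite_lborel ac]) (simp add: sets)
  have "AE x in lborel. RN_deriv lborel M x \<noteq> \<infinity>"
    by (rule sigma_finite_measure.RN_deriv_finite[OF sigma_finite_lborel _ ac]) (auto simp: sets sigma_finite_measure_axioms)
  then have "AE x in lborel. ennreal (f x) = RN_deriv lborel M x"
    by eventually_elim (simp add: f_def density_of_def top.not_eq_extremum)
  then have "density lborel (\<lambda>x. ennreal (f x)) = density lborel (RN_deriv lborel M)"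
    by (rule density_cong[rotated 2]) auto
  then have dM: "density lborel (\<lambda>x. ennreal (f x)) = M" using dRN by simp
  have "(\<integral>\<^sup>+x. ennreal (f x) \<partial>lborel) = 1"
    using emeasure_space_1 unfolding dM[symmetric] by (simp add: emeasure_density)
  then have fi: "integrable lborel f" "(LINT x|lborel. f x) = 1"
    using f0 by (auto intro: integrableI_nonneg simp: integral_eq_nn_integral)
  have fx: "integrable lborel (\<lambda>x. x\<^sup>2 * f x)"
    using i2 f0 unfolding dM[symmetric] by (subst (asm) integrable_density) (auto simp: mult.commute)
  obtain g0 where g0: "g0 \<in> L2" "has_weak_derivative f g0" using H1 by (auto simp: H1_def f_def)
  have wd: "has_weak_derivative f (weak_deriv f)"
    unfolding weak_deriv_def by (rule someI[of _ g0]) fact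
  define g where "g = weak_deriv f"
  obtain u0 where u0: "is_primitive u0 g0" "AE x in lborel. f x = u0 x"
    using weak_derivative_imp_primitive[OF g0(2)] by blast
  obtain u where u: "is_primitive u g" "AE x in lborel. f x = u x"
    using weak_derivative_imp_primitive[OF wd] unfolding g_def by blast
  have [measurable]: "u \<in> borel_measurable borel" "g \<in> borel_measurable borel" "g0 \<in> borel_measurable borel"
    using primitive_measurable[OF u(1)] u(1) u0(1) locally_integrable_measurable by (auto simp: is_primitive_def)
  have "AE x in lborel. u0 x = u x" using u0(2) u(2) by eventually_elim simp
  then have gg: "AE x in lborel. (g0 x)\<^sup>2 = (g x)\<^sup>2"
    using primitive_unique[OF u0(1) u(1)] by (auto elim: eventually_mono)
  have "integrable lborel (\<lambda>x. (g0 x)\<^sup>2)" using g0(1) by (simp add: L2_def)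
  from this _ gg have g2: "integrable lborel (\<lambda>x. (g x)\<^sup>2)"
    by (rule integrable_cong_AE_imp) measurable
  have "AE x in lborel. 0 \<le> u x" using u(2) by eventually_elim (metis f0)
  then have u0': "0 \<le> u x" for x by (rule AE_nonneg_continuous[OF primitive_continuous[OF u(1)]])
  have ui: "integrable lborel u" by (rule integrable_cong_AE_imp[OF fi(1)]) (use u(2) in auto)
  have u1: "(LINT x|lborel. u x) = 1"
    using integral_cong_AE[of f lborel u] u(2) fi(2) by simp
  have ux: "integrable lborel (\<lambda>x. x\<^sup>2 * u x)" by (rule integrable_cong_AE_imp[OF fx]) (use u(2) in auto)
  have p: "profile u g" using u(1) g2 u0' ui u1 ux by (simp add: profile_def)
  have [measurable]: "(\<lambda>x. h (f x)) \<in> borel_measurable borel" "(\<lambda>x. h (u x)) \<in> borel_measurable borel"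
    using f0 u0' by (auto intro!: h_comp_measurable)
  have "(LINT x|lborel. 1/2 * (weak_deriv f x)\<^sup>2 + lam/2 * x\<^sup>2 * f x + eps * h (f x)) = J u g"
    unfolding J_def g_def[symmetric] by (rule integral_cong_AE) (measurable, use u(2) in eventually_elim, simp)
  then have "energy lam h eps M = ereal (J u g)" using ac H1 by (simp add: energy_def f_def)
  then show ?thesis using that p by blast
qed

end

section \<open>Tent functions\<close>

text \<open>Rises linearly from \<open>0\<close> at \<open>a\<close> to \<open>1\<close> at \<open>b\<close> and is constant outside \<open>{a..b}\<close>.\<close>

definition ramp :: "real \<Rightarrow> real \<Rightarrow> real \<Rightarrow> real" where
  "ramp a b x = max 0 (min 1 ((x - a) / (b - a)))"

lemma ramp_primitive:
  assumes "a < b"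
  shows "is_primitive (ramp a b) (\<lambda>x. indicator {a..b} x / (b - a))"
proof -
  have r: "ramp a b x = (max a (min b x) - a) / (b - a)" for x
    using assms by (auto simp: ramp_def max_def min_def field_simps)
  have "ramp a b y - ramp a b x = set_lebesgue_integral lborel {x..y} (\<lambda>x. indicator {a..b} x / (b - a))"
    if xy: "x \<le> y" for x y
  proof -
    have e: "(\<lambda>t. indicator {x..y} t *\<^sub>R (indicator {a..b} t / (b - a))) = (\<lambda>t. indicator {max x a..min y b} t / (b - a))"
      by (auto simp: indicator_def fun_eq_iff)
    have "(LINT t|lborel. indicator {max x a..min y b} t) = max 0 (min y b - max x a)"
      by (cases "max x a \<le> min y b") auto
    then have "set_lebesgue_integral lborel {x..y} (\<lambda>x. indicator {a..b} x / (b - a)) = max 0 (min y b - max x a) / (b - a)"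
      unfolding set_lebesgue_integral_def e by simp
    also have "max 0 (min y b - max x a) = max a (min b y) - max a (min b x)"
      using xy assms by (auto simp: max_def min_def)
    also have "\<dots> / (b - a) = ramp a b y - ramp a b x" by (simp add: r diff_divide_distrib)
    finally show ?thesis by (rule sym)
  qed
  moreover have "locally_integrable (\<lambda>x. indicator {a..b} x / (b - a))"
  proof (rule locally_integrableI)
    fix p q :: real
    have e: "(\<lambda>t. indicator {p..q} t *\<^sub>R (indicator {a..b} t / (b - a))) = (\<lambda>t. indicator {max p a..min q b} t / (b - a))"
      by (auto simp: indicator_def fun_eq_iff)
    show "set_integrable lborel {p..q} (\<lambda>x. indicator {a..b} x / (b - a))"
      unfolding set_integrable_def e by (intro integrable_divide integrable_indicator_Icc)
  qed
  ultimately show ?thesis by (simp add: is_primitive_def)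
qed

text \<open>Height one at \<open>m\<close>, zero outside the interval from \<open>l\<close> to \<open>r\<close>.\<close>

definition tent :: "real \<Rightarrow> real \<Rightarrow> real \<Rightarrow> real \<Rightarrow> real" where
  "tent l m r x = ramp l m x - ramp m r x"

definition tent_slope :: "real \<Rightarrow> real \<Rightarrow> real \<Rightarrow> real \<Rightarrow> real" where
  "tent_slope l m r x = indicator {l..m} x / (m - l) - indicator {m..r} x / (r - m)"

lemma tent_primitive:
  assumes "l < m" "m < r"
  shows "is_primitive (tent l m r) (tent_slope l m r)"
  using is_primitive_add[OF ramp_primitive[OF assms(1)] is_primitive_scale[OF ramp_primitive[OF assms(2)], of "-1"]]
  by (simp add: tent_def[abs_def] tent_slope_def[abs_def])

lemma tent_eq:
  assumes "l < m" "m < r"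
  shows "tent l m r x = (if x \<le> l then 0 else if x \<le> m then (x - l) / (m - l) else if x \<le> r then (r - x) / (r - m) else 0)"
  using assms by (auto simp: tent_def ramp_def max_def min_def field_simps)

lemma tent_bounds:
  assumes "l < m" "m < r"
  shows "0 \<le> tent l m r x" "tent l m r x \<le> 1" "x \<notin> {l<..<r} \<Longrightarrow> tent l m r x = 0" "x \<in> {l<..<r} \<Longrightarrow> 0 < tent l m r x"
  using assms by (auto simp: tent_eq[OF assms] field_simps)

lemma tent_slope_square_integrable:
  assumes "l < m" "m < r"
  shows "integrable lborel (\<lambda>x. (tent_slope l m r x)\<^sup>2)"
proof (rule integrableI_bounded_set[where A = "{l..r}" and B = "(1 / (m - l) + 1 / (r - m))\<^sup>2"])
  show "(\<lambda>x. (tent_slope l m r x)\<^sup>2) \<in> borel_measurable lborel" unfolding tent_slope_def by measurable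
  show "emeasure lborel {l..r} < \<infinity>" by (simp add: emeasure_lborel_Icc_eq)
  have "\<bar>tent_slope l m r x\<bar> \<le> 1 / (m - l) + 1 / (r - m)" for x
  proof -
    have "\<bar>indicator {l..m} x / (m - l)\<bar> \<le> 1 / (m - l)" "\<bar>indicator {m..r} x / (r - m)\<bar> \<le> 1 / (r - m)"
      using assms by (auto simp: indicator_def)
    then show ?thesis unfolding tent_slope_def by linarith
  qed
  then have "(tent_slope l m r x)\<^sup>2 \<le> (1 / (m - l) + 1 / (r - m))\<^sup>2" for x
    by (metis abs_ge_zero power2_abs power_mono)
  then show "AE x in lborel. x \<in> {l..r} \<longrightarrow> norm ((tent_slope l m r x)\<^sup>2) \<le> (1 / (m - l) + 1 / (r - m))\<^sup>2" by simp
qed (use assms in \<open>auto simp: tent_slope_def indicator_def\<close>)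

text \<open>Testing a derivative against a tent yields a difference of two chord slopes. This is why tents are
convenient variations: the Euler-Lagrange inequality becomes a statement on chord slopes.\<close>

lemma integral_mult_tent_slope:
  assumes u: "is_primitive u g" and "l < m" "m < r"
  shows "integrable lborel (\<lambda>x. g x * tent_slope l m r x)"
    and "(LINT x|lborel. g x * tent_slope l m r x) = (u m - u l) / (m - l) - (u r - u m) / (r - m)"
proof -
  have li: "locally_integrable g" using u by (simp add: is_primitive_def)
  have e: "g x * tent_slope l m r x = (indicator {l..m} x *\<^sub>R g x) / (m - l) - (indicator {m..r} x *\<^sub>R g x) / (r - m)" for x
    by (simp add: tent_slope_def algebra_simps)
  have i: "integrable lborel (\<lambda>x. indicator {a..b} x *\<^sub>R g x)" for a b :: real
    using locally_integrable_Icc[OF li] by (simp add: set_integrable_def)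
  show "integrable lborel (\<lambda>x. g x * tent_slope l m r x)"
    unfolding e by (intro Bochner_Integration.integrable_diff integrable_divide i)
  show "(LINT x|lborel. g x * tent_slope l m r x) = (u m - u l) / (m - l) - (u r - u m) / (r - m)"
    unfolding e using assms is_primitiveD[OF u, of l m] is_primitiveD[OF u, of m r]
    by (subst Bochner_Integration.integral_diff[OF integrable_divide[OF i] integrable_divide[OF i]])
      (simp add: set_lebesgue_integral_def)
qed

lemma tent_integrals:
  assumes "l < m" "m < r"
  shows "integrable lborel (tent l m r)" "integrable lborel (\<lambda>x. x\<^sup>2 * tent l m r x)"
    "0 < (LINT x|lborel. tent l m r x)" "continuous_on UNIV (tent l m r)"
proof -
  show c: "continuous_on UNIV (tent l m r)" by (rule primitive_continuous[OF tent_primitive[OF assms]])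
  have z: "tent l m r x = 0" if "x \<notin> {l..r}" for x using that tent_bounds(3)[OF assms] by auto
  have "integrable lborel (\<lambda>x. 1 * tent l m r x)"
    by (rule integrable_mult_compact_support[OF locally_integrable_continuous c z]) (auto intro: continuous_intros)
  then show i: "integrable lborel (tent l m r)" by simp
  show "integrable lborel (\<lambda>x. x\<^sup>2 * tent l m r x)"
    by (rule integrable_mult_compact_support[OF locally_integrable_continuous c z]) (auto intro: continuous_intros)
  have "(LINT x|lborel. tent l m r x) \<noteq> 0"
  proof
    assume "(LINT x|lborel. tent l m r x) = 0"
    then have "AE x in lborel. tent l m r x = 0"
      using integral_nonneg_eq_0_iff_AE[OF i] tent_bounds(1)[OF assms] by auto
    then have "tent l m r = (\<lambda>x. 0)" by (intro AE_eq_continuous c continuous_intros)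
    then show False using tent_bounds(4)[OF assms, of m] assms by simp
  qed
  moreover have "0 \<le> (LINT x|lborel. tent l m r x)"
    using tent_bounds(1)[OF assms] by (intro integral_nonneg_AE) auto
  ultimately show "0 < (LINT x|lborel. tent l m r x)" by simp
qed

lemma profile_normalize:
  assumes u: "is_primitive u g" and g: "integrable lborel (\<lambda>x. (g x)\<^sup>2)" and nn: "\<And>x. 0 \<le> u x"
    and i: "integrable lborel u" "integrable lborel (\<lambda>x. x\<^sup>2 * u x)" and c: "c > 0" "(LINT x|lborel. u x) = c"
  shows "profile (\<lambda>x. u x / c) (\<lambda>x. g x / c)"
  using is_primitive_scale[OF u, of "1/c"] assms
  by (simp add: profile_def power_divide)

lemma profile_exists: obtains u g where "profile u g"
proof
  show "profile (\<lambda>x. tent (-1) 0 1 x / (LINT x|lborel. tent (-1) 0 1 x)) (\<lambda>x. tent_slope (-1) 0 1 x / (LINT x|lborel. tent (-1) 0 1 x))"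
    by (rule profile_normalize[OF tent_primitive tent_slope_square_integrable])
      (auto intro: tent_bounds tent_integrals)
qed

section \<open>Existence of a minimizer\<close>

text \<open>Completeness of \<open>L\<^sup>2\<close>, with almost everywhere convergence of a subsequence. After multiplication by a
positive function with integrable square, the sequence is Cauchy in \<open>L\<^sup>1\<close>, where such a subsequence is
known to exist. Fatou's lemma then transfers the Cauchy estimate to the limit.\<close>

lemma L2_complete:
  fixes g :: "nat \<Rightarrow> real \<Rightarrow> real"
  assumes [measurable]: "\<And>n. g n \<in> borel_measurable borel" and sq: "\<And>n. integrable lborel (\<lambda>x. (g n x)\<^sup>2)"
    and cau: "\<And>e. e > 0 \<Longrightarrow> \<exists>N. \<forall>i\<ge>N. \<forall>j\<ge>N. (LINT x|lborel. (g i x - g j x)\<^sup>2) < e"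
  obtains f r where "strict_mono r" "f \<in> borel_measurable borel" "integrable lborel (\<lambda>x. (f x)\<^sup>2)"
    "AE x in lborel. (\<lambda>n. g (r n) x) \<longlonglongrightarrow> f x" "(\<lambda>n. LINT x|lborel. (g (r n) x - f x)\<^sup>2) \<longlonglongrightarrow> 0"
proof -
  \<comment> \<open>Any positive weight whose square is integrable would do.\<close>
  define w where "w x = sqrt (std_normal_density x)" for x
  have w0: "w x > 0" for x by (simp add: w_def normal_density_pos)
  have w2: "(w x)\<^sup>2 = std_normal_density x" for x by (simp add: w_def)
  have [measurable]: "w \<in> borel_measurable borel" unfolding w_def by measurable
  have wi: "integrable lborel (\<lambda>x. (w x)\<^sup>2)" "(LINT x|lborel. (w x)\<^sup>2) = 1"
    using integrable_normal_density[of 1 0] integral_normal_density[of 1 0] by (simp_all add: w2)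
  have dsq: "integrable lborel (\<lambda>x. (g i x - g j x)\<^sup>2)" for i j
    by (rule square_integrable_diff) (auto intro: sq)
  have wgi: "integrable lborel (\<lambda>x. w x * g n x)" for n
    by (rule integral_Cauchy_Schwarz(1)) (use wi sq in auto)
  have L1: "\<exists>N. \<forall>i\<ge>N. \<forall>j\<ge>N. (LINT x|lborel. norm (w x * g i x - w x * g j x)) < e" if e: "e > 0" for e
  proof -
    obtain N where N: "\<And>i j. i \<ge> N \<Longrightarrow> j \<ge> N \<Longrightarrow> (LINT x|lborel. (g i x - g j x)\<^sup>2) < e\<^sup>2"
      using cau[of "e\<^sup>2"] e by auto
    have "(LINT x|lborel. norm (w x * g i x - w x * g j x)) < e" if "i \<ge> N" "j \<ge> N" for i j
    proof -
      have "(LINT x|lborel. w x * \<bar>g i x - g j x\<bar>)\<^sup>2 \<le> (LINT x|lborel. (w x)\<^sup>2) * (LINT x|lborel. (\<bar>g i x - g j x\<bar>)\<^sup>2)"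
        by (rule integral_Cauchy_Schwarz(2)) (use wi dsq in auto)
      also have "\<dots> < e\<^sup>2" using N[OF that] wi(2) by simp
      finally have "(LINT x|lborel. w x * \<bar>g i x - g j x\<bar>) < e" using e by (simp add: power2_less_imp_less)
      moreover have "norm (w x * g i x - w x * g j x) = w x * \<bar>g i x - g j x\<bar>" for x
        using w0[of x] by (simp add: right_diff_distrib[symmetric] abs_mult)
      ultimately show ?thesis by simp
    qed
    then show ?thesis by blast
  qed
  obtain r where r: "strict_mono r" "AE x in lborel. Cauchy (\<lambda>i. w x * g (r i) x)"
    by (rule cauchy_L1_AE_cauchy_subseq[of lborel "\<lambda>n x. w x * g n x", OF wgi L1])
  define f where "f x = lim (\<lambda>n. g (r n) x)" for x
  have [measurable]: "f \<in> borel_measurable borel" unfolding f_def by measurable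
  have lim: "AE x in lborel. (\<lambda>n. g (r n) x) \<longlonglongrightarrow> f x"
    using r(2)
  proof eventually_elim
    fix x assume "Cauchy (\<lambda>i. w x * g (r i) x)"
    then obtain l where "(\<lambda>i. w x * g (r i) x) \<longlonglongrightarrow> l" using Cauchy_convergent convergent_def by blast
    then have "(\<lambda>i. w x * g (r i) x / w x) \<longlonglongrightarrow> l / w x" using w0[of x] by (intro tendsto_intros) auto
    then have "(\<lambda>i. g (r i) x) \<longlonglongrightarrow> l / w x" using w0[of x] by simp
    then show "(\<lambda>n. g (r n) x) \<longlonglongrightarrow> f x" by (simp add: f_def limI)
  qed
  have close: "\<exists>N. \<forall>n\<ge>N. integrable lborel (\<lambda>x. (g (r n) x - f x)\<^sup>2) \<and> (LINT x|lborel. (g (r n) x - f x)\<^sup>2) \<le> e" if e: "e > 0" for e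
  proof -
    obtain N where N: "\<And>i j. i \<ge> N \<Longrightarrow> j \<ge> N \<Longrightarrow> (LINT x|lborel. (g i x - g j x)\<^sup>2) < e"
      using cau[OF e] by blast
    have "integrable lborel (\<lambda>x. (g (r n) x - f x)\<^sup>2) \<and> (LINT x|lborel. (g (r n) x - f x)\<^sup>2) \<le> e" if n: "n \<ge> N" for n
    proof -
      have ge: "r n \<ge> N" "\<And>k. r (k + N) \<ge> N" using seq_suble[OF r(1)] n le_trans trans_le_add2 by blast+
      have l: "AE x in lborel. (\<lambda>k. (g (r n) x - g (r (k + N)) x)\<^sup>2) \<longlonglongrightarrow> (g (r n) x - f x)\<^sup>2"
        using lim
      proof eventually_elim
        fix x assume "(\<lambda>n. g (r n) x) \<longlonglongrightarrow> f x"
        then have "(\<lambda>k. g (r (k + N)) x) \<longlonglongrightarrow> f x" by (rule LIMSEQ_ignore_initial_segment)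
        then show "(\<lambda>k. (g (r n) x - g (r (k + N)) x)\<^sup>2) \<longlonglongrightarrow> (g (r n) x - f x)\<^sup>2" by (intro tendsto_intros)
      qed
      have le: "(LINT x|lborel. (g (r n) x - g (r (k + N)) x)\<^sup>2) \<le> e" for k
        using N[OF ge(1) ge(2)] less_imp_le by blast
      show ?thesis
        using integral_Fatou[of lborel "\<lambda>k x. (g (r n) x - g (r (k + N)) x)\<^sup>2" "\<lambda>x. (g (r n) x - f x)\<^sup>2" e, OF dsq _ _ _ l le]
        by simp
    qed
    then show ?thesis by blast
  qed
  have fsq: "integrable lborel (\<lambda>x. (f x)\<^sup>2)"
  proof -
    obtain N where N: "integrable lborel (\<lambda>x. (g (r N) x - f x)\<^sup>2)" using close[of 1] by auto
    have i: "integrable lborel (\<lambda>x. 2 * (g (r N) x - f x)\<^sup>2 + 2 * (g (r N) x)\<^sup>2)" using N sq by simp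
    have "(f x)\<^sup>2 \<le> 2 * (g (r N) x - f x)\<^sup>2 + 2 * (g (r N) x)\<^sup>2" for x
      using zero_le_power2[of "2 * g (r N) x - f x"] by (simp add: power2_eq_square algebra_simps)
    then show ?thesis
      by (intro Bochner_Integration.integrable_bound[OF i]) auto
  qed
  have conv: "(\<lambda>n. LINT x|lborel. (g (r n) x - f x)\<^sup>2) \<longlonglongrightarrow> 0"
  proof (rule LIMSEQ_I)
    fix e :: real assume "e > 0"
    then obtain N where N: "\<forall>n\<ge>N. (LINT x|lborel. (g (r n) x - f x)\<^sup>2) \<le> e / 2" using close[of "e/2"] by auto
    have "norm ((LINT x|lborel. (g (r n) x - f x)\<^sup>2) - 0) < e" if "n \<ge> N" for n
      using N[rule_format, OF that] \<open>e > 0\<close> by simp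
    then show "\<exists>no. \<forall>n\<ge>no. norm ((LINT x|lborel. (g (r n) x - f x)\<^sup>2) - 0) < e" by blast
  qed
  show ?thesis by (rule that[OF r(1) _ fsq lim conv]) measurable
qed

text \<open>A diagonal subsequence converges at the rationals, and equicontinuity extends this to all points.\<close>

lemma equi_Hoelder_subsequence:
  fixes u :: "nat \<Rightarrow> real \<Rightarrow> real"
  assumes B: "\<And>n x. \<bar>u n x\<bar> \<le> B" and D: "\<And>n x y. (u n y - u n x)\<^sup>2 \<le> \<bar>y - x\<bar> * D" "D \<ge> 0"
  obtains r v where "strict_mono r" "\<And>x. (\<lambda>n. u (r n) x) \<longlonglongrightarrow> v x"
proof -
  obtain r where r: "strict_mono r" "\<And>q. q \<in> \<rat> \<Longrightarrow> \<exists>l. (\<lambda>n. u (r n) q) \<longlonglongrightarrow> l"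
    by (rule function_convergent_subsequence[OF countable_rat, of u B]) (use B in auto)
  have "Cauchy (\<lambda>n. u (r n) x)" for x
  proof (rule CauchyI)
    fix e :: real assume e: "e > 0"
    \<comment> \<open>Within distance \<open>d\<close> every member of the sequence varies by at most \<open>e / 3\<close>.\<close>
    define d where "d = (e/3)\<^sup>2 / (D + 1)"
    have d: "d > 0" using e D(2) by (simp add: d_def)
    obtain q where q: "q \<in> \<rat>" "x < q" "q < x + d" using Rats_dense_in_real[of x "x + d"] d by auto
    have near: "\<bar>u n q - u n x\<bar> \<le> e / 3" for n
    proof -
      have "(u n q - u n x)\<^sup>2 \<le> \<bar>q - x\<bar> * D" by (rule D)
      also have "\<dots> \<le> d * (D + 1)" using q D(2) by (intro mult_mono) auto
      also have "\<dots> = (e/3)\<^sup>2" using D(2) by (simp add: d_def)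
      finally show ?thesis using e abs_le_square_iff[of "u n q - u n x" "e/3"] by simp
    qed
    have "Cauchy (\<lambda>n. u (r n) q)" using r(2)[OF q(1)] LIMSEQ_imp_Cauchy by blast
    then obtain N where N: "\<And>m n. m \<ge> N \<Longrightarrow> n \<ge> N \<Longrightarrow> norm (u (r m) q - u (r n) q) < e / 3"
      using CauchyD[of "\<lambda>n. u (r n) q" "e/3"] e by auto
    have "norm (u (r m) x - u (r n) x) < e" if "m \<ge> N" "n \<ge> N" for m n
      using N[OF that] near[of "r m"] near[of "r n"] unfolding real_norm_def by linarith
    then show "\<exists>M. \<forall>m\<ge>M. \<forall>n\<ge>M. norm (u (r m) x - u (r n) x) < e" by blast
  qed
  then have "(\<lambda>n. u (r n) x) \<longlonglongrightarrow> lim (\<lambda>n. u (r n) x)" for x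
    using Cauchy_convergent convergent_LIMSEQ_iff by blast
  then show ?thesis by (rule that[OF r(1)])
qed

text \<open>The mass outside \<open>{- T..T}\<close> is at most \<open>C / T\<^sup>2\<close> for every member of the sequence, while inside
this interval dominated convergence applies.\<close>

lemma tight_limit_mass:
  fixes u :: "nat \<Rightarrow> real \<Rightarrow> real"
  assumes [measurable]: "\<And>n. u n \<in> borel_measurable borel" and nn: "\<And>n x. 0 \<le> u n x" and B: "\<And>n x. u n x \<le> B"
    and i: "\<And>n. integrable lborel (u n)" "\<And>n. (LINT x|lborel. u n x) = 1"
    and i2: "\<And>n. integrable lborel (\<lambda>x. x\<^sup>2 * u n x)" "\<And>n. (LINT x|lborel. x\<^sup>2 * u n x) \<le> C"
    and lim: "\<And>x. (\<lambda>n. u n x) \<longlonglongrightarrow> v x"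
  shows "integrable lborel v" "(LINT x|lborel. v x) = 1" "integrable lborel (\<lambda>x. x\<^sup>2 * v x)"
proof -
  have v0: "0 \<le> v x" for x using lim nn by (meson LIMSEQ_le_const)
  have [measurable]: "v \<in> borel_measurable borel" by (rule borel_measurable_LIMSEQ_real[OF lim]) measurable
  show vi: "integrable lborel v" and le: "integrable lborel (\<lambda>x. x\<^sup>2 * v x)"
    using integral_Fatou(1)[of lborel u v 1] integral_Fatou(1)[of lborel "\<lambda>n x. x\<^sup>2 * u n x" "\<lambda>x. x\<^sup>2 * v x" C]
      i i2 nn v0 lim AE_I2[of lborel "\<lambda>x. (\<lambda>n. x\<^sup>2 * u n x) \<longlonglongrightarrow> x\<^sup>2 * v x", OF tendsto_mult[OF tendsto_const lim]] by auto
  have le1: "(LINT x|lborel. v x) \<le> 1"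
    using integral_Fatou(2)[of lborel u v 1] i nn v0 lim by auto
  have C: "C \<ge> 0" using i2(2)[of 0] nn by (smt (verit) Bochner_Integration.integral_nonneg mult_nonneg_nonneg zero_le_power2)
  have ge: "1 - C / T\<^sup>2 \<le> (LINT x|lborel. v x)" if T: "T > 0" for T
  proof -
    have out: "1 - C / T\<^sup>2 \<le> (LINT x|lborel. indicator {-T..T} x * u n x)" for n
    proof -
      have ii: "integrable lborel (\<lambda>x. indicator {-T..T} x * u n x)"
        using integrable_mult_indicator[of "{-T..T}" lborel "u n"] i(1) by simp
      have "(LINT x|lborel. u n x - x\<^sup>2 * u n x / T\<^sup>2) \<le> (LINT x|lborel. indicator {-T..T} x * u n x)"
      proof (intro integral_mono ii Bochner_Integration.integrable_diff i(1) integrable_divide i2(1))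
        fix x
        show "u n x - x\<^sup>2 * u n x / T\<^sup>2 \<le> indicator {-T..T} x * u n x"
        proof (cases "x \<in> {-T..T}")
          case True then show ?thesis using nn by simp
        next
          case False
          then have "T\<^sup>2 \<le> x\<^sup>2" using T abs_le_square_iff[of T x] by auto
          then have "T\<^sup>2 * u n x \<le> x\<^sup>2 * u n x" using nn by (intro mult_right_mono)
          then show ?thesis using T False by (simp add: field_simps)
        qed
      qed
      moreover have "(LINT x|lborel. u n x - x\<^sup>2 * u n x / T\<^sup>2) = 1 - (LINT x|lborel. x\<^sup>2 * u n x) / T\<^sup>2"
        using i i2(1) by simp
      moreover have "(LINT x|lborel. x\<^sup>2 * u n x) / T\<^sup>2 \<le> C / T\<^sup>2" using i2(2) by (intro divide_right_mono) auto
      ultimately show ?thesis by linarith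
    qed
    have "(\<lambda>n. LINT x|lborel. indicator {-T..T} x * u n x) \<longlonglongrightarrow> (LINT x|lborel. indicator {-T..T} x * v x)"
    proof (rule integral_dominated_convergence[where w = "\<lambda>x. B * indicator {-T..T} x"])
      show "integrable lborel (\<lambda>x. B * indicator {-T..T} x)" by (intro integrable_mult_right integrable_indicator_Icc)
      show "AE x in lborel. (\<lambda>n. indicator {-T..T} x * u n x) \<longlonglongrightarrow> indicator {-T..T} x * v x"
        by (intro AE_I2 tendsto_intros lim)
      show "AE x in lborel. norm (indicator {-T..T} x * u n x) \<le> B * indicator {-T..T} x" for n
        using nn B by (auto simp: indicator_def)
    qed measurable
    then have "1 - C / T\<^sup>2 \<le> (LINT x|lborel. indicator {-T..T} x * v x)"
      using out by (meson LIMSEQ_le_const)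
    also have "\<dots> \<le> (LINT x|lborel. v x)"
      using integrable_mult_indicator[of "{-T..T}" lborel v] vi v0
      by (intro integral_mono) (auto simp: indicator_def)
    finally show ?thesis .
  qed
  have "(LINT x|lborel. v x) \<ge> 1"
  proof (rule field_le_epsilon)
    fix e :: real assume e: "e > 0"
    \<comment> \<open>Then \<open>C / T\<^sup>2 \<le> e\<close>.\<close>
    define T where "T = sqrt ((C + 1) / e)"
    have T: "T > 0" "T\<^sup>2 = (C + 1) / e" using e C by (auto simp: T_def)
    have "C / T\<^sup>2 \<le> e" using e C unfolding T(2) by (simp add: field_simps)
    then show "1 \<le> (LINT x|lborel. v x) + e" using ge[OF T(1)] by simp
  qed
  then show "(LINT x|lborel. v x) = 1" using le1 by simp
qed

context droplet_energy begin

lemma J_bounded_below: "\<exists>c. \<forall>u g. profile u g \<longrightarrow> c \<le> J u g"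
proof (intro exI[of _ "- J_offset"] allI impI)
  fix u g assume p: "profile u g"
  have "0 \<le> (LINT x|lborel. (g x)\<^sup>2)" by simp
  moreover have "0 \<le> lam / 2 * (LINT x|lborel. x\<^sup>2 * u x)"
    using lam profileD(3)[OF p] by (intro mult_nonneg_nonneg integral_nonneg_AE) auto
  ultimately show "- J_offset \<le> J u g" using J_coercive[OF p] by linarith
qed

text \<open>The Dirichlet energy obeys the parallelogram law, the confinement energy is linear, and \<open>h\<close> is convex
up to \<open>K\<close> times a square. The midpoint is written
as the case \<open>t = 1/2\<close> of a convex combination of two profiles.\<close>

lemma J_midpoint:
  assumes u: "profile u g" and v: "profile v k"
  shows "J (\<lambda>x. (1 - 1/2) * u x + 1/2 * v x) (\<lambda>x. (1 - 1/2) * g x + 1/2 * k x)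
    \<le> 1/2 * J u g + 1/2 * J v k - 1/8 * (LINT x|lborel. (g x - k x)\<^sup>2) + eps * K / 4 * (LINT x|lborel. (u x - v x)\<^sup>2)"
    and "integrable lborel (\<lambda>x. (g x - k x)\<^sup>2)"
proof -
  let ?u = "\<lambda>x. (1 - 1/2) * u x + 1/2 * v x" and ?g = "\<lambda>x. (1 - 1/2) * g x + 1/2 * k x"
  have p: "profile ?u ?g" by (rule profile_convex[OF u v]) auto
  show i1: "integrable lborel (\<lambda>x. (g x - k x)\<^sup>2)"
    using profileD(2,8)[OF u] profileD(2,8)[OF v] by (intro square_integrable_diff) auto
  have i2: "integrable lborel (\<lambda>x. (u x - v x)\<^sup>2)"
    using profileD(7)[OF u] profileD(7)[OF v] profile_square_integrable[OF u] profile_square_integrable[OF v]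
    by (intro square_integrable_diff) auto
  define F where "F u g x = 1/2 * (g x)\<^sup>2 + lam/2 * x\<^sup>2 * u x + eps * h (u x)" for u g :: "real \<Rightarrow> real" and x
  have Fi: "integrable lborel (F u g)" "integrable lborel (F v k)" "integrable lborel (F ?u ?g)"
    using J_split(2)[OF u] J_split(2)[OF v] J_split(2)[OF p] by (auto simp: F_def[abs_def])
  have pt: "F ?u ?g x \<le> 1/2 * F u g x + 1/2 * F v k x - 1/8 * (g x - k x)\<^sup>2 + eps * K / 4 * (u x - v x)\<^sup>2" for x
  proof -
    define m d where "m = ?u x" and "d = u x - v x"
    have m: "0 \<le> m" using profileD(3)[OF u, of x] profileD(3)[OF v, of x] by (simp add: m_def)
    have um: "u x - m = d / 2" and vm: "v x - m = - (d / 2)" by (simp_all add: m_def d_def field_simps)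
    have "h (u x) \<ge> h m + h' m * (d / 2) - K * (d / 2)\<^sup>2"
      using h_taylor[OF m profileD(3)[OF u, of x]] unfolding um by linarith
    moreover have "h (v x) \<ge> h m - h' m * (d / 2) - K * (d / 2)\<^sup>2"
      using h_taylor[OF m profileD(3)[OF v, of x]] unfolding vm power2_minus mult_minus_right by linarith
    moreover have "K * (d / 2)\<^sup>2 = K / 4 * d\<^sup>2" by (simp add: power_divide)
    ultimately have "h m \<le> 1/2 * h (u x) + 1/2 * h (v x) + K / 4 * d\<^sup>2" by linarith
    then have hm: "h (?u x) \<le> 1/2 * h (u x) + 1/2 * h (v x) + K / 4 * (u x - v x)\<^sup>2" by (simp only: m_def d_def)
    from hm have "eps * h (?u x) \<le> eps * (1/2 * h (u x) + 1/2 * h (v x) + K / 4 * (u x - v x)\<^sup>2)"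
      using eps by (intro mult_left_mono) auto
    moreover have "1/2 * (?g x)\<^sup>2 = 1/4 * (g x)\<^sup>2 + 1/4 * (k x)\<^sup>2 - 1/8 * (g x - k x)\<^sup>2"
      by (simp add: power2_eq_square algebra_simps)
    moreover have "lam/2 * x\<^sup>2 * ?u x = 1/2 * (lam/2 * x\<^sup>2 * u x) + 1/2 * (lam/2 * x\<^sup>2 * v x)"
      by (simp add: algebra_simps)
    moreover have "eps * (1/2 * h (u x) + 1/2 * h (v x) + K / 4 * (u x - v x)\<^sup>2)
      = 1/2 * (eps * h (u x)) + 1/2 * (eps * h (v x)) + eps * K / 4 * (u x - v x)\<^sup>2"
      by (simp add: algebra_simps)
    ultimately show ?thesis unfolding F_def distrib_left[of "1/2"] by linarith
  qed
  have "J ?u ?g = (LINT x|lborel. F ?u ?g x)" by (simp add: J_def F_def)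
  also have "\<dots> \<le> (LINT x|lborel. 1/2 * F u g x + 1/2 * F v k x - 1/8 * (g x - k x)\<^sup>2 + eps * K / 4 * (u x - v x)\<^sup>2)"
    using Fi i1 i2 pt by (intro integral_mono) auto
  also have "\<dots> = 1/2 * J u g + 1/2 * J v k - 1/8 * (LINT x|lborel. (g x - k x)\<^sup>2) + eps * K / 4 * (LINT x|lborel. (u x - v x)\<^sup>2)"
    using Fi i1 i2 by (simp add: J_def F_def[abs_def])
  finally show "J ?u ?g \<le> 1/2 * J u g + 1/2 * J v k - 1/8 * (LINT x|lborel. (g x - k x)\<^sup>2) + eps * K / 4 * (LINT x|lborel. (u x - v x)\<^sup>2)" .
qed

text \<open>In the proof, \<open>u0\<close> is a minimizing sequence, \<open>U\<close> a pointwise convergent subsequence, and \<open>b i + b j\<close>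
the bound for \<open>\<integral>(g\<^sub>i - g\<^sub>j)\<^sup>2\<close> that the midpoint inequality provides. A multiple of \<open>u\<close>, of constant
integral, is added to the integrand to make it non-negative for Fatou's lemma.\<close>

lemma minimizer_exists: obtains u g where "is_minimizer u g"
proof -
  define S where "S = {J u g | u g. profile u g}"
  define m where "m = Inf S"
  have bdd: "bdd_below S" using J_bounded_below unfolding S_def bdd_below_def by blast
  have ne: "S \<noteq> {}" using profile_exists unfolding S_def by blast
  have inf: "m \<le> J u g" if "profile u g" for u g
    unfolding m_def using that by (intro cInf_lower bdd) (auto simp: S_def)
  have "\<exists>p. profile (fst p) (snd p) \<and> J (fst p) (snd p) < m + 1 / real (Suc n)" for n
  proof -
    have "m < m + 1 / real (Suc n)" by simp
    then obtain s where "s \<in> S" "s < m + 1 / real (Suc n)" using cInf_lessD[OF ne] unfolding m_def by blast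
    then show ?thesis unfolding S_def by auto
  qed
  then obtain p where p: "\<And>n. profile (fst (p n)) (snd (p n))" "\<And>n. J (fst (p n)) (snd (p n)) < m + 1 / real (Suc n)"
    by metis
  define u0 g0 where "u0 n = fst (p n)" and "g0 n = snd (p n)" for n
  have pr0: "profile (u0 n) (g0 n)" and J0: "J (u0 n) (g0 n) < m + 1 / real (Suc n)" for n
    using p by (auto simp: u0_def g0_def)
  define E where "E = m + 1 + J_offset"
  define D where "D = 8/3 * E"
  define B where "B = 8 * (D + 1)"
  define C where "C = 2 / lam * E"
  have bounds: "(LINT x|lborel. (g0 n x)\<^sup>2) \<le> D" "(LINT x|lborel. x\<^sup>2 * u0 n x) \<le> C" for n
  proof -
    have "1 / real (Suc n) \<le> 1" by simp
    then have le: "3/8 * (LINT x|lborel. (g0 n x)\<^sup>2) + lam/2 * (LINT x|lborel. x\<^sup>2 * u0 n x) \<le> E"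
      using J_coercive[OF pr0, of n] J0[of n] unfolding E_def by linarith
    have G: "0 \<le> (LINT x|lborel. (g0 n x)\<^sup>2)" by simp
    have X: "0 \<le> lam/2 * (LINT x|lborel. x\<^sup>2 * u0 n x)"
      using lam profileD(3)[OF pr0] by (intro mult_nonneg_nonneg integral_nonneg_AE) auto
    show "(LINT x|lborel. (g0 n x)\<^sup>2) \<le> D" using le X unfolding D_def by linarith
    have "lam/2 * (LINT x|lborel. x\<^sup>2 * u0 n x) \<le> E" using le G by linarith
    then show "(LINT x|lborel. x\<^sup>2 * u0 n x) \<le> C" using lam unfolding C_def by (simp add: field_simps)
  qed
  have D: "D \<ge> 0" using bounds(1)[of 0] order_trans[of 0 "LINT x|lborel. (g0 0 x)\<^sup>2" D] by simp
  have B: "B > 0" using D by (simp add: B_def)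
  have uB: "u0 n x \<le> B" for n x
    unfolding B_def by (rule order_trans[OF profile_le[OF pr0]]) (simp add: bounds(1))
  have Hoel: "(u0 n y - u0 n x)\<^sup>2 \<le> \<bar>y - x\<bar> * D" for n x y
    using primitive_Hoelder[OF profileD(1,2)[OF pr0], of n y x] mult_left_mono[OF bounds(1)[of n], of "\<bar>y - x\<bar>"]
    by linarith
  have u0abs: "\<bar>u0 n x\<bar> \<le> B" for n x using uB[of n x] profileD(3)[OF pr0, of n x] by simp
  obtain r1 v where r1: "strict_mono r1" and lim: "\<And>x. (\<lambda>n. u0 (r1 n) x) \<longlonglongrightarrow> v x"
    by (rule equi_Hoelder_subsequence[of u0, OF u0abs Hoel D]) (rule that)
  define U G where "U n = u0 (r1 n)" and "G n = g0 (r1 n)" for n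
  have pr: "profile (U n) (G n)" for n by (simp add: U_def G_def pr0)
  have JU: "J (U n) (G n) < m + 1 / real (Suc n)" for n
  proof -
    have "1 / real (Suc (r1 n)) \<le> 1 / real (Suc n)"
      using seq_suble[OF r1, of n] by (intro divide_left_mono) auto
    then show ?thesis using J0[of "r1 n"] unfolding U_def G_def by linarith
  qed
  have Ulim: "(\<lambda>n. U n x) \<longlonglongrightarrow> v x" for x using lim by (simp add: U_def)
  have U0: "0 \<le> U n x" "U n x \<le> B" for n x using profileD(3)[OF pr] uB by (auto simp: U_def)
  note [measurable] = profileD(7)[OF pr] profileD(8)[OF pr]
  have v: "integrable lborel v" "(LINT x|lborel. v x) = 1" "integrable lborel (\<lambda>x. x\<^sup>2 * v x)"
    using tight_limit_mass[OF profileD(7)[OF pr] U0 profileD(4)[OF pr] profileD(5)[OF pr] profileD(6)[OF pr] _ Ulim, of C]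
      bounds(2) by (auto simp: U_def)
  have v0: "0 \<le> v x" for x using Ulim U0(1) by (meson LIMSEQ_le_const)
  have [measurable]: "v \<in> borel_measurable borel" using v(1) by (simp add: borel_measurable_integrable)
  define a where "a n = (LINT x|lborel. \<bar>U n x - v x\<bar>)" for n
  have ai: "integrable lborel (\<lambda>x. \<bar>U n x - v x\<bar>)" for n using profileD(4)[OF pr] v(1) by simp
  have a: "a \<longlonglongrightarrow> 0"
  proof -
    have "(\<lambda>n. \<integral>\<^sup>+x. ennreal (norm (U n x - v x)) \<partial>lborel) \<longlonglongrightarrow> 0"
    proof (rule Scheffe_lemma2)
      show "(\<integral>\<^sup>+x. ennreal (norm (U n x)) \<partial>lborel) \<le> (\<integral>\<^sup>+x. ennreal (norm (v x)) \<partial>lborel)" for n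
        using U0 v0 v(1,2) profileD(4,5)[OF pr] by (simp add: nn_integral_eq_integral)
    qed (auto simp: v Ulim)
    moreover have "(\<integral>\<^sup>+x. ennreal (norm (U n x - v x)) \<partial>lborel) = ennreal (a n)" for n
      unfolding a_def real_norm_def by (rule nn_integral_eq_integral[OF ai]) auto
    ultimately show ?thesis by (simp add: ennreal_tendsto_0_iff a_def[abs_def])
  qed
  define b where "b n = 4 * (1 / real (Suc n)) + 2 * eps * K * B * a n" for n
  have b: "b \<longlonglongrightarrow> 0"
    unfolding b_def by (rule tendsto_eq_intros a LIMSEQ_Suc[OF lim_1_over_n] refl | simp)+
  have Gle: "(LINT x|lborel. (G i x - G j x)\<^sup>2) \<le> b i + b j" for i j
  proof -
    have ii: "integrable lborel (\<lambda>x. B * (\<bar>U i x - v x\<bar> + \<bar>U j x - v x\<bar>))" using ai by simp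
    have "(U i x - U j x)\<^sup>2 \<le> B * (\<bar>U i x - v x\<bar> + \<bar>U j x - v x\<bar>)" for x
    proof -
      have "(U i x - U j x)\<^sup>2 = \<bar>U i x - U j x\<bar> * \<bar>U i x - U j x\<bar>" by (simp add: power2_eq_square)
      also have "\<dots> \<le> B * (\<bar>U i x - v x\<bar> + \<bar>U j x - v x\<bar>)"
        using U0[of i x] U0[of j x] by (intro mult_mono) auto
      finally show ?thesis .
    qed
    then have "(LINT x|lborel. (U i x - U j x)\<^sup>2) \<le> (LINT x|lborel. B * (\<bar>U i x - v x\<bar> + \<bar>U j x - v x\<bar>))"
      using square_integrable_diff[of "U i" lborel "U j"] profile_square_integrable[OF pr] ii
      by (intro integral_mono) auto
    also have "\<dots> = B * (a i + a j)" using ai by (simp add: a_def)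
    finally have "eps * K / 4 * (LINT x|lborel. (U i x - U j x)\<^sup>2) \<le> eps * K / 4 * (B * (a i + a j))"
      using eps K by (intro mult_left_mono) auto
    moreover have "m \<le> 1/2 * J (U i) (G i) + 1/2 * J (U j) (G j) - 1/8 * (LINT x|lborel. (G i x - G j x)\<^sup>2)
        + eps * K / 4 * (LINT x|lborel. (U i x - U j x)\<^sup>2)"
      using inf[OF profile_convex[OF pr[of i] pr[of j], of "1/2"]] J_midpoint(1)[OF pr[of i] pr[of j]] by simp
    moreover have "b i + b j = 4 * (1 / real (Suc i)) + 4 * (1 / real (Suc j)) + 8 * (eps * K / 4 * (B * (a i + a j)))"
      by (simp add: b_def algebra_simps)
    ultimately show ?thesis using JU[of i] JU[of j] by linarith
  qed
  have cau: "\<exists>N. \<forall>i\<ge>N. \<forall>j\<ge>N. (LINT x|lborel. (G i x - G j x)\<^sup>2) < e" if e: "e > 0" for e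
  proof -
    obtain N where N: "\<And>n. n \<ge> N \<Longrightarrow> norm (b n - 0) < e / 2" using LIMSEQ_D[OF b, of "e/2"] e by auto
    have "(LINT x|lborel. (G i x - G j x)\<^sup>2) < e" if "i \<ge> N" "j \<ge> N" for i j
      using Gle[of i j] N[OF that(1)] N[OF that(2)] unfolding real_norm_def by linarith
    then show ?thesis by blast
  qed
  obtain k r2 where r2: "strict_mono r2" and k[measurable]: "k \<in> borel_measurable borel" and k2: "integrable lborel (\<lambda>x. (k x)\<^sup>2)"
    and Gk: "AE x in lborel. (\<lambda>n. G (r2 n) x) \<longlonglongrightarrow> k x" "(\<lambda>n. LINT x|lborel. (G (r2 n) x - k x)\<^sup>2) \<longlonglongrightarrow> 0"
    by (rule L2_complete[of G, OF profileD(8)[OF pr] profileD(2)[OF pr] cau]) (assumption, rule that)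
  have vlim: "(\<lambda>n. U (r2 n) x) \<longlonglongrightarrow> v x" for x
    using LIMSEQ_subseq_LIMSEQ[OF Ulim r2] by (simp add: o_def)
  have prim: "is_primitive v k"
    unfolding is_primitive_def
  proof (intro conjI allI impI)
    show lk: "locally_integrable k" by (rule L2_locally_integrable[OF k k2])
    fix x y :: real assume xy: "x \<le> y"
    define z where "z n = (U (r2 n) y - U (r2 n) x) - set_lebesgue_integral lborel {x..y} k" for n
    have z: "(z n)\<^sup>2 \<le> (y - x) * (LINT t|lborel. (G (r2 n) t - k t)\<^sup>2)" for n
    proof -
      have "z n = set_lebesgue_integral lborel {x..y} (\<lambda>t. G (r2 n) t - k t)"
        using is_primitiveD[OF profileD(1)[OF pr] xy] profileD(1)[OF pr]
        by (simp add: z_def is_primitive_def locally_integrable_Icc[OF lk] locally_integrable_Icc)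
      then show ?thesis
        using interval_integral_L2_bound[of "\<lambda>t. G (r2 n) t - k t" x y] xy
          square_integrable_diff[of "G (r2 n)" lborel k] profileD(2)[OF pr] k2 by simp
    qed
    have "(\<lambda>n. (z n)\<^sup>2) \<longlonglongrightarrow> 0"
      by (rule tendsto_sandwich[OF _ _ tendsto_const tendsto_mult_right_zero[OF Gk(2), of "y - x"]]) (use z in auto)
    then have "(\<lambda>n. sqrt ((z n)\<^sup>2)) \<longlonglongrightarrow> sqrt 0" by (rule tendsto_real_sqrt)
    then have "z \<longlonglongrightarrow> 0" by (simp add: tendsto_rabs_zero_iff)
    moreover have "z \<longlonglongrightarrow> (v y - v x) - set_lebesgue_integral lborel {x..y} k"
      unfolding z_def by (intro tendsto_intros vlim)
    ultimately show "v y - v x = set_lebesgue_integral lborel {x..y} k"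
      using LIMSEQ_unique by fastforce
  qed
  have pv: "profile v k" unfolding profile_def using prim k2 v v0 by simp
  have vB: "v x \<le> B" for x using Ulim U0(2) by (meson LIMSEQ_le_const2)
  \<comment> \<open>Since \<open>h a \<ge> - K a\<^sup>2 \<ge> - K B a\<close> for \<open>0 \<le> a \<le> B\<close>, this multiple of \<open>u\<close> compensates a negative \<open>h\<close>.\<close>
  define C1 where "C1 = eps * K * B"
  define F where "F u g x = 1/2 * (g x)\<^sup>2 + lam/2 * x\<^sup>2 * u x + eps * h (u x) + C1 * u x" for u g :: "real \<Rightarrow> real" and x
  have Fnn: "0 \<le> F u g x" if "profile u g" "u x \<le> B" for u g x
  proof -
    have u: "0 \<le> u x" by (rule profileD(3)[OF that(1)])
    have "- h (u x) \<le> K * (u x)\<^sup>2" using h_bound[OF u] by simp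
    also have "\<dots> \<le> K * B * u x" using u that(2) K by (simp add: power2_eq_square mult_mono mult.assoc)
    finally have "eps * - h (u x) \<le> eps * (K * B * u x)" using eps by (intro mult_left_mono) auto
    then have "0 \<le> eps * h (u x) + C1 * u x" by (simp add: C1_def mult.assoc)
    moreover have "0 \<le> 1/2 * (g x)\<^sup>2 + lam/2 * x\<^sup>2 * u x" using u lam by simp
    ultimately show ?thesis unfolding F_def by linarith
  qed
  have FJ: "integrable lborel (F u g)" "(LINT x|lborel. F u g x) = J u g + C1" if "profile u g" for u g
    using J_split(2)[OF that] profileD(4,5)[OF that] unfolding F_def[abs_def] J_def by auto
  have Flim: "AE x in lborel. (\<lambda>n. F (U (r2 n)) (G (r2 n)) x) \<longlonglongrightarrow> F v k x"
    using Gk(1)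
  proof eventually_elim
    fix x assume g: "(\<lambda>n. G (r2 n) x) \<longlonglongrightarrow> k x"
    have "(\<lambda>n. h (U (r2 n) x)) \<longlonglongrightarrow> h (v x)"
      by (rule continuous_on_tendsto_compose[OF h_cont vlim]) (use v0 U0 in auto)
    then show "(\<lambda>n. F (U (r2 n)) (G (r2 n)) x) \<longlonglongrightarrow> F v k x"
      unfolding F_def by (intro tendsto_intros g vlim)
  qed
  have "J v k \<le> m + 1 / real (Suc N)" for N
  proof -
    have "(LINT x|lborel. F v k x) \<le> m + 1 / real (Suc N) + C1"
    proof (rule integral_Fatou(2)[where F = "\<lambda>n. F (U (r2 (n + N))) (G (r2 (n + N)))"])
      show "AE x in lborel. (\<lambda>n. F (U (r2 (n + N))) (G (r2 (n + N))) x) \<longlonglongrightarrow> F v k x"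
        using Flim by eventually_elim (rule LIMSEQ_ignore_initial_segment)
      show "(LINT x|lborel. F (U (r2 (n + N))) (G (r2 (n + N))) x) \<le> m + 1 / real (Suc N) + C1" for n
      proof -
        have "N \<le> r2 (n + N)" using seq_suble[OF r2, of "n + N"] by simp
        then have "1 / real (Suc (r2 (n + N))) \<le> 1 / real (Suc N)" by (intro divide_left_mono) auto
        then show ?thesis using FJ(2)[OF pr, of "r2 (n + N)"] JU[of "r2 (n + N)"] by linarith
      qed
    qed (use FJ(1)[OF pr] FJ(1)[OF pv] Fnn[OF pr] Fnn[OF pv] U0 vB in \<open>auto intro: borel_measurable_integrable\<close>)
    then show ?thesis using FJ(2)[OF pv] by linarith
  qed
  then have "J v k \<le> m"
    using LIMSEQ_le_const[of "\<lambda>N. m + 1 / real (Suc N)" m "J v k"] tendsto_add[OF tendsto_const[of m] LIMSEQ_Suc[OF lim_1_over_n]]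
    by simp
  then have "is_minimizer v k" unfolding is_minimizer_def using pv inf by (meson order_trans)
  then show ?thesis by (rule that)
qed

end

section \<open>Minimizers are even and non-increasing away from the origin\<close>

lemma lborel_integral_reflect:
  fixes f :: "real \<Rightarrow> real"
  shows "(LINT x|lborel. f (c - x)) = (LINT x|lborel. f x)"
    and "integrable lborel (\<lambda>x. f (c - x)) \<longleftrightarrow> integrable lborel f"
  using lborel_integral_real_affine[of "-1" f c] lborel_integrable_real_affine_iff[of "-1" f c] by simp_all

lemma is_primitive_reflect:
  assumes "is_primitive u g"
  shows "is_primitive (\<lambda>x. u (c - x)) (\<lambda>x. - g (c - x))"
proof -
  have li: "locally_integrable g" using assms by (simp add: is_primitive_def)
  have e: "(\<lambda>t. indicator {x..y} t *\<^sub>R - g (c - t)) = (\<lambda>t. - (indicator {c - y..c - x} (c - t) *\<^sub>R g (c - t)))" for x y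
    by (auto simp: indicator_def fun_eq_iff)
  show ?thesis
    unfolding is_primitive_def
  proof (intro conjI allI impI)
    show "locally_integrable (\<lambda>x. - g (c - x))"
    proof (rule locally_integrableI)
      fix x y
      show "set_integrable lborel {x..y} (\<lambda>x. - g (c - x))"
        using locally_integrable_Icc[OF li, of "c - y" "c - x"]
          lborel_integral_reflect(2)[of "\<lambda>s. indicator {c - y..c - x} s *\<^sub>R g s" c]
        unfolding set_integrable_def e by simp
    qed
    fix x y :: real assume "x \<le> y"
    then have "u (c - x) - u (c - y) = set_lebesgue_integral lborel {c - y..c - x} g"
      using is_primitiveD[OF assms, of "c - y" "c - x"] by simp
    then show "u (c - y) - u (c - x) = set_lebesgue_integral lborel {x..y} (\<lambda>x. - g (c - x))"
      using lborel_integral_reflect(1)[of "\<lambda>s. indicator {c - y..c - x} s *\<^sub>R g s" c]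
      unfolding set_lebesgue_integral_def e by simp
  qed
qed

lemma locally_integrable_indicator_mult:
  assumes "locally_integrable g" "T \<in> sets borel"
  shows "locally_integrable (\<lambda>x. indicator T x * g x :: real)"
proof (rule locally_integrableI)
  fix a b
  have "integrable lborel (\<lambda>x. indicator T x *\<^sub>R (indicator {a..b} x *\<^sub>R g x))"
    by (rule integrable_mult_indicator)
      (use locally_integrable_Icc[OF assms(1), of a b] assms(2) in \<open>auto simp: set_integrable_def\<close>)
  then show "set_integrable lborel {a..b} (\<lambda>x. indicator T x * g x)"
    by (simp add: set_integrable_def mult.left_commute)
qed

text \<open>A primitive may be continued by zero beyond one of its zeros.\<close>

lemma is_primitive_cut_above:
  assumes p: "is_primitive w g" and z: "w \<beta> = 0"
  shows "is_primitive (\<lambda>x. indicator {..\<beta>} x * w x) (\<lambda>x. indicator {..\<beta>} x * g x)"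
  unfolding is_primitive_def
proof (intro conjI allI impI)
  have li: "locally_integrable g" using p by (simp add: is_primitive_def)
  show "locally_integrable (\<lambda>x. indicator {..\<beta>} x * g x)"
    by (rule locally_integrable_indicator_mult[OF li]) simp
  fix x y :: real assume xy: "x \<le> y"
  have "(\<lambda>t. indicator {x..y} t *\<^sub>R (indicator {..\<beta>} t * g t)) = (\<lambda>t. indicator {x..min y \<beta>} t *\<^sub>R g t)"
    by (auto simp: indicator_def fun_eq_iff)
  then have e: "set_lebesgue_integral lborel {x..y} (\<lambda>x. indicator {..\<beta>} x * g x) = set_lebesgue_integral lborel {x..min y \<beta>} g"
    by (simp add: set_lebesgue_integral_def)
  show "indicator {..\<beta>} y * w y - indicator {..\<beta>} x * w x = set_lebesgue_integral lborel {x..y} (\<lambda>x. indicator {..\<beta>} x * g x)"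
  proof (cases "x \<le> \<beta>")
    case True
    then show ?thesis using is_primitiveD[OF p, of x "min y \<beta>"] xy z unfolding e
      by (cases "y \<le> \<beta>") (auto simp: min_def indicator_def)
  next
    case False
    then show ?thesis using xy unfolding e by (simp add: set_lebesgue_integral_def)
  qed
qed

lemma is_primitive_cut_below:
  assumes p: "is_primitive w g" and z: "w \<alpha> = 0"
  shows "is_primitive (\<lambda>x. indicator {\<alpha>..} x * w x) (\<lambda>x. indicator {\<alpha>..} x * g x)"
proof -
  have "is_primitive (\<lambda>x. indicator {..- \<alpha>} x * w (0 - x)) (\<lambda>x. indicator {..- \<alpha>} x * - g (0 - x))"
    by (rule is_primitive_cut_above[OF is_primitive_reflect[OF p]]) (simp add: z)
  from is_primitive_reflect[OF this, of 0] show ?thesis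
    by (simp add: indicator_def cong: if_cong)
qed

lemma is_primitive_cong_AE:
  assumes p: "is_primitive w g" and [measurable]: "g' \<in> borel_measurable borel" and ae: "AE x in lborel. g' x = g x"
  shows "is_primitive w g'"
proof -
  have [measurable]: "g \<in> borel_measurable borel" using p locally_integrable_measurable by (auto simp: is_primitive_def)
  have "set_integrable lborel {x..y} g' = set_integrable lborel {x..y} g" for x y
    by (rule set_integrable_cong_AE) (use ae in auto)
  moreover have "set_lebesgue_integral lborel {x..y} g' = set_lebesgue_integral lborel {x..y} g" for x y
    by (rule set_lebesgue_integral_cong_AE) (use ae in auto)
  ultimately show ?thesis using p locally_integrable_Icc by (auto simp: is_primitive_def intro!: locally_integrableI)
qed

text \<open>For \<open>T\<close> symmetric about \<open>c / 2\<close> this is a measure-preserving involution of the line.\<close>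

definition swap_on :: "real set \<Rightarrow> real \<Rightarrow> real \<Rightarrow> real" where
  "swap_on T c x = (if x \<in> T then c - x else x)"

lemma swap_on_integral:
  fixes f :: "real \<Rightarrow> real"
  assumes T: "T \<in> sets borel" and sym: "\<And>x. c - x \<in> T \<longleftrightarrow> x \<in> T" and f: "integrable lborel f"
  shows "integrable lborel (\<lambda>x. f (swap_on T c x))" "(LINT x|lborel. f (swap_on T c x)) = (LINT x|lborel. f x)"
proof -
  have e: "f (swap_on T c x) = indicator T (c - x) *\<^sub>R f (c - x) + indicator (- T) x *\<^sub>R f x" for x
    using sym[of x] by (simp add: swap_on_def indicator_def)
  have i: "integrable lborel (\<lambda>x. indicator T x *\<^sub>R f x)" "integrable lborel (\<lambda>x. indicator (- T) x *\<^sub>R f x)"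
    using T integrable_mult_indicator[OF _ f, of T] integrable_mult_indicator[OF _ f, of "- T"] by auto
  have ir: "integrable lborel (\<lambda>x. indicator T (c - x) *\<^sub>R f (c - x))"
    using lborel_integral_reflect(2)[of "\<lambda>x. indicator T x *\<^sub>R f x" c] i(1) by simp
  show "integrable lborel (\<lambda>x. f (swap_on T c x))" unfolding e using ir i(2) by (rule Bochner_Integration.integrable_add)
  have "(LINT x|lborel. f (swap_on T c x)) = (LINT x|lborel. indicator T x *\<^sub>R f x) + (LINT x|lborel. indicator (- T) x *\<^sub>R f x)"
    unfolding e using Bochner_Integration.integral_add[OF ir i(2)]
      lborel_integral_reflect(1)[of "\<lambda>x. indicator T x *\<^sub>R f x" c] by simp
  also have "\<dots> = (LINT x|lborel. indicator T x *\<^sub>R f x + indicator (- T) x *\<^sub>R f x)"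
    using i by simp
  also have "\<dots> = (LINT x|lborel. f x)"
    by (rule Bochner_Integration.integral_cong) (auto simp: indicator_def)
  finally show "(LINT x|lborel. f (swap_on T c x)) = (LINT x|lborel. f x)" .
qed

text \<open>\<open>S\<close> is the closure of the component of \<open>{w < 0}\<close> that contains \<open>x0\<close>; it is unbounded below if \<open>w\<close>
has no zero to the left of \<open>x0\<close>. Since \<open>w\<close> vanishes at the end points of \<open>S\<close>, cutting it off outside
\<open>S\<close> gives a primitive again.\<close>

lemma negative_component:
  fixes w :: "real \<Rightarrow> real"
  assumes w: "is_primitive w g" and x0: "x0 < a" "w x0 < 0" and a0: "w a = 0"
  obtains S \<beta> where "S \<in> sets borel" "S \<subseteq> {..a}" "x0 < \<beta>" "{x0<..<\<beta>} \<subseteq> S" "\<And>x. x \<in> {x0<..<\<beta>} \<Longrightarrow> w x < 0"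
    "\<And>x. x \<in> S \<Longrightarrow> w x \<le> 0" "is_primitive (\<lambda>x. indicator S x * w x) (\<lambda>x. indicator S x * g x)"
proof -
  have cont: "isCont w x" for x using primitive_continuous[OF w, of UNIV] by (simp add: continuous_on_eq_continuous_at)
  have cl: "closed {y. 0 \<le> w y}" 
    using primitive_continuous[OF w] by (intro closed_Collect_le continuous_intros)
  define P where "P = {y. 0 \<le> w y} \<inter> {x0..}"
  have "a \<in> P" unfolding P_def using x0 a0 by simp
  then have P: "closed P" "P \<noteq> {}" "bdd_below P" unfolding P_def by (auto intro!: closed_Int cl)
  define \<beta> where "\<beta> = Inf P"
  have "\<beta> \<in> P" unfolding \<beta>_def by (rule closed_contains_Inf[OF P(2,3,1)])
  then have b: "0 \<le> w \<beta>" "x0 \<le> \<beta>" by (auto simp: P_def)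
  have xb: "x0 < \<beta>" using b x0(2) by (cases "\<beta> = x0") auto
  have ba: "\<beta> \<le> a" unfolding \<beta>_def using x0 a0 by (intro cInf_lower P) (auto simp: P_def)
  have neg: "w y < 0" if "x0 \<le> y" "y < \<beta>" for y
  proof (rule ccontr)
    assume "\<not> w y < 0"
    then have "\<beta> \<le> y" unfolding \<beta>_def using that by (intro cInf_lower P) (auto simp: P_def)
    then show False using that by simp
  qed
  have "w \<beta> \<le> 0"
  proof (rule tendsto_upperbound)
    show "(w \<longlongrightarrow> w \<beta>) (at_left \<beta>)" using cont[of \<beta>] by (simp add: isCont_def filterlim_at_split)
    show "\<forall>\<^sub>F y in at_left \<beta>. w y \<le> 0"
      using eventually_at_left_real[OF xb] by eventually_elim (rule less_imp_le, use neg in simp)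
  qed simp
  then have b0: "w \<beta> = 0" using b by simp
  have cutb: "is_primitive (\<lambda>x. indicator {..\<beta>} x * w x) (\<lambda>x. indicator {..\<beta>} x * g x)"
    by (rule is_primitive_cut_above[where w = w, OF w b0])
  show ?thesis
  proof (cases "\<exists>y\<le>x0. 0 \<le> w y")
    case False
    show ?thesis
    proof (rule that[of "{..\<beta>}" \<beta>])
      show "w x \<le> 0" if "x \<in> {..\<beta>}" for x
        using that False neg[of x] b0 by (cases "x = \<beta>"; cases "x \<le> x0") force+
    qed (use ba xb neg cutb in auto)
  next
    case True
    define N where "N = {y. 0 \<le> w y} \<inter> {..x0}"
    have N: "closed N" "N \<noteq> {}" "bdd_above N" unfolding N_def using True by (auto intro!: closed_Int cl)
    define \<alpha> where "\<alpha> = Sup N"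
    have "\<alpha> \<in> N" unfolding \<alpha>_def by (rule closed_contains_Sup[OF N(2,3,1)])
    then have al: "0 \<le> w \<alpha>" "\<alpha> \<le> x0" by (auto simp: N_def)
    have ax: "\<alpha> < x0" using al x0(2) by (cases "\<alpha> = x0") auto
    have negl: "w y < 0" if "\<alpha> < y" "y \<le> x0" for y
    proof (rule ccontr)
      assume "\<not> w y < 0"
      then have "y \<le> \<alpha>" unfolding \<alpha>_def using that by (intro cSup_upper N) (auto simp: N_def)
      then show False using that by simp
    qed
    have "w \<alpha> \<le> 0"
    proof (rule tendsto_upperbound)
      show "(w \<longlongrightarrow> w \<alpha>) (at_right \<alpha>)" using cont[of \<alpha>] by (simp add: isCont_def filterlim_at_split)
      show "\<forall>\<^sub>F y in at_right \<alpha>. w y \<le> 0"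
        using eventually_at_right_real[OF ax] by eventually_elim (rule less_imp_le, use negl in simp)
    qed simp
    then have a00: "w \<alpha> = 0" using al by simp
    have eq: "indicator {\<alpha>..} x * (indicator {..\<beta>} x * s) = (indicator {\<alpha>..\<beta>} x * s :: real)" for x s
      by (auto simp: indicator_def)
    have cut: "is_primitive (\<lambda>x. indicator {\<alpha>..\<beta>} x * w x) (\<lambda>x. indicator {\<alpha>..\<beta>} x * g x)"
      using is_primitive_cut_below[OF cutb, of \<alpha>] a00 by (simp add: eq)
    show ?thesis
    proof (rule that[of "{\<alpha>..\<beta>}" \<beta>])
      show "w x \<le> 0" if x: "x \<in> {\<alpha>..\<beta>}" for x
      proof (cases "x \<le> x0")
        case True
        then show ?thesis using x negl[of x] a00 by (cases "x = \<alpha>") force+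
      next
        case False
        then show ?thesis using x neg[of x] b0 by (cases "x = \<beta>") force+
      qed
    qed (use ba xb neg cut al in auto)
  qed
qed

context droplet_energy begin

text \<open>With \<open>w x = u x - u (c - x)\<close>, \<open>c = 2 a\<close>, suppose \<open>w x0 < 0\<close> and let \<open>S\<close> be the component of
\<open>{w < 0}\<close> at \<open>x0\<close>. The competitor is \<open>u \<circ> s\<close>, where \<open>s\<close> swaps \<open>S\<close> with its mirror image. As \<open>s\<close>
preserves Lebesgue measure, the two energies differ only by \<open>lam/2 \<integral>((s y)\<^sup>2 - y\<^sup>2) u y\<close>. Averaging this
integrand \<open>q\<close> with its reflection gives \<open>- Q / 2\<close>, where \<open>Q\<close> is non-negative, and positive
immediately to the right of \<open>x0\<close>.\<close>

lemma minimizer_reflection_ineq: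
  assumes min: "is_minimizer u g" and a: "a > 0" and x0: "x0 < a"
  shows "u (2 * a - x0) \<le> u x0"
proof (rule ccontr)
  have p: "profile u g" using min by (simp add: is_minimizer_def)
  define c where "c = 2 * a"
  assume nle: "\<not> u (2 * a - x0) \<le> u x0"
  define w where "w x = u x - u (c - x)" for x
  have w0: "w x0 < 0" using nle by (simp add: w_def c_def)
  have wa: "w a = 0" by (simp add: w_def c_def)
  define gw where "gw x = g x + g (c - x)" for x
  have wp: "is_primitive w gw"
    using is_primitive_add[OF profileD(1)[OF p] is_primitive_scale[OF is_primitive_reflect[OF profileD(1)[OF p], of c], of "-1"]]
    by (simp add: w_def[abs_def] gw_def[abs_def])
  obtain S \<beta> where S[measurable]: "S \<in> sets borel" and Sa: "S \<subseteq> {..a}" and \<beta>: "x0 < \<beta>" "{x0<..<\<beta>} \<subseteq> S"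
    "\<And>x. x \<in> {x0<..<\<beta>} \<Longrightarrow> w x < 0" and Sw: "\<And>x. x \<in> S \<Longrightarrow> w x \<le> 0"
    and cut: "is_primitive (\<lambda>x. indicator S x * w x) (\<lambda>x. indicator S x * gw x)"
    using negative_component[OF wp x0 w0 wa] by metis
  define T where "T = {x. x \<in> S \<or> c - x \<in> S}"
  have T[measurable]: "T \<in> sets borel"
  proof -
    have "(\<lambda>x. c - x) -` S \<inter> space borel \<in> sets borel" by (rule measurable_sets[OF _ S]) measurable
    then have "S \<union> ((\<lambda>x. c - x) -` S) \<in> sets borel" by (intro sets.Un S) simp
    moreover have "T = S \<union> ((\<lambda>x. c - x) -` S)" by (auto simp: T_def)
    ultimately show ?thesis by simp
  qed
  have sym: "c - x \<in> T \<longleftrightarrow> x \<in> T" for x by (auto simp: T_def)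
  define s where "s = swap_on T c"
  have ss: "s (s x) = x" for x using sym[of x] by (simp add: s_def swap_on_def)
  note swap = swap_on_integral[OF T sym, folded s_def]
  define g1 where "g1 x = (if x \<in> T then - g (c - x) else g x)" for x
  note [measurable] = profileD(7,8)[OF p]
  have g1m[measurable]: "g1 \<in> borel_measurable borel" unfolding g1_def by measurable
  have g1sq: "(g1 x)\<^sup>2 = (g (s x))\<^sup>2" for x by (simp add: g1_def s_def swap_on_def)
  \<comment> \<open>\<open>S\<close> and its mirror image meet at most in \<open>a\<close>; there the formula for the derivative may fail.\<close>
  have both: "x = a" if "x \<in> S" "c - x \<in> S" for x
    using subsetD[OF Sa that(1)] subsetD[OF Sa that(2)] by (simp add: c_def)
  have prim: "is_primitive (\<lambda>x. u (s x)) g1"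
  proof (rule is_primitive_cong_AE[OF _ g1m])
    have "is_primitive (\<lambda>x. u x + (- 1) * (indicator S x * w x) + indicator S (c - x) * w (c - x))
      (\<lambda>x. g x + (- 1) * (indicator S x * gw x) + - (indicator S (c - x) * gw (c - x)))"
      by (intro is_primitive_add is_primitive_scale profileD(1)[OF p] cut is_primitive_reflect[OF cut])
    moreover have "u x + (- 1) * (indicator S x * w x) + indicator S (c - x) * w (c - x) = u (s x)" for x
      using both[of x] wa by (auto simp: s_def swap_on_def T_def w_def indicator_def c_def)
    ultimately show "is_primitive (\<lambda>x. u (s x)) (\<lambda>x. g x + (- 1) * (indicator S x * gw x) + - (indicator S (c - x) * gw (c - x)))"
      by simp
    show "AE x in lborel. g1 x = g x + (- 1) * (indicator S x * gw x) + - (indicator S (c - x) * gw (c - x))"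
      using AE_lborel_singleton[of a]
      by eventually_elim (use both in \<open>auto simp: g1_def T_def gw_def indicator_def\<close>)
  qed
  have sle: "(s y)\<^sup>2 \<le> 2 * c\<^sup>2 + 2 * y\<^sup>2" for y
  proof -
    have "0 \<le> (c + y)\<^sup>2" "0 \<le> c\<^sup>2" by simp_all
    then show ?thesis by (simp add: s_def swap_on_def power2_eq_square algebra_simps)
  qed
  have [measurable]: "s \<in> borel_measurable borel" unfolding s_def swap_on_def[abs_def] by measurable
  have s2: "integrable lborel (\<lambda>y. (s y)\<^sup>2 * u y)"
  proof (rule Bochner_Integration.integrable_bound)
    show "integrable lborel (\<lambda>y. 2 * c\<^sup>2 * u y + 2 * (y\<^sup>2 * u y))" using profileD(4,6)[OF p] by simp
    show "AE y in lborel. norm ((s y)\<^sup>2 * u y) \<le> norm (2 * c\<^sup>2 * u y + 2 * (y\<^sup>2 * u y))"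
    proof (rule AE_I2)
      fix y
      have "(s y)\<^sup>2 * u y \<le> (2 * c\<^sup>2 + 2 * y\<^sup>2) * u y" by (intro mult_right_mono sle profileD(3)[OF p])
      then show "norm ((s y)\<^sup>2 * u y) \<le> norm (2 * c\<^sup>2 * u y + 2 * (y\<^sup>2 * u y))"
        using profileD(3)[OF p, of y] by (simp add: algebra_simps abs_mult)
    qed
  qed measurable
  have x2: "integrable lborel (\<lambda>x. x\<^sup>2 * u (s x))" "(LINT x|lborel. x\<^sup>2 * u (s x)) = (LINT y|lborel. (s y)\<^sup>2 * u y)"
    using swap[OF s2] by (simp_all add: ss)
  have ps: "profile (\<lambda>x. u (s x)) g1"
    unfolding profile_def using prim x2(1) swap[OF profileD(4)[OF p]] swap[OF profileD(2)[OF p]] profileD(3,5)[OF p]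
    by (simp add: g1sq)
  have Js: "J (\<lambda>x. u (s x)) g1 = J u g + lam/2 * (LINT y|lborel. (s y)\<^sup>2 * u y - y\<^sup>2 * u y)"
    using swap(2)[OF profileD(2)[OF p]] swap(2)[OF h_comp_integrable[OF p]] s2 profileD(6)[OF p]
    unfolding J_split(1)[OF ps] J_split(1)[OF p] x2(2) by (simp add: g1sq right_diff_distrib)
  define q where "q y = (s y)\<^sup>2 * u y - y\<^sup>2 * u y" for y
  have qi: "integrable lborel q" unfolding q_def using s2 profileD(6)[OF p] by simp
  have q: "0 \<le> (LINT y|lborel. q y)"
    using Js min ps lam zero_le_mult_iff[of "lam / 2"] unfolding is_minimizer_def q_def by force
  define Q where "Q y = - (q y + q (c - y))" for y
  have Q: "Q y = (if y \<in> T then 4 * a * ((a - y) * - w y) else 0)" for y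
    using sym[of y] by (auto simp: Q_def q_def s_def swap_on_def w_def c_def power2_eq_square algebra_simps)
  have Qnn: "0 \<le> Q y" for y
  proof (cases "y \<in> T")
    case True
    then consider "y \<in> S" | "c - y \<in> S" by (auto simp: T_def)
    then have "0 \<le> (a - y) * - w y"
    proof cases
      case 1
      then show ?thesis using Sw[of y] Sa by (intro mult_nonneg_nonneg) auto
    next
      case 2
      have "w (c - y) = - w y" by (simp add: w_def)
      then have "w y \<ge> 0" "y \<ge> a" using Sw[OF 2] Sa 2 by (auto simp: c_def)
      then show ?thesis by (simp add: mult_nonpos_nonneg)
    qed
    then have "0 \<le> 4 * a * ((a - y) * - w y)" 
      by (rule mult_nonneg_nonneg[of "4 * a", rotated]) (use a in simp)
    then show ?thesis using True unfolding Q by simp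
  qed (simp add: Q)
  have Qi: "integrable lborel Q" unfolding Q_def[abs_def] using qi lborel_integral_reflect(2)[of q c] by simp
  have "(LINT y|lborel. Q y) = - 2 * (LINT y|lborel. q y)"
    unfolding Q_def using qi lborel_integral_reflect[of q c] by simp
  moreover have "0 \<le> (LINT y|lborel. Q y)" by (intro integral_nonneg_AE) (simp add: Qnn)
  ultimately have "(LINT y|lborel. Q y) = 0" using q by linarith
  then have "AE y in lborel. Q y = 0"
    using integral_nonneg_eq_0_iff_AE[OF Qi] Qnn by simp
  then have "AE y in lborel. y \<in> - {x0<..<\<beta>}"
  proof eventually_elim
    fix y assume Qy: "Q y = 0"
    show "y \<in> - {x0<..<\<beta>}"
    proof
      assume y: "y \<in> {x0<..<\<beta>}"
      have "y \<in> S" using y \<beta>(2) by auto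
      moreover have "w y < 0" using \<beta>(3)[OF y] .
      moreover have "y \<noteq> a" using wa \<open>w y < 0\<close> by auto
      ultimately have "y \<in> T" "(a - y) * - w y > 0" using Sa by (auto simp: T_def intro!: mult_pos_pos mult_pos_neg)
      then show False using Qy a Q[of y] by auto
    qed
  qed
  then have "AE y in lebesgue. y \<in> - {x0<..<\<beta>}" by (rule AE_completion)
  then have "(x0 + \<beta>) / 2 \<in> - {x0<..<\<beta>}" by (rule mem_closed_if_AE_lebesgue[rotated]) auto
  then show False using \<beta>(1) by simp
qed

lemma minimizer_reflect:
  assumes min: "is_minimizer u g"
  shows "is_minimizer (\<lambda>x. u (- x)) (\<lambda>x. - g (- x))"
proof -
  have p: "profile u g" using min by (simp add: is_minimizer_def)
  have r: "integrable lborel f \<Longrightarrow> integrable lborel (\<lambda>x. f (- x))" "(LINT x|lborel. f (- x)) = (LINT x|lborel. f x)" for f :: "real \<Rightarrow> real"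
    using lborel_integral_reflect[of f 0] by simp_all
  have pr: "profile (\<lambda>x. u (- x)) (\<lambda>x. - g (- x))"
    unfolding profile_def using is_primitive_reflect[OF profileD(1)[OF p], of 0] profileD[OF p]
      r[of u] r[of "\<lambda>x. (g x)\<^sup>2"] r[of "\<lambda>x. x\<^sup>2 * u x"] by simp
  have "J (\<lambda>x. u (- x)) (\<lambda>x. - g (- x)) = J u g"
    using r(2)[of "\<lambda>x. 1/2 * (g x)\<^sup>2 + lam/2 * x\<^sup>2 * u x + eps * h (u x)"] by (simp add: J_def)
  then show ?thesis using min pr by (simp add: is_minimizer_def)
qed

text \<open>Two points \<open>x < y\<close> with \<open>x + y > 0\<close> are mirror images about the midpoint \<open>(x + y) / 2 > 0\<close>. Evenness
follows by continuity, letting the midpoint tend to zero from either side.\<close>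

lemma minimizer_radially_decreasing:
  assumes min: "is_minimizer u g"
  shows "radially_decreasing u"
proof -
  have p: "profile u g" using min by (simp add: is_minimizer_def)
  have less: "u y \<le> u x" if "x < y" "0 < x + y" for x y
    using minimizer_reflection_ineq[OF min, of "(x + y) / 2" x] that by (simp add: field_simps)
  have less': "u (- y) \<le> u (- x)" if "x < y" "0 < x + y" for x y
    using minimizer_reflection_ineq[OF minimizer_reflect[OF min], of "(x + y) / 2" x] that by (simp add: field_simps)
  have cont: "isCont u x" for x using profileD(9)[OF p, of UNIV] by (simp add: continuous_on_eq_continuous_at)
  have even: "u (- x) = u x" if "x > 0" for x
  proof -
    have lim: "(u \<longlongrightarrow> u t) (at_right t)" "(u \<longlongrightarrow> u t) (at_left t)" for t using cont[of t] by (auto simp: isCont_def filterlim_at_split)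
    have "u x \<le> u (- x)"
    proof (rule tendsto_lowerbound[OF lim(1)])
      show "\<forall>\<^sub>F t in at_right (- x). u x \<le> u t"
        using eventually_at_right_real[of "-x" x] that less by (auto elim!: eventually_mono)
    qed simp
    moreover have "u (- x) \<le> u x"
    proof (rule tendsto_lowerbound[OF lim(2)])
      have "u (- x) \<le> u t" if "t \<in> {- x<..<x}" for t
        using less'[of "- t" x] that by simp
      then show "\<forall>\<^sub>F t in at_left x. u (- x) \<le> u t"
        using eventually_at_left_real[of "-x" x] that by (auto elim!: eventually_mono)
    qed simp
    ultimately show ?thesis by simp
  qed
  have "u (- x) = u x" for x
    using even[of x] even[of "- x"] by (cases "x = 0"; cases "x > 0") auto
  moreover have "u y \<le> u x" if "x \<in> {0..}" "y \<in> {0..}" "x \<le> y" for x y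
    using that less[of x y] by (cases "x = y") auto
  ultimately show ?thesis by (auto simp: radially_decreasing_def monotone_on_def)
qed

end

section \<open>The Euler-Lagrange equation and the free boundary\<close>

text \<open>Two integrations by parts: the second derivative of a tent is a combination of point masses at
\<open>l\<close>, \<open>m\<close> and \<open>r\<close>. On the two halves, \<open>(x - l) P x - Z x\<close> and \<open>(r - x) P x + Z x\<close> are explicit
antiderivatives.\<close>

lemma integral_tent_second_derivative:
  assumes Z: "\<And>x. (Z has_real_derivative P x) (at x)" and P: "\<And>x. (P has_real_derivative f x) (at x)"
    and f: "continuous_on UNIV f" and lmr: "l < m" "m < r"
  shows "(LINT x|lborel. f x * tent l m r x) = (Z r - Z m) / (r - m) - (Z m - Z l) / (m - l)"
proof -
  note [measurable] = borel_measurable_continuous_onI[OF f] borel_measurable_continuous_onI[OF tent_integrals(4)[OF lmr]]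
  let ?L = "\<lambda>x. f x * ((x - l) / (m - l))" and ?R = "\<lambda>x. f x * ((r - x) / (r - m))"
  have cL: "continuous_on UNIV ?L" and cR: "continuous_on UNIV ?R" using f lmr by (auto intro!: continuous_intros)
  have iL: "integrable lborel (\<lambda>x. indicator {l..m} x *\<^sub>R ?L x)" and iR: "integrable lborel (\<lambda>x. indicator {m..r} x *\<^sub>R ?R x)"
    using borel_integrable_atLeastAtMost'[OF continuous_on_subset[OF cL]] borel_integrable_atLeastAtMost'[OF continuous_on_subset[OF cR]]
    unfolding set_integrable_def by auto
  have "(LINT x|lborel. f x * tent l m r x) = (LINT x|lborel. indicator {l..m} x *\<^sub>R ?L x + indicator {m..r} x *\<^sub>R ?R x)"
  proof (rule integral_cong_AE)
    show "AE x in lborel. f x * tent l m r x = indicator {l..m} x *\<^sub>R ?L x + indicator {m..r} x *\<^sub>R ?R x"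
      using AE_lborel_singleton[of m] by eventually_elim (use lmr in \<open>auto simp: tent_eq indicator_def\<close>)
  qed measurable
  also have "\<dots> = (LINT x|lborel. indicator {l..m} x *\<^sub>R ?L x) + (LINT x|lborel. indicator {m..r} x *\<^sub>R ?R x)"
    using iL iR by (rule Bochner_Integration.integral_add)
  also have "(LINT x|lborel. indicator {l..m} x *\<^sub>R ?L x)
      = ((m - l) * P m - Z m) / (m - l) - ((l - l) * P l - Z l) / (m - l)"
  proof (rule integral_FTC_atLeastAtMost)
    show "((\<lambda>x. ((x - l) * P x - Z x) / (m - l)) has_vector_derivative ?L x) (at x within {l..m})" for x
    proof -
      have "((\<lambda>x. ((x - l) * P x - Z x) / (m - l)) has_real_derivative (((x - l) * f x + (1 - 0) * P x) - P x) / (m - l)) (at x)"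
        by (intro DERIV_cdivide DERIV_diff DERIV_mult' P Z DERIV_ident DERIV_const)
      then show ?thesis
        by (simp add: has_real_derivative_iff_has_vector_derivative[symmetric] has_field_derivative_at_within mult.commute)
    qed
  qed (use lmr cL continuous_on_subset in auto)
  also have "(LINT x|lborel. indicator {m..r} x *\<^sub>R ?R x)
      = ((r - r) * P r + Z r) / (r - m) - ((r - m) * P m + Z m) / (r - m)"
  proof (rule integral_FTC_atLeastAtMost)
    show "((\<lambda>x. ((r - x) * P x + Z x) / (r - m)) has_vector_derivative ?R x) (at x within {m..r})" for x
    proof -
      have "((\<lambda>x. ((r - x) * P x + Z x) / (r - m)) has_real_derivative (((r - x) * f x + (0 - 1) * P x) + P x) / (r - m)) (at x)"
        by (intro DERIV_cdivide DERIV_add DERIV_diff DERIV_mult' P Z DERIV_ident DERIV_const)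
      then show ?thesis
        by (simp add: has_real_derivative_iff_has_vector_derivative[symmetric] has_field_derivative_at_within mult.commute)
    qed
  qed (use lmr cR continuous_on_subset in auto)
  finally show ?thesis using lmr by (simp add: add_divide_distrib diff_divide_distrib)
qed

lemma affine_if_slopes_equal:
  fixes z :: "real \<Rightarrow> real"
  assumes I: "p \<in> I" "q \<in> I" "p < q"
    and s: "\<And>l m r. l \<in> I \<Longrightarrow> m \<in> I \<Longrightarrow> r \<in> I \<Longrightarrow> l < m \<Longrightarrow> m < r \<Longrightarrow> (z r - z m) / (r - m) = (z m - z l) / (m - l)"
  obtains A B where "\<And>x. x \<in> I \<Longrightarrow> z x = A + B * x"
proof
  define B where "B = (z q - z p) / (q - p)"
  define A where "A = z p - B * p"
  have "B * (q - p) = z q - z p" using I by (simp add: B_def)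
  then have q: "z q = A + B * q" by (simp add: A_def algebra_simps)
  fix x assume x: "x \<in> I"
  consider "x = p" | "x = q" | "x < p" | "p < x" "x < q" | "q < x" by linarith
  then show "z x = A + B * x"
  proof cases
    case 3
    then have "B = (z p - z x) / (p - x)" using s[OF x I(1,2)] I by (simp add: B_def)
    then have "B * (p - x) = z p - z x" using 3 by simp
    then show ?thesis by (simp add: A_def algebra_simps)
  next
    case 4
    define k where "k = (z x - z p) / (x - p)"
    have k: "k = (z q - z x) / (q - x)" using s[OF I(1) x I(2)] 4 by (simp add: k_def)
    have "k * (q - x) = z q - z x" unfolding k using 4 by simp
    moreover have kp: "k * (x - p) = z x - z p" using 4 by (simp add: k_def)
    ultimately have "k * (q - p) = z q - z p" by (simp add: algebra_simps)
    then have "k = B" using I by (simp add: B_def field_simps)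
    then show ?thesis using kp by (simp add: A_def algebra_simps)
  next
    case 5
    then have "B = (z x - z q) / (x - q)" using s[OF I(1,2) x] I by (simp add: B_def)
    then have "B * (x - q) = z x - z q" using 5 by simp
    then show ?thesis using q by (simp add: algebra_simps)
  qed (use q in \<open>auto simp: A_def\<close>)
qed

context droplet_energy begin

definition potential :: "(real \<Rightarrow> real) \<Rightarrow> real \<Rightarrow> real" where
  "potential u x = lam/2 * x\<^sup>2 + eps * h' (u x)"

text \<open>The Lagrange multiplier of the mass constraint: renormalizing the mass of \<open>u\<close> changes the energy at
this rate.\<close>

definition multiplier :: "(real \<Rightarrow> real) \<Rightarrow> (real \<Rightarrow> real) \<Rightarrow> real" where
  "multiplier u g = (LINT x|lborel. (g x)\<^sup>2) + (LINT x|lborel. potential u x * u x)"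

lemma potential_continuous: "profile u g \<Longrightarrow> continuous_on UNIV (potential u)"
  unfolding potential_def[abs_def]
  by (intro continuous_intros h_comp_continuous(2)) (auto intro: profileD)

lemma potential_integrable:
  assumes u: "profile u g" and v: "profile v k"
  shows "integrable lborel (\<lambda>x. potential u x * v x)"
proof -
  obtain B where B: "B > 0" "\<And>x. u x \<le> B" using profile_bounded[OF u] by blast
  note [measurable] = profileD(7)[OF v] borel_measurable_continuous_onI[OF potential_continuous[OF u]]
  have le: "\<bar>potential u x * v x\<bar> \<le> lam/2 * (x\<^sup>2 * v x) + eps * (2 * K * B) * v x" for x
  proof -
    have "\<bar>h' (u x)\<bar> \<le> 2 * K * B"
      using h'_bound[OF profileD(3)[OF u], of x] mult_left_mono[OF B(2)[of x], of "2 * K"] K by linarith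
    then have "eps * \<bar>h' (u x)\<bar> \<le> eps * (2 * K * B)" using eps by (intro mult_left_mono) auto
    moreover have "\<bar>potential u x\<bar> \<le> \<bar>lam/2 * x\<^sup>2\<bar> + \<bar>eps * h' (u x)\<bar>" unfolding potential_def by (rule abs_triangle_ineq)
    moreover have "\<bar>lam/2 * x\<^sup>2\<bar> + \<bar>eps * h' (u x)\<bar> = lam/2 * x\<^sup>2 + eps * \<bar>h' (u x)\<bar>" using lam eps by (simp add: abs_mult)
    ultimately have "\<bar>potential u x\<bar> \<le> lam/2 * x\<^sup>2 + eps * (2 * K * B)" by linarith
    then have "\<bar>potential u x\<bar> * v x \<le> (lam/2 * x\<^sup>2 + eps * (2 * K * B)) * v x"
      by (intro mult_right_mono profileD(3)[OF v])
    then show ?thesis using profileD(3)[OF v, of x] by (simp add: abs_mult algebra_simps)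
  qed
  have i: "integrable lborel (\<lambda>x. lam/2 * (x\<^sup>2 * v x) + eps * (2 * K * B) * v x)"
    using profileD(4,6)[OF v] by simp
  show ?thesis
    by (rule Bochner_Integration.integrable_bound[OF i]) (measurable, use le in \<open>auto intro: order_trans[OF _ abs_ge_self]\<close>)
qed

text \<open>The energy along the segment from \<open>u\<close> to \<open>v\<close> is at most \<open>J u g + t Q + t\<^sup>2 R\<close>, where \<open>Q\<close> is the claimed
non-negative quantity.\<close>

lemma first_variation:
  assumes min: "is_minimizer u g" and v: "profile v k"
  shows "0 \<le> (LINT x|lborel. g x * (k x - g x)) + (LINT x|lborel. potential u x * (v x - u x))"
proof -
  have u: "profile u g" using min by (simp add: is_minimizer_def)
  note [measurable] = profileD(7,8)[OF u] profileD(7,8)[OF v]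
  have dsq: "integrable lborel (\<lambda>x. (k x - g x)\<^sup>2)" "integrable lborel (\<lambda>x. (v x - u x)\<^sup>2)"
    using profileD(2)[OF u] profileD(2)[OF v] profile_square_integrable[OF u] profile_square_integrable[OF v]
    by (auto intro!: square_integrable_diff)
  have gi: "integrable lborel (\<lambda>x. g x * (k x - g x))"
    using profileD(2)[OF u] dsq by (intro integral_Cauchy_Schwarz(1)) auto
  have Vi: "integrable lborel (\<lambda>x. potential u x * (v x - u x))"
    using potential_integrable[OF u v] potential_integrable[OF u u] by (simp add: right_diff_distrib)
  define Q where "Q = (LINT x|lborel. g x * (k x - g x)) + (LINT x|lborel. potential u x * (v x - u x))"
  define R where "R = 1/2 * (LINT x|lborel. (k x - g x)\<^sup>2) + eps * K * (LINT x|lborel. (v x - u x)\<^sup>2)"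
  have lin: "(LINT x|lborel. f0 x + t * f1 x + t * f2 x + t\<^sup>2 * (1/2 * f3 x + eps * K * f4 x)) =
      (LINT x|lborel. f0 x) + t * ((LINT x|lborel. f1 x) + (LINT x|lborel. f2 x))
      + t\<^sup>2 * (1/2 * (LINT x|lborel. f3 x) + eps * K * (LINT x|lborel. f4 x))"
    if "integrable lborel f0" "integrable lborel f1" "integrable lborel f2" "integrable lborel f3" "integrable lborel f4"
    for f0 f1 f2 f3 f4 :: "real \<Rightarrow> real" and t
    using that by (simp add: distrib_left)
  have step: "0 \<le> Q + t * R" if t: "0 < t" "t \<le> 1" for t
  proof -
    let ?w = "\<lambda>x. (1 - t) * u x + t * v x" and ?gw = "\<lambda>x. (1 - t) * g x + t * k x"
    have p: "profile ?w ?gw" using t by (intro profile_convex u v) auto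
    define F where "F u g x = 1/2 * (g x)\<^sup>2 + lam/2 * x\<^sup>2 * u x + eps * h (u x)" for u g :: "real \<Rightarrow> real" and x
    have Fi: "integrable lborel (F u g)" "integrable lborel (F ?w ?gw)"
      using J_split(2)[OF u] J_split(2)[OF p] by (auto simp: F_def[abs_def])
    have pt: "F ?w ?gw x \<le> F u g x + t * (g x * (k x - g x)) + t * (potential u x * (v x - u x))
        + t\<^sup>2 * (1/2 * (k x - g x)\<^sup>2 + eps * K * (v x - u x)\<^sup>2)" for x
    proof -
      have d: "?w x - u x = t * (v x - u x)" by (simp add: algebra_simps)
      have "h (?w x) \<le> h (u x) + h' (u x) * (t * (v x - u x)) + K * (t * (v x - u x))\<^sup>2"
        using h_taylor[OF profileD(3)[OF u, of x] profileD(3)[OF p, of x]] unfolding d by linarith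
      then have "eps * h (?w x) \<le> eps * (h (u x) + h' (u x) * (t * (v x - u x)) + K * (t * (v x - u x))\<^sup>2)"
        using eps by (intro mult_left_mono) auto
      moreover have "eps * (h (u x) + h' (u x) * (t * (v x - u x)) + K * (t * (v x - u x))\<^sup>2)
          = eps * h (u x) + t * (eps * h' (u x) * (v x - u x)) + t\<^sup>2 * (eps * K * (v x - u x)\<^sup>2)"
        by (simp add: power2_eq_square algebra_simps)
      moreover have "1/2 * (?gw x)\<^sup>2 = 1/2 * (g x)\<^sup>2 + t * (g x * (k x - g x)) + t\<^sup>2 * (1/2 * (k x - g x)\<^sup>2)"
        by (simp add: power2_eq_square field_simps)
      moreover have "lam/2 * x\<^sup>2 * ?w x = lam/2 * x\<^sup>2 * u x + t * (lam/2 * x\<^sup>2 * (v x - u x))"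
        by (simp add: field_simps)
      moreover have "t * (potential u x * (v x - u x)) = t * (lam/2 * x\<^sup>2 * (v x - u x)) + t * (eps * h' (u x) * (v x - u x))"
        by (simp add: potential_def algebra_simps)
      ultimately show ?thesis unfolding F_def distrib_left[of "t\<^sup>2"] by linarith
    qed
    have "J u g \<le> J ?w ?gw" using min p by (simp add: is_minimizer_def)
    also have "\<dots> = (LINT x|lborel. F ?w ?gw x)" by (simp add: J_def F_def)
    also have "\<dots> \<le> (LINT x|lborel. F u g x + t * (g x * (k x - g x)) + t * (potential u x * (v x - u x))
        + t\<^sup>2 * (1/2 * (k x - g x)\<^sup>2 + eps * K * (v x - u x)\<^sup>2))"
      using Fi gi Vi dsq pt by (intro integral_mono) auto
    also have "\<dots> = J u g + t * Q + t\<^sup>2 * R"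
      unfolding lin[OF Fi(1) gi Vi dsq] by (simp add: J_def F_def[abs_def] Q_def R_def)
    finally have "0 \<le> t * (Q + t * R)" by (simp add: power2_eq_square algebra_simps)
    then show ?thesis using t(1) by (simp add: zero_le_mult_iff)
  qed
  have "0 \<le> Q"
  proof (rule ccontr)
    assume n: "\<not> 0 \<le> Q"
    have R: "R \<ge> 0" unfolding R_def using eps K by simp
    \<comment> \<open>So small that \<open>t * R\<close> cannot compensate half of a negative \<open>Q\<close>.\<close>
    define t where "t = min 1 (- Q / (2 * (R + 1)))"
    have "0 < - Q / (2 * (R + 1))" using n R by (intro divide_pos_pos) auto
    then have t: "0 < t" "t \<le> 1" "t \<le> - Q / (2 * (R + 1))" by (auto simp: t_def)
    have "t * R \<le> t * (R + 1)" using t R by simp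
    also have "\<dots> \<le> - Q / (2 * (R + 1)) * (R + 1)" using t R by (intro mult_right_mono) auto
    also have "\<dots> = - Q / 2" using R by (simp add: field_simps)
    finally show False using step[OF t(1,2)] n by simp
  qed
  then show ?thesis by (simp add: Q_def)
qed

text \<open>The competitor is \<open>(u + s' \<sigma> \<phi>) / c\<close>, where \<open>c\<close> restores the mass to one and \<open>s' \<le> s\<close> is so small that
\<open>c\<close> is positive. The lower sign \<open>\<sigma> = - 1\<close> is available only if \<open>u\<close> is positive under the
tent, which is expressed by the last hypothesis.\<close>

lemma tent_variation:
  assumes min: "is_minimizer u g" and lmr: "l < m" "m < r" and s: "s > 0" and \<sigma>: "\<sigma> = 1 \<or> \<sigma> = - 1"
    and nn: "\<And>x. 0 \<le> u x + s * (\<sigma> * tent l m r x)"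
  shows "0 \<le> \<sigma> * ((u m - u l) / (m - l) - (u r - u m) / (r - m)
       + (LINT x|lborel. (potential u x - multiplier u g) * tent l m r x))"
proof -
  have u: "profile u g" using min by (simp add: is_minimizer_def)
  note [measurable] = profileD(7,8)[OF u]
  let ?\<phi> = "tent l m r" and ?\<psi> = "tent_slope l m r"
  define I where "I = (LINT x|lborel. ?\<phi> x)"
  have I: "I > 0" unfolding I_def by (rule tent_integrals(3)[OF lmr])
  define s' where "s' = min s (1 / (2 * I))"
  have s': "s' > 0" "s' \<le> s" "s' * I \<le> 1/2" using s I by (auto simp: s'_def min_def field_simps)
  have nn': "0 \<le> u x + s' * \<sigma> * ?\<phi> x" for x
  proof (cases "\<sigma> = 1")
    case True
    then show ?thesis using profileD(3)[OF u, of x] tent_bounds(1)[OF lmr, of x] s' by simp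
  next
    case False
    then have "s' * ?\<phi> x \<le> s * ?\<phi> x" "\<sigma> = -1" using s' tent_bounds(1)[OF lmr, of x] \<sigma> by (auto intro: mult_right_mono)
    then show ?thesis using nn[of x] by simp
  qed
  define c where "c = 1 + s' * \<sigma> * I"
  have c: "c > 0"
  proof -
    have "0 \<le> s' * I" using s' I by simp
    then show ?thesis using s'(3) \<sigma> by (auto simp: c_def)
  qed
  have \<phi>i: "integrable lborel ?\<phi>" "integrable lborel (\<lambda>x. x\<^sup>2 * ?\<phi> x)" using tent_integrals[OF lmr] by auto
  have \<psi>m[measurable]: "?\<psi> \<in> borel_measurable borel" unfolding tent_slope_def[abs_def] by measurable
  have v: "profile (\<lambda>x. (u x + s' * \<sigma> * ?\<phi> x) / c) (\<lambda>x. (g x + s' * \<sigma> * ?\<psi> x) / c)"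
  proof (rule profile_normalize[OF _ _ nn' _ _ c])
    show "is_primitive (\<lambda>x. u x + s' * \<sigma> * ?\<phi> x) (\<lambda>x. g x + s' * \<sigma> * ?\<psi> x)"
      by (intro is_primitive_add is_primitive_scale profileD(1)[OF u] tent_primitive lmr)
    have "integrable lborel (\<lambda>x. (- (s' * \<sigma>) * ?\<psi> x)\<^sup>2)"
      using tent_slope_square_integrable[OF lmr] by (simp add: power_mult_distrib)
    then show "integrable lborel (\<lambda>x. (g x + s' * \<sigma> * ?\<psi> x)\<^sup>2)"
      using square_integrable_diff[of g lborel "\<lambda>x. - (s' * \<sigma>) * ?\<psi> x"] profileD(2)[OF u] by simp
    show "integrable lborel (\<lambda>x. u x + s' * \<sigma> * ?\<phi> x)" "(LINT x|lborel. u x + s' * \<sigma> * ?\<phi> x) = c"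
      using profileD(4,5)[OF u] \<phi>i by (simp_all add: c_def I_def)
    have "integrable lborel (\<lambda>x. x\<^sup>2 * u x + s' * \<sigma> * (x\<^sup>2 * ?\<phi> x))" using profileD(6)[OF u] \<phi>i by simp
    then show "integrable lborel (\<lambda>x. x\<^sup>2 * (u x + s' * \<sigma> * ?\<phi> x))" by (simp add: algebra_simps)
  qed
  define V where "V = potential u"
  have V\<phi>: "integrable lborel (\<lambda>x. V x * ?\<phi> x)"
    unfolding V_def using tent_bounds(3)[OF lmr]
    by (intro integrable_mult_compact_support[of _ _ l r] locally_integrable_continuous potential_continuous[OF u] tent_integrals(4)[OF lmr]) auto
  have Vu: "integrable lborel (\<lambda>x. V x * u x)" unfolding V_def by (rule potential_integrable[OF u u])
  have g2: "integrable lborel (\<lambda>x. g x * g x)" using profileD(2)[OF u] by (simp add: power2_eq_square)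
  note g\<psi> = integral_mult_tent_slope[OF profileD(1)[OF u] lmr]
  have e1: "g x * ((g x + s' * \<sigma> * ?\<psi> x) / c - g x) = s' * \<sigma> / c * (g x * ?\<psi> x - I * (g x * g x))" for x
    using c by (simp add: c_def field_simps)
  have e2: "V x * ((u x + s' * \<sigma> * ?\<phi> x) / c - u x) = s' * \<sigma> / c * (V x * ?\<phi> x - I * (V x * u x))" for x
    using c by (simp add: c_def field_simps)
  have "0 \<le> s' * \<sigma> / c * ((LINT x|lborel. g x * ?\<psi> x) - I * (LINT x|lborel. g x * g x))
     + s' * \<sigma> / c * ((LINT x|lborel. V x * ?\<phi> x) - I * (LINT x|lborel. V x * u x))"
    using first_variation[OF min v] unfolding V_def[symmetric] e1 e2
    using g\<psi>(1) g2 V\<phi> Vu by simp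
  also have "\<dots> = s' / c * (\<sigma> * ((LINT x|lborel. g x * ?\<psi> x) + ((LINT x|lborel. V x * ?\<phi> x) - multiplier u g * I)))"
    unfolding multiplier_def V_def[symmetric] power2_eq_square by (simp add: algebra_simps)
  also have "(LINT x|lborel. V x * ?\<phi> x) - multiplier u g * I = (LINT x|lborel. (V x - multiplier u g) * ?\<phi> x)"
    using V\<phi> \<phi>i by (simp add: left_diff_distrib I_def)
  finally have "0 \<le> \<sigma> * ((LINT x|lborel. g x * ?\<psi> x) + (LINT x|lborel. (V x - multiplier u g) * ?\<phi> x))"
    using s'(1) c by (simp add: zero_le_mult_iff zero_le_divide_iff)
  then show ?thesis unfolding g\<psi>(2) V_def .
qed

lemma second_antiderivative:
  assumes u: "profile u g"
  obtains Z P where "\<And>x. (Z has_real_derivative P x) (at x)"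
    "\<And>x. (P has_real_derivative potential u x - multiplier u g) (at x)"
proof -
  have c: "continuous_on UNIV (\<lambda>x. potential u x - multiplier u g)"
    by (intro continuous_intros potential_continuous[OF u])
  obtain P where P: "is_primitive P (\<lambda>x. potential u x - multiplier u g)"
    using primitive_exists[OF locally_integrable_continuous[OF c]] by metis
  obtain Z where Z: "is_primitive Z P"
    using primitive_exists[OF locally_integrable_continuous[OF primitive_continuous[OF P]]] by metis
  show ?thesis using that primitive_deriv[OF P c] primitive_deriv[OF Z primitive_continuous[OF P]] by blast
qed

text \<open>Adding a tent is always possible and gives the inequality; where \<open>u\<close> is bounded below by a positive
constant a small tent may also be subtracted, and this gives the reverse inequality.\<close>

lemma slopes_concave:
  assumes min: "is_minimizer u g" and lmr: "l < m" "m < r"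
    and Z: "\<And>x. (Z has_real_derivative P x) (at x)" "\<And>x. (P has_real_derivative potential u x - multiplier u g) (at x)"
  shows "((u r - Z r) - (u m - Z m)) / (r - m) \<le> ((u m - Z m) - (u l - Z l)) / (m - l)"
    and "(\<And>x. x \<in> {l..r} \<Longrightarrow> 0 < u x) \<Longrightarrow>
      ((u r - Z r) - (u m - Z m)) / (r - m) = ((u m - Z m) - (u l - Z l)) / (m - l)"
proof -
  have u: "profile u g" using min by (simp add: is_minimizer_def)
  have c: "continuous_on UNIV (\<lambda>x. potential u x - multiplier u g)"
    by (intro continuous_intros potential_continuous[OF u])
  note int = integral_tent_second_derivative[OF Z c lmr]
  have e: "(u m - u l) / (m - l) - (u r - u m) / (r - m) + ((Z r - Z m) / (r - m) - (Z m - Z l) / (m - l))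
     = ((u m - Z m) - (u l - Z l)) / (m - l) - ((u r - Z r) - (u m - Z m)) / (r - m)"
    by (simp add: diff_divide_distrib)
  have "0 \<le> u x + 1 * (1 * tent l m r x)" for x using profileD(3)[OF u, of x] tent_bounds(1)[OF lmr, of x] by simp
  from tent_variation[OF min lmr _ _ this] 
  show le: "((u r - Z r) - (u m - Z m)) / (r - m) \<le> ((u m - Z m) - (u l - Z l)) / (m - l)"
    unfolding int e by simp
  assume pos: "\<And>x. x \<in> {l..r} \<Longrightarrow> 0 < u x"
  obtain x0 where x0: "x0 \<in> {l..r}" "\<And>x. x \<in> {l..r} \<Longrightarrow> u x0 \<le> u x"
    using continuous_attains_inf[of "{l..r}" u] profileD(9)[OF u] lmr by auto
  have nn: "0 \<le> u x + u x0 * (- 1 * tent l m r x)" for x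
  proof (cases "x \<in> {l..r}")
    case True
    have "u x0 * tent l m r x \<le> u x0 * 1" using tent_bounds(2)[OF lmr] pos[OF x0(1)] by (intro mult_left_mono) auto
    then show ?thesis using x0(2)[OF True] by simp
  next
    case False
    then show ?thesis using tent_bounds(3)[OF lmr, of x] profileD(3)[OF u, of x] by auto
  qed
  from tent_variation[OF min lmr pos[OF x0(1)] _ nn]
  have "0 \<le> (-1) * (((u m - Z m) - (u l - Z l)) / (m - l) - ((u r - Z r) - (u m - Z m)) / (r - m))"
    unfolding int e by simp
  then show "((u r - Z r) - (u m - Z m)) / (r - m) = ((u m - Z m) - (u l - Z l)) / (m - l)"
    using le by simp
qed

text \<open>Otherwise \<open>u'' = potential u - \<mu>\<close> on the whole line. This is at least \<open>1\<close> for large \<open>x\<close>, because \<open>h' u\<close>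
is bounded, so \<open>u'\<close> becomes positive, although \<open>u\<close> is non-increasing on \<open>{0..}\<close>.\<close>

lemma minimizer_has_zero:
  assumes min: "is_minimizer u g" and rad: "radially_decreasing u"
  shows "\<exists>x\<ge>0. u x = 0"
proof (rule ccontr)
  assume "\<not> ?thesis"
  have u: "profile u g" using min by (simp add: is_minimizer_def)
  have even: "u (- x) = u x" for x using rad by (simp add: radially_decreasing_def)
  have pos0: "0 < u x" if "x \<ge> 0" for x using \<open>\<not> (\<exists>x\<ge>0. u x = 0)\<close> that profileD(3)[OF u, of x] by (metis less_eq_real_def)
  have pos: "0 < u x" for x using pos0[of x] pos0[of "- x"] even[of x] by (cases "x \<ge> 0") auto
  obtain Z P where Z: "\<And>x. (Z has_real_derivative P x) (at x)" "\<And>x. (P has_real_derivative potential u x - multiplier u g) (at x)"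
    using second_antiderivative[OF u] by metis
  obtain A B where AB: "\<And>x. u x - Z x = A + B * x"
  proof (rule affine_if_slopes_equal[of 0 UNIV 1 "\<lambda>x. u x - Z x"])
    show "(u r - Z r - (u m - Z m)) / (r - m) = (u m - Z m - (u l - Z l)) / (m - l)" if "l < m" "m < r" for l m r
      by (rule slopes_concave(2)[OF min that Z pos])
  next
    fix A B assume "\<And>x. x \<in> UNIV \<Longrightarrow> u x - Z x = A + B * x"
    then show thesis by (intro that) auto
  qed auto
  have du: "(u has_real_derivative P x + B) (at x)" for x
  proof -
    have "((\<lambda>x. Z x + (A + B * x)) has_real_derivative P x + B) (at x)"
      by (rule derivative_eq_intros Z refl | simp)+
    moreover have "(\<lambda>x. Z x + (A + B * x)) = u" using AB by (auto simp: fun_eq_iff algebra_simps)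
    ultimately show ?thesis by simp
  qed
  obtain b where b: "b > 0" "\<And>x. u x \<le> b" using profile_bounded[OF u] by blast
  define c where "c = eps * (2 * K * b) + multiplier u g"
  \<comment> \<open>Beyond \<open>X\<close> the quadratic potential exceeds all other terms by one.\<close>
  define X where "X = sqrt (2 * (\<bar>c\<bar> + 1) / lam)"
  have X: "X \<ge> 0" "lam / 2 * X\<^sup>2 = \<bar>c\<bar> + 1" using lam by (simp_all add: X_def)
  have ge1: "1 \<le> potential u x - multiplier u g" if "X \<le> x" for x
  proof -
    have "lam / 2 * X\<^sup>2 \<le> lam / 2 * x\<^sup>2" using that X lam by (intro mult_left_mono power_mono) auto
    moreover have "\<bar>h' (u x)\<bar> \<le> 2 * K * b"
      using h'_bound[OF profileD(3)[OF u], of x] mult_left_mono[OF b(2)[of x], of "2 * K"] K by linarith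
    then have "eps * - h' (u x) \<le> eps * (2 * K * b)" using eps by (intro mult_left_mono) auto
    then have "- (eps * h' (u x)) \<le> c - multiplier u g" by (simp add: c_def)
    ultimately show ?thesis using X(2) abs_ge_self[of c] unfolding potential_def by linarith
  qed
  \<comment> \<open>Beyond \<open>X\<close> the derivative \<open>P + B\<close> of \<open>u\<close> grows at least linearly, so it is positive from \<open>Y\<close> on.\<close>
  define Y where "Y = X + \<bar>P X + B\<bar> + 1"
  have dpos: "0 < P x + B" if "Y \<le> x" for x
  proof -
    have "X \<le> x" using that by (simp add: Y_def)
    have "P X - X \<le> P x - x"
    proof (rule DERIV_nonneg_imp_nondecreasing[OF \<open>X \<le> x\<close>])
      fix y assume "X \<le> y"
      then show "\<exists>d. ((\<lambda>x. P x - x) has_real_derivative d) (at y) \<and> 0 \<le> d"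
        using ge1[of y] by (intro exI[of _ "potential u y - multiplier u g - 1"] conjI DERIV_diff Z DERIV_ident) auto
    qed
    then show ?thesis using that unfolding Y_def by linarith
  qed
  have "u Y < u (Y + 1)"
    by (rule DERIV_pos_imp_increasing) (use du dpos in auto)
  moreover have "u (Y + 1) \<le> u Y"
    using rad X(1) by (auto simp: radially_decreasing_def monotone_on_def Y_def)
  ultimately show False by simp
qed

text \<open>On \<open>{- R..R}\<close> the minimizer agrees with the twice differentiable function \<open>y\<close>. Outside it vanishes,
and there the chord inequality across \<open>\<plusminus> R\<close> bounds \<open>y\<close> from below by zero. So \<open>y\<close> has local minima
at \<open>\<plusminus> R\<close> and its derivative vanishes there; \<open>u\<close> inherits this because \<open>\<bar>u\<bar> \<le> \<bar>y\<bar>\<close>.\<close>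

lemma minimizer_regular:
  assumes min: "is_minimizer u g" and rad: "radially_decreasing u"
  shows "bounded (closure {x. u x \<noteq> 0})" "u C1_differentiable_on UNIV"
proof -
  have u: "profile u g" using min by (simp add: is_minimizer_def)
  have even: "u (- x) = u x" for x using rad by (simp add: radially_decreasing_def)
  have dec: "u y \<le> u x" if "0 \<le> x" "x \<le> y" for x y
    using rad that by (auto simp: radially_decreasing_def monotone_on_def)
  have u0: "0 \<le> u x" for x by (rule profileD(3)[OF u])
  have cont: "continuous_on UNIV u" by (rule profileD(9)[OF u])
  define N where "N = {x. u x = 0} \<inter> {0..}"
  have N: "closed N" "N \<noteq> {}" "bdd_below N"
    unfolding N_def using minimizer_has_zero[OF min rad] cont
    by (auto intro!: closed_Int closed_Collect_eq continuous_intros)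
  define R where "R = Inf N"
  have "R \<in> N" unfolding R_def by (rule closed_contains_Inf[OF N(2,3,1)])
  then have R: "u R = 0" "R \<ge> 0" by (auto simp: N_def)
  have out0: "u x = 0" if "R \<le> \<bar>x\<bar>" for x
  proof -
    have "u \<bar>x\<bar> = 0" using dec[of R "\<bar>x\<bar>"] that R u0[of "\<bar>x\<bar>"] by simp
    then show ?thesis using even[of x] by (cases "x \<ge> 0") auto
  qed
  have in0: "0 < u x" if "\<bar>x\<bar> < R" for x
  proof -
    have "\<bar>x\<bar> \<notin> N" using cInf_lower[OF _ N(3), of "\<bar>x\<bar>"] that by (auto simp: R_def)
    then have "u \<bar>x\<bar> \<noteq> 0" by (simp add: N_def)
    then show ?thesis using u0[of x] even[of x] by (cases "x \<ge> 0") auto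
  qed
  have Rpos: "R > 0"
  proof (rule ccontr)
    assume "\<not> R > 0"
    then have "u = (\<lambda>_. 0)" using out0 R by auto
    then show False using profileD(5)[OF u] by simp
  qed
  have "{x. u x \<noteq> 0} \<subseteq> {-R..R}"
  proof
    fix x assume "x \<in> {x. u x \<noteq> 0}"
    then have "\<not> R \<le> \<bar>x\<bar>" using out0 by auto
    then show "x \<in> {-R..R}" by auto
  qed
  then have "closure {x. u x \<noteq> 0} \<subseteq> {-R..R}" by (rule closure_minimal) simp
  then show "bounded (closure {x. u x \<noteq> 0})" using bounded_subset bounded_closed_interval by blast
  obtain Z P where Z: "\<And>x. (Z has_real_derivative P x) (at x)" "\<And>x. (P has_real_derivative potential u x - multiplier u g) (at x)"
    using second_antiderivative[OF u] by metis
  have Zc: "continuous_on UNIV Z" and Pc: "continuous_on UNIV P"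
    using Z DERIV_isCont by (blast intro: continuous_at_imp_continuous_on)+
  obtain A B where AB0: "\<And>x. x \<in> {-R<..<R} \<Longrightarrow> u x - Z x = A + B * x"
  proof (rule affine_if_slopes_equal[of 0 "{-R<..<R}" "R/2" "\<lambda>x. u x - Z x"])
    show "(u r - Z r - (u m - Z m)) / (r - m) = (u m - Z m - (u l - Z l)) / (m - l)"
      if "l \<in> {-R<..<R}" "m \<in> {-R<..<R}" "r \<in> {-R<..<R}" "l < m" "m < r" for l m r
    proof (rule slopes_concave(2)[OF min that(4,5) Z])
      show "0 < u x" if "x \<in> {l..r}" for x using that \<open>l \<in> _\<close> \<open>r \<in> _\<close> by (intro in0) auto
    qed
  next
    fix A B assume "\<And>x. x \<in> {-R<..<R} \<Longrightarrow> u x - Z x = A + B * x"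
    then show thesis by (rule that)
  qed (use Rpos in auto)
  define y where "y x = Z x + (A + B * x)" for x
  have dy: "(y has_real_derivative P x + B) (at x)" for x
    unfolding y_def by (rule derivative_eq_intros Z refl | simp)+
  have uy: "u x = y x" if "\<bar>x\<bar> \<le> R" for x
  proof -
    have "closed {x. u x = y x}"
      unfolding y_def using cont Zc by (intro closed_Collect_eq continuous_intros)
    moreover have "{-R<..<R} \<subseteq> {x. u x = y x}" using AB0 by (force simp: y_def)
    ultimately have "closure {-R<..<R} \<subseteq> {x. u x = y x}" by (intro closure_minimal)
    moreover have "x \<in> closure {-R<..<R}" using that Rpos by (auto simp: abs_le_iff)
    ultimately show ?thesis by blast
  qed
  have yR: "y R = 0" "y (- R) = 0" using uy[of R] uy[of "- R"] R out0[of "- R"] by auto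
  have zy: "u x - Z x = A + B * x" if "\<bar>x\<bar> \<le> R" for x using uy[OF that] by (simp add: y_def)
  have ynn: "0 \<le> y x" if "\<bar>x\<bar> < 3 * R" for x
  proof -
    consider "\<bar>x\<bar> \<le> R" | "R < x" | "x < - R" by linarith
    then show ?thesis
    proof cases
      case 1
      then show ?thesis using uy[OF 1] u0[of x] by simp
    next
      case 2
      have "((u x - Z x) - (u R - Z R)) / (x - R) \<le> ((u R - Z R) - (u (-R) - Z (-R))) / (R - (-R))"
        by (rule slopes_concave(1)[OF min _ 2 Z]) (use Rpos in simp)
      also have "\<dots> = B" using Rpos by (simp add: zy field_simps)
      finally have "(u x - Z x) - (u R - Z R) \<le> B * (x - R)" using 2 by (simp add: pos_divide_le_eq)
      moreover have "u x = 0" using out0[of x] 2 Rpos by simp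
      ultimately show ?thesis using yR(1) R by (simp add: y_def algebra_simps)
    next
      case 3
      have "((u R - Z R) - (u (-R) - Z (-R))) / (R - (-R)) \<le> ((u (-R) - Z (-R)) - (u x - Z x)) / (- R - x)"
        by (rule slopes_concave(1)[OF min 3 _ Z]) (use Rpos in simp)
      moreover have e: "((u R - Z R) - (u (-R) - Z (-R))) / (R - (-R)) = B" using Rpos by (simp add: zy field_simps)
      ultimately have "B \<le> ((u (-R) - Z (-R)) - (u x - Z x)) / (- R - x)" unfolding e by blast
      then have "B * (- R - x) \<le> (u (-R) - Z (-R)) - (u x - Z x)" using 3 by (simp add: pos_le_divide_eq)
      moreover have "u x = 0" "u (- R) = 0" using out0[of x] out0[of "- R"] 3 Rpos by auto
      ultimately show ?thesis using yR(2) by (simp add: y_def algebra_simps)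
    qed
  qed
  have zeroR: "P R + B = 0" "P (- R) + B = 0"
  proof -
    show "P R + B = 0"
      by (rule DERIV_local_min[OF dy Rpos]) (use ynn yR Rpos in auto)
    show "P (- R) + B = 0"
      by (rule DERIV_local_min[OF dy Rpos]) (use ynn yR Rpos in auto)
  qed
  \<comment> \<open>Clamping \<open>x\<close> to \<open>{- R..R}\<close> makes continuity of the derivative evident.\<close>
  define D where "D x = P (max (- R) (min R x)) + B" for x
  have Dc: "continuous_on UNIV D"
    unfolding D_def[abs_def] by (intro continuous_intros continuous_on_compose2[OF Pc]) auto
  have du: "(u has_real_derivative D x) (at x)" for x
  proof -
    consider "\<bar>x\<bar> < R" | "\<bar>x\<bar> > R" | "x = R \<or> x = - R" by linarith
    then show ?thesis
    proof cases
      case 1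
      then have D: "D x = P x + B" by (auto simp: D_def max_def min_def)
      have "\<forall>\<^sub>F t in nhds x. u t = y t"
        by (rule eventually_mono[OF eventually_nhds_in_open[of "{-R<..<R}"]]) (use 1 uy in auto)
      then show ?thesis using dy[of x] DERIV_cong_ev[of x x u y] D by simp
    next
      case 2
      then have D: "D x = 0" using zeroR Rpos by (auto simp: D_def max_def min_def)
      have "\<forall>\<^sub>F t in nhds x. u t = 0"
        by (rule eventually_mono[OF eventually_nhds_in_open[of "- {-R..R}"]]) (use 2 out0 in \<open>auto intro!: out0\<close>)
      then show ?thesis using DERIV_cong_ev[of x x u "\<lambda>_. 0"] D by simp
    next
      case 3
      then have D: "D x = 0" and Px: "P x + B = 0" using zeroR Rpos by (auto simp: D_def max_def min_def)
      have ux: "u x = 0" "y x = 0" using 3 yR R out0[of x] by auto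
      have yl: "((\<lambda>t. (y t - y x) / (t - x)) \<longlongrightarrow> 0) (at x)"
        using dy[of x] Px by (simp add: has_field_derivative_iff)
      have "((\<lambda>t. (u t - u x) / (t - x)) \<longlongrightarrow> 0) (at x)"
      proof (rule Lim_null_comparison[OF _ tendsto_norm_zero[OF yl]])
        have "\<bar>u t\<bar> \<le> \<bar>y t\<bar>" for t using uy[of t] out0[of t] by (cases "\<bar>t\<bar> \<le> R") auto
        then show "\<forall>\<^sub>F t in at x. norm ((u t - u x) / (t - x)) \<le> norm ((y t - y x) / (t - x))"
          by (intro always_eventually allI) (simp add: ux divide_right_mono)
      qed
      then show ?thesis using D by (simp add: has_field_derivative_iff)
    qed
  qed
  show "u C1_differentiable_on UNIV"
    unfolding C1_differentiable_on_def using du Dc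
    by (auto simp: has_real_derivative_iff_has_vector_derivative)
qed

end

section \<open>Existence of a regular, radially decreasing minimizer\<close>

text \<open>For \<open>s = \<plusminus> 1\<close>, the function \<open>K (x - a)\<^sup>2 + s (h x - h a - h' a (x - a))\<close> vanishes at \<open>a\<close>, and it is monotone
on either side of \<open>a\<close> because \<open>h'\<close> has Lipschitz constant \<open>2 K\<close>.\<close>

lemma taylor_quadratic_bound:
  fixes h h' h'' :: "real \<Rightarrow> real"
  assumes d1: "\<And>x. 0 \<le> x \<Longrightarrow> (h has_real_derivative h' x) (at x within {0..})"
    and d2: "\<And>x. 0 \<le> x \<Longrightarrow> (h' has_real_derivative h'' x) (at x within {0..})"
    and b: "\<And>x. x > 0 \<Longrightarrow> \<bar>h'' x\<bar> \<le> 2 * K"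
    and a: "a \<ge> 0" and c: "c \<ge> 0"
  shows "\<bar>h c - h a - h' a * (c - a)\<bar> \<le> K * (c - a)\<^sup>2"
proof -
  have at: "(h has_real_derivative h' x) (at x)" "(h' has_real_derivative h'' x) (at x)" if "x > 0" for x
    using d1[of x] d2[of x] that at_within_interior[of x "{0..}"] by auto
  have ch: "continuous_on {0..} h" using d1 by (intro DERIV_continuous_on[where D = h']) auto
  have ch': "continuous_on {0..} h'" using d2 by (intro DERIV_continuous_on[where D = h'']) auto
  have lip: "\<bar>h' y - h' x\<bar> \<le> 2 * K * (y - x)" if xy: "0 \<le> x" "x < y" for x y
  proof -
    have dif: "h' differentiable (at w)" if "x < w" for w
      using at(2)[of w] that xy unfolding real_differentiable_def by auto
    have "\<exists>l z. x < z \<and> z < y \<and> (h' has_real_derivative l) (at z) \<and> h' y - h' x = (y - x) * l"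
      by (rule MVT[OF xy(2) continuous_on_subset[OF ch']])
        (use xy dif in auto)
    then obtain l z where z: "x < z" "(h' has_real_derivative l) (at z)" "h' y - h' x = (y - x) * l" by blast
    have "l = h'' z" using z xy at(2)[of z] DERIV_unique by force
    then have "\<bar>l\<bar> \<le> 2 * K" using b[of z] z xy by simp
    then have "(y - x) * \<bar>l\<bar> \<le> (y - x) * (2 * K)" using xy by (intro mult_left_mono) auto
    then show ?thesis using z(3) xy by (simp add: abs_mult mult.commute)
  qed
  have one_sided: "0 \<le> K * (c - a)\<^sup>2 + s * (h c - h a - h' a * (c - a))" if s: "\<bar>s\<bar> = 1" for s
  proof -
    define q where "q x = K * (x - a)\<^sup>2 + s * (h x - h a - h' a * (x - a))" for x
    have dq: "(q has_real_derivative 2 * K * (x - a) + s * (h' x - h' a)) (at x)" if "x > 0" for x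
      unfolding q_def by (rule derivative_eq_intros at(1) that refl | simp)+
    have cq: "continuous_on {0..} q" unfolding q_def by (intro continuous_intros ch)
    have qa: "q a = 0" by (simp add: q_def)
    consider "a = c" | "a < c" | "c < a" by linarith
    then have "0 \<le> q c"
    proof cases
      case 2
      have "q a \<le> q c"
      proof (rule DERIV_nonneg_imp_increasing_open[of a c q])
        fix x assume x: "a < x" "x < c"
        have "\<bar>s * (h' x - h' a)\<bar> \<le> 2 * K * (x - a)" using lip[OF a x(1)] s by (simp add: abs_mult)
        then show "\<exists>y. (q has_real_derivative y) (at x) \<and> 0 \<le> y"
          using dq[of x] x a by (intro exI[of _ "2 * K * (x - a) + s * (h' x - h' a)"]) (auto simp: abs_le_iff)
      qed (use 2 a continuous_on_subset[OF cq] in auto)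
      then show ?thesis using qa by simp
    next
      case 3
      have "q a \<le> q c"
      proof (rule DERIV_nonpos_imp_decreasing_open[of c a q])
        fix x assume x: "c < x" "x < a"
        have "0 \<le> x" using x c by simp
        have "\<bar>s * (h' x - h' a)\<bar> \<le> 2 * K * (a - x)"
          using lip[OF \<open>0 \<le> x\<close> x(2)] s by (simp add: abs_mult abs_minus_commute)
        then have "2 * K * (x - a) + s * (h' x - h' a) \<le> 0" by (simp add: abs_le_iff algebra_simps)
        then show "\<exists>y. (q has_real_derivative y) (at x) \<and> y \<le> 0"
          using dq[of x] x c by (intro exI[of _ "2 * K * (x - a) + s * (h' x - h' a)"]) auto
      qed (use 3 c continuous_on_subset[OF cq] in auto)
      then show ?thesis using qa by simp
    qed (use qa in simp)
    then show ?thesis by (simp add: q_def)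
  qed
  show ?thesis using one_sided[of 1] one_sided[of "-1"] by (simp add: abs_le_iff)
qed

theorem theorem1p4:
  fixes lam A :: real and h :: "real \<Rightarrow> real"
  assumes "lam > 0"
    and "Ck_on 2 {0..} h" and "Ck_on 4 {0<..} h"
    and "h 0 = 0" and "(h has_real_derivative 0) (at 0 within {0..})"
    and "\<And>r. r > 0 \<Longrightarrow> \<bar>(deriv ^^ 2) h r\<bar> \<le> A / 2 * min (1 / sqrt r) (sqrt r)"
    and "\<And>H::real. \<exists>L::real. \<forall>r. 0 < r \<and> r \<le> H \<longrightarrow>
           \<bar>(deriv ^^ 4) h r\<bar> \<le> L / (8 * r powr (3/2))"
  shows "\<forall>eps>0. \<exists>\<rho> :: real \<Rightarrow> real.
           (\<forall>x. \<rho> x \<ge> 0) \<and>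
           density lborel \<rho> \<in> P2 \<and>
           (\<forall>M\<in>P2. energy lam h eps (density lborel \<rho>) \<le> energy lam h eps M) \<and>
           radially_decreasing \<rho> \<and>
           bounded (closure {x. \<rho> x \<noteq> 0}) \<and>
           \<rho> C1_differentiable_on UNIV"
proof (intro allI impI)
  fix eps :: real assume eps: "eps > 0"
  obtain D where D0: "D 0 = h"
    and D: "\<And>j x. j < 2 \<Longrightarrow> x \<in> {0..} \<Longrightarrow> (D j has_real_derivative D (Suc j) x) (at x within {0..})"
    and Dc: "\<And>j. j \<le> 2 \<Longrightarrow> continuous_on {0..} (D j)"
    using assms(2) unfolding Ck_on_def by blast
  define h' h'' where "h' = D 1" and "h'' = D 2"
  have d1: "(h has_real_derivative h' x) (at x within {0..})" if "0 \<le> x" for x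
    using D[of 0 x] that by (simp add: D0 h'_def)
  have d2: "(h' has_real_derivative h'' x) (at x within {0..})" if "0 \<le> x" for x
    using D[of 1 x] that by (simp add: h'_def h''_def numeral_2_eq_2)
  have d1': "deriv h x = h' x" and d2': "deriv h' x = h'' x" if "x > 0" for x
    using d1[of x] d2[of x] that at_within_interior[of x "{0..}"] by (auto intro!: DERIV_imp_deriv)
  have snd: "(deriv ^^ 2) h r = h'' r" if "r > 0" for r
  proof -
    have "\<forall>\<^sub>F x in nhds r. deriv h x = h' x"
      by (rule eventually_mono[OF eventually_nhds_in_open[of "{0<..}"]]) (use that d1' in auto)
    then have "deriv (deriv h) r = deriv h' r" by (rule deriv_cong_ev) simp
    then show ?thesis using d2'[OF that] by (simp add: numeral_2_eq_2)
  qed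
  have A: "A \<ge> 0" using assms(6)[of 1] by simp
  have bound: "\<bar>h'' r\<bar> \<le> 2 * (A / 4)" if r: "r > 0" for r
  proof -
    have "min (1 / sqrt r) (sqrt r) \<le> 1"
      using r by (cases "r \<le> 1") (auto simp: min_le_iff_disj)
    then have "A / 2 * min (1 / sqrt r) (sqrt r) \<le> A / 2 * 1" using A by (intro mult_left_mono) auto
    then show ?thesis using assms(6)[OF r] snd[OF r] by simp
  qed
  have h'0: "h' 0 = 0"
  proof -
    have "at (0::real) within {0..} \<noteq> bot" by (simp add: at_within_Ici_at_right trivial_limit_at_right_real)
    then show ?thesis using has_field_derivative_unique[OF d1[of 0] assms(5)] by simp
  qed
  interpret droplet_energy lam eps "A / 4" h h'
  proof
    show "\<bar>h b - h a - h' a * (b - a)\<bar> \<le> A / 4 * (b - a)\<^sup>2" if "0 \<le> a" "0 \<le> b" for a b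
      by (rule taylor_quadratic_bound[OF d1 d2 bound that])
  qed (use assms(1,4) eps A Dc[of 0] Dc[of 1] D0 h'0 in \<open>auto simp: h'_def\<close>)
  obtain u g where min: "is_minimizer u g" using minimizer_exists by blast
  then have p: "profile u g" by (simp add: is_minimizer_def)
  have rad: "radially_decreasing u" by (rule minimizer_radially_decreasing[OF min])
  have "energy lam h eps (density lborel u) \<le> energy lam h eps M" if "M \<in> P2" for M
  proof (cases "energy lam h eps M = \<infinity>")
    case False
    then obtain v k where "profile v k" "energy lam h eps M = ereal (J v k)"
      using energy_finite_imp_profile[OF \<open>M \<in> P2\<close>] by blast
    then show ?thesis using profile_energy(2)[OF p] min by (simp add: is_minimizer_def)
  qed simp
  then show "\<exists>\<rho> :: real \<Rightarrow> real. (\<forall>x. \<rho> x \<ge> 0) \<and> density lborel \<rho> \<in> P2 \<and>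
           (\<forall>M\<in>P2. energy lam h eps (density lborel \<rho>) \<le> energy lam h eps M) \<and>
           radially_decreasing \<rho> \<and> bounded (closure {x. \<rho> x \<noteq> 0}) \<and> \<rho> C1_differentiable_on UNIV"
    using profileD(3)[OF p] profile_energy(1)[OF p] rad minimizer_regular[OF min rad] by blast
qed

end
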